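(* Let $\phi:\mathbb R^N\to\mathbb R^m$ be a homogeneous polynomial harmonic morphism of degree $d\ge1$, with dilation $\lambda>0$ on its regular set. Suppose that on the regular set there is a function $\eta$ with $$d\phi(\nabla\lambda^2)=\eta(x)\,\phi(x).$$ Let $H$ be a nonzero homogeneous polynomial of degree $\ell>0$ on $\mathbb R^m$, put $G=H\circ\phi$ and $W_H=|\nabla H|^2$. Then, on the regular set, $$|\nabla G|^2=\lambda^2(W_H\circ\phi),\qquad \Delta G=\lambda^2(\Delta H)\circ\phi,\qquad \mathcal L(G)=\lambda^4\,\mathcal L(H)\circ\phi-\frac{\ell\eta}{2}(HW_H)\circ\phi .$$ Suppose further that a constant $\kappa\in\mathbb R$ satisfies $$\frac{|\phi(x)|^2\eta(x)}{2\lambda(x)^4}\le\kappa$$ at regular points with $\phi(x)\ne0$, and that $$|y|^2H(y)\,\mathcal L(H)(y)\ge\kappa\,\ell\,H(y)^2W_H(y)\qquad(y\in\mathbb R^m\setminus\{0\}).$$ Then $G\,\mathcal L(G)\ge0$ at regular points with $\phi(x)\ne0$. If in addition $G\not\equiv0$ and a closed algebraic set $Z\subset\mathbb R^N$ of dimension at most $N-2$ contains the critical set of $G$, the singular zeros of $G$, and the points excluded from this calculation (the non-regular points of $\phi$ and the points with $\phi(x)=0$), then $\{G<0\}$ is locally perimeter minimizing and $\partial[\![\{G<0\}]\!]$ is locally mass minimizing.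
   Context: For a smooth function $G$ on a Euclidean space, $\mathcal L(G)=|\nabla G|^2\Delta G-\frac12\langle\nabla|\nabla G|^2,\nabla G\rangle$. A homogeneous polynomial harmonic morphism $\phi=(\phi_1,\dots,\phi_m)$ satisfies $\Delta\phi_i=0$ and $\langle\nabla\phi_i,\nabla\phi_j\rangle=\lambda^2\delta_{ij}$; its regular set is where $d\phi\ne0$, i.e. where the dilation $\lambda$ is positive. Gradients, Laplacians and $\mathcal L$ of $G,\lambda^2$ are taken in $\mathbb R^N$, those of $H$ in $\mathbb R^m$. A set $E\subset\mathbb R^N$ of locally finite perimeter is locally perimeter minimizing if $\operatorname{Per}(E;U)\le\operatorname{Per}(K;U)$ for every $K$ of locally finite perimeter with $K\triangle E\Subset U$, $U$ bounded open. The current $\partial[\![E]\!]$ ($[\![E]\!]$ being integration over $E$ with standard orientation) is locally mass minimizing if its mass in $U$ is at most that of $\partial[\![E]\!]+\partial W$ for every bounded open $U$ and integral $N$-current $W$ compactly supported in $U$. *)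

theory Defs
  imports "HOL-Analysis.Analysis"
begin

section \<open>Differential operators on Euclidean space\<close>

definition grad :: "(real^'n \<Rightarrow> real) \<Rightarrow> real^'n \<Rightarrow> real^'n" where
  "grad f x = (\<chi> i. frechet_derivative f (at x) (axis i 1))"

definition divergence :: "(real^'n \<Rightarrow> real^'n) \<Rightarrow> real^'n \<Rightarrow> real" where
  "divergence T x = (\<Sum>i\<in>UNIV. frechet_derivative T (at x) (axis i 1) $ i)"

definition laplacian :: "(real^'n \<Rightarrow> real) \<Rightarrow> real^'n \<Rightarrow> real" where
  "laplacian f = divergence (grad f)"

definition level_op :: "(real^'n \<Rightarrow> real) \<Rightarrow> real^'n \<Rightarrow> real" where
  "level_op f x = (norm (grad f x))\<^sup>2 * laplacian f x
     - 1/2 * (grad (\<lambda>y. (norm (grad f y))\<^sup>2) x \<bullet> grad f x)"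

primrec C_k :: "nat \<Rightarrow> ('a::euclidean_space \<Rightarrow> 'b::euclidean_space) \<Rightarrow> bool" where
  "C_k 0 f \<longleftrightarrow> continuous_on UNIV f"
| "C_k (Suc k) f \<longleftrightarrow> (\<forall>x. f differentiable (at x)) \<and>
     (\<forall>v. C_k k (\<lambda>x. frechet_derivative f (at x) v))"

definition C_infinity :: "('a::euclidean_space \<Rightarrow> 'b::euclidean_space) \<Rightarrow> bool" where
  "C_infinity f \<longleftrightarrow> (\<forall>k. C_k k f)"


section \<open>Homogeneous polynomial harmonic morphisms\<close>

text \<open>A real linear combination of the finitely many monomials of degree \<open>d\<close>;
  the zero polynomial is homogeneous of every degree.\<close>

definition homogeneous_polynomial :: "nat \<Rightarrow> (real^'n \<Rightarrow> real) \<Rightarrow> bool" where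
  "homogeneous_polynomial d p \<longleftrightarrow>
     (\<exists>c. \<forall>x. p x =
        (\<Sum>\<alpha> | (\<Sum>i\<in>UNIV. \<alpha> i) = d. c \<alpha> * (\<Prod>i\<in>UNIV. (x $ i) ^ \<alpha> i)))"

definition regular_set :: "(real^'n \<Rightarrow> real^'m) \<Rightarrow> (real^'n) set" where
  "regular_set \<phi> = {x. frechet_derivative \<phi> (at x) \<noteq> (\<lambda>_. 0)}"

text \<open>Harmonicity and horizontal weak conformality with dilation \<open>\<lambda>\<close>. Outside the regular
  set the conformality equation forces \<open>\<lambda> = 0\<close>.\<close>

definition polynomial_harmonic_morphism ::
    "nat \<Rightarrow> (real^'n \<Rightarrow> real^'m) \<Rightarrow> (real^'n \<Rightarrow> real) \<Rightarrow> bool" where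
  "polynomial_harmonic_morphism d \<phi> lam \<longleftrightarrow>
     (\<forall>i. homogeneous_polynomial d (\<lambda>x. \<phi> x $ i)) \<and>
     (\<forall>i x. laplacian (\<lambda>x. \<phi> x $ i) x = 0) \<and>
     (\<forall>i j x. grad (\<lambda>x. \<phi> x $ i) x \<bullet> grad (\<lambda>x. \<phi> x $ j) x = (if i = j then (lam x)\<^sup>2 else 0)) \<and>
     (\<forall>x\<in>regular_set \<phi>. lam x > 0)"


section \<open>Real algebraic sets and their dimension\<close>

definition algebraic_set :: "(real^'n) set \<Rightarrow> bool" where
  "algebraic_set Z \<longleftrightarrow>
     (\<exists>P. (\<forall>p\<in>P. real_polynomial_function p) \<and> Z = {x. \<forall>p\<in>P. p x = 0})"

text \<open>Algebraic independence of \<open>p 0, \<dots>, p (k-1)\<close> in the coordinate ring of \<open>Z\<close>: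
  distinct monomials in the \<open>p i\<close> are linearly independent as functions on \<open>Z\<close>.
  A polynomial in \<open>k\<close> variables is given by its coefficients \<open>c\<close> on a finite set
  \<open>A\<close> of exponents.\<close>

definition algebraically_independent_on ::
    "(real^'n) set \<Rightarrow> nat \<Rightarrow> (nat \<Rightarrow> real^'n \<Rightarrow> real) \<Rightarrow> bool" where
  "algebraically_independent_on Z k p \<longleftrightarrow>
     (\<forall>(A :: (nat \<Rightarrow> nat) set) (c :: (nat \<Rightarrow> nat) \<Rightarrow> real).
        finite A \<and> (\<forall>\<alpha>\<in>A. \<forall>i\<ge>k. \<alpha> i = 0) \<and>
        (\<forall>x\<in>Z. (\<Sum>\<alpha>\<in>A. c \<alpha> * (\<Prod>i<k. p i x ^ \<alpha> i)) = 0)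
        \<longrightarrow> (\<forall>\<alpha>\<in>A. c \<alpha> = 0))"

text \<open>The transcendence degree (equivalently Krull dimension) of the coordinate ring of \<open>Z\<close>,
  that is, the maximal number of algebraically independent elements; for reducible \<open>Z\<close> this is
  the maximum over the irreducible components. The empty set has dimension \<open>-\<infinity>\<close>.\<close>

definition algebraic_dim :: "(real^'n) set \<Rightarrow> ereal" where
  "algebraic_dim Z =
     Sup {ereal (real k) | k. \<exists>p. (\<forall>i<k. real_polynomial_function (p i)) \<and>
                                  algebraically_independent_on Z k p}"


section \<open>Perimeter\<close>

definition test_fields :: "(real^'n) set \<Rightarrow> (real^'n \<Rightarrow> real^'n) set" where
  "test_fields U =
     {T. C_k 1 T \<and> compact (closure {x. T x \<noteq> 0}) \<and> closure {x. T x \<noteq> 0} \<subseteq> U}"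

definition perimeter :: "(real^'n) set \<Rightarrow> (real^'n) set \<Rightarrow> ereal" where
  "perimeter E U =
     (SUP T \<in> {T \<in> test_fields U. \<forall>x. norm (T x) \<le> 1}. ereal (LINT x:E|lebesgue. divergence T x))"

definition locally_finite_perimeter :: "(real^'n) set \<Rightarrow> bool" where
  "locally_finite_perimeter E \<longleftrightarrow>
     E \<in> sets lebesgue \<and> (\<forall>U. open U \<and> bounded U \<longrightarrow> perimeter E U < \<infinity>)"

definition locally_perimeter_minimizing :: "(real^'n) set \<Rightarrow> bool" where
  "locally_perimeter_minimizing E \<longleftrightarrow>
     locally_finite_perimeter E \<and>
     (\<forall>U K. open U \<and> bounded U \<and> locally_finite_perimeter K \<and>
        compact (closure ((K - E) \<union> (E - K))) \<and> closure ((K - E) \<union> (E - K)) \<subseteq> U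
        \<longrightarrow> perimeter E U \<le> perimeter K U)"


section \<open>Differential forms and currents\<close>

text \<open>A \<open>k\<close>-covector is an alternating \<open>k\<close>-linear function of \<open>v 0, \<dots>, v (k-1)\<close>; it is
  represented on sequences \<open>v\<close> and ignores the remaining entries.\<close>

definition alternating_form :: "nat \<Rightarrow> ((nat \<Rightarrow> real^'n) \<Rightarrow> real) \<Rightarrow> bool" where
  "alternating_form k \<alpha> \<longleftrightarrow>
     (\<forall>v w. (\<forall>i<k. v i = w i) \<longrightarrow> \<alpha> v = \<alpha> w) \<and>
     (\<forall>v. \<forall>i<k. linear (\<lambda>x. \<alpha> (v(i := x)))) \<and>
     (\<forall>v i j. i < k \<and> j < k \<and> i \<noteq> j \<and> v i = v j \<longrightarrow> \<alpha> v = 0)"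

text \<open>The comass norm is the supremum over unit simple \<open>k\<close>-vectors, each of which is
  \<open>v 0 \<and> \<dots> \<and> v (k-1)\<close> for an orthonormal family.\<close>

definition comass :: "nat \<Rightarrow> ((nat \<Rightarrow> real^'n) \<Rightarrow> real) \<Rightarrow> ennreal" where
  "comass k \<alpha> =
     (SUP v \<in> {v. \<forall>i<k. \<forall>j<k. v i \<bullet> v j = (if i = j then 1 else 0)}. ennreal \<bar>\<alpha> v\<bar>)"

type_synonym 'v dform = "'v \<Rightarrow> (nat \<Rightarrow> 'v) \<Rightarrow> real"

definition test_forms :: "nat \<Rightarrow> (real^'n) set \<Rightarrow> (real^'n) dform set" where
  "test_forms k U =
     {\<omega>. (\<forall>x. alternating_form k (\<omega> x)) \<and> (\<forall>v. C_infinity (\<lambda>x. \<omega> x v)) \<and>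
         compact (closure {x. \<omega> x \<noteq> (\<lambda>_. 0)}) \<and> closure {x. \<omega> x \<noteq> (\<lambda>_. 0)} \<subseteq> U}"

text \<open>\<open>d\<omega>(v\<^sub>0, \<dots>, v\<^sub>k) = \<Sum>\<^sub>i (-1)^i D\<^bsub>v\<^sub>i\<^esub> (\<omega>(v\<^sub>0, \<dots>, omit v\<^sub>i, \<dots>, v\<^sub>k))\<close> for a \<open>k\<close>-form
  \<open>\<omega>\<close> and constant vectors.\<close>

definition ext_deriv :: "nat \<Rightarrow> (real^'n) dform \<Rightarrow> (real^'n) dform" where
  "ext_deriv k \<omega> x v =
     (\<Sum>i\<le>k. (-1) ^ i *
        frechet_derivative (\<lambda>y. \<omega> y (\<lambda>j. if j < i then v j else v (Suc j))) (at x) (v i))"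

text \<open>A \<open>k\<close>-current is a functional on forms, of which only the values on
  \<open>test_forms k UNIV\<close> are relevant.\<close>

type_synonym 'v current = "'v dform \<Rightarrow> real"

text \<open>Boundary of a \<open>k\<close>-current, for \<open>k \<ge> 1\<close>.\<close>

definition current_boundary :: "nat \<Rightarrow> (real^'n) current \<Rightarrow> (real^'n) current" where
  "current_boundary k T = (\<lambda>\<omega>. T (ext_deriv (k - 1) \<omega>))"

definition current_mass :: "nat \<Rightarrow> (real^'n) current \<Rightarrow> (real^'n) set \<Rightarrow> ereal" where
  "current_mass k T U =
     (SUP \<omega> \<in> {\<omega> \<in> test_forms k U. \<forall>x. comass k (\<omega> x) \<le> 1}. ereal (T \<omega>))"

definition current_support :: "nat \<Rightarrow> (real^'n) current \<Rightarrow> (real^'n) set" where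
  "current_support k T = - \<Union>{V. open V \<and> (\<forall>\<omega>\<in>test_forms k V. T \<omega> = 0)}"

text \<open>The standard oriented frame \<open>e\<^sub>1, \<dots>, e\<^sub>N\<close>, in the order of the index type.\<close>

definition std_frame :: "nat \<Rightarrow> real^('n::{finite,linorder})" where
  "std_frame i = axis (sorted_list_of_set (UNIV :: 'n set) ! i) 1"

definition set_current ::
    "(real^('n::{finite,linorder})) set \<Rightarrow> (real^('n::{finite,linorder})) current" where
  "set_current E = (\<lambda>\<omega>. LINT x:E|lebesgue. \<omega> x std_frame)"

text \<open>Integral currents of top dimension \<open>N\<close>: integer rectifiable with boundary of finite mass.
  A rectifiable set carrying an \<open>N\<close>-current in \<open>\<real>^N\<close> is just a measurable set, with Hausdorff
  measure equal to Lebesgue measure; the integer multiplicity, extended by 0 and with the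
  orientation absorbed into its sign, is an integrable function \<open>\<theta> : \<real>^N \<rightarrow> \<int>\<close>.\<close>

definition integral_top_current :: "(real^('n::{finite,linorder})) current \<Rightarrow> bool" where
  "integral_top_current W \<longleftrightarrow>
     (\<exists>\<theta> :: real^('n::{finite,linorder}) \<Rightarrow> int.
        integrable lebesgue (\<lambda>x. real_of_int (\<theta> x)) \<and>
        W = (\<lambda>\<omega>. LINT x|lebesgue. real_of_int (\<theta> x) * \<omega> x std_frame)) \<and>
     current_mass (CARD('n) - 1) (current_boundary CARD('n) W) UNIV < \<infinity>"

text \<open>Local mass minimality of the \<open>(N-1)\<close>-current \<open>S\<close> among \<open>S + \<partial>W\<close>.\<close>

definition locally_mass_minimizing :: "(real^('n::{finite,linorder})) current \<Rightarrow> bool" where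
  "locally_mass_minimizing S \<longleftrightarrow>
     (\<forall>U W. open U \<and> bounded U \<and> integral_top_current W \<and>
        compact (current_support CARD('n) W) \<and> current_support CARD('n) W \<subseteq> U
        \<longrightarrow> current_mass (CARD('n) - 1) S U
             \<le> current_mass (CARD('n) - 1) (\<lambda>\<omega>. S \<omega> + current_boundary CARD('n) W \<omega>) U)"

end

theory Submission
  imports Defs
begin

text \<open>
  The identities are chain rules. The components of a harmonic morphism are harmonic with orthogonal
  gradients of common length \<open>\<lambda>\<close>, so \<open>\<nabla>(K \<circ> \<phi>) \<bullet> \<nabla>(L \<circ> \<phi>) = \<lambda>\<^sup>2 (\<nabla>K \<bullet> \<nabla>L) \<circ> \<phi>\<close> and
  \<open>\<Delta>(H \<circ> \<phi>) = \<lambda>\<^sup>2 (\<Delta>H) \<circ> \<phi>\<close>; differentiating \<open>\<bar>\<nabla>G\<bar>\<^sup>2 = \<lambda>\<^sup>2 (W \<circ> \<phi>)\<close> along \<open>\<nabla>G\<close> leaves one further term, the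
  derivative of \<open>G\<close> along \<open>\<nabla>\<lambda>\<^sup>2\<close>, which the hypothesis on \<open>\<eta>\<close> and Euler's identity turn into
  \<open>\<eta> l H\<close> (\<open>level_op_compose\<close>). After multiplication by \<open>\<bar>\<phi>\<bar>\<^sup>2\<close> the two inequalities with \<open>\<kappa>\<close> combine to
  \<open>G \<L>(G) \<ge> 0\<close>.

  Minimality is a calibration argument. Where \<open>\<nabla>G \<noteq> 0\<close>, the unit field \<open>\<nu> = \<nabla>G / \<bar>\<nabla>G\<bar>\<close> has divergence
  \<open>\<L>(G) / \<bar>\<nabla>G\<bar>\<^sup>3\<close>, which has the sign of \<open>G\<close>. Hence the flux of \<open>\<nu>\<close> out of a set cannot decrease when points
  of \<open>{G \<ge> 0}\<close> are added to \<open>{G < 0}\<close> or points of \<open>{G < 0}\<close> are removed (\<open>competitor_flux\<close>), while among all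
  unit fields \<open>\<nu>\<close> has the largest flux out of \<open>{G < 0}\<close>, being its outer normal (\<open>cut_normal_maximal_flux\<close>).
  The latter needs no boundary integral: if \<open>Y \<bullet> \<nabla>G \<ge> 0\<close>, then the flux of \<open>Y\<close> out of \<open>{G < 0}\<close> is a limit of
  the nonnegative numbers \<open>-\<integral> \<nabla>(f \<circ> G) \<bullet> Y\<close> with \<open>f\<close> decreasing (\<open>flux_nonneg\<close>).

  The field \<open>\<nu>\<close> is singular on \<open>Z\<close>, and is cut off there by functions \<open>\<psi>\<close> with small \<open>\<integral> \<bar>\<nabla>\<psi>\<bar>\<close>. These exist when
  \<open>Z\<close> has coverings by balls with arbitrarily small sum of the \<open>r\<^sup>N\<^sup>-\<^sup>1\<close> (\<open>codim1_null_cutoff\<close>), and the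
  algebraic dimension gives such coverings (\<open>algebraic_codim_two_null\<close>): for each variable \<open>x\<^sub>l\<close> the other
  \<open>N - 1\<close> coordinates satisfy a polynomial relation on \<open>Z\<close>, so at each point of \<open>Z\<close> some iterated partial
  derivative \<open>Q\<^sub>l\<close> of that relation vanishes with nonzero gradient, and \<open>\<nabla>Q\<^sub>l\<close> has no component along
  \<open>x\<^sub>l\<close>. Nonzero vectors with this property cannot all be parallel. Thus two of the \<open>Q\<^sub>l\<close> have independent
  gradients, and \<open>Z\<close> is contained in a finite union of sets of codimension two, which are locally Lipschitz
  graphs over \<open>N - 2\<close> coordinates.

  For currents, forms of degree \<open>N - 1\<close> correspond to vector fields, comass to length and exterior derivative
  to divergence. A competitor is then given by the indicator of \<open>{G < 0}\<close> plus an integer density \<open>\<theta>\<close> of compact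
  support. Truncation to \<open>[0, 1]\<close> makes it the indicator of a set that differs from \<open>{G < 0}\<close> only on the
  support of \<open>\<theta>\<close>; by mollification, truncation does not increase the total variation
  (\<open>truncation_flux\<close>), and the calibration applies to that set.
\<close>


section \<open>Differentiable and smooth functions\<close>

lemma C_k_SucI:
  assumes "\<And>x. (f has_derivative D x) (at x)" and "\<And>v. C_k k (\<lambda>x. D x v)"
  shows "C_k (Suc k) f"
proof -
  have "frechet_derivative f (at x) = D x" for x
    using assms(1) by (metis frechet_derivative_at)
  then show ?thesis
    using assms by (auto simp: differentiable_def)
qed

lemma C_k_SucE:
  assumes "C_k (Suc k) f"
  obtains D where "\<And>x. (f has_derivative D x) (at x)" and "\<And>v. C_k k (\<lambda>x. D x v)"
  using assms that[of "\<lambda>x. frechet_derivative f (at x)"] by (simp add: frechet_derivative_works)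

lemma C_k_Suc_imp: "C_k (Suc k) f \<Longrightarrow> C_k k f"
proof (induction k arbitrary: f)
  case 0
  then show ?case
    by (auto intro!: continuous_at_imp_continuous_on differentiable_imp_continuous_within)
next
  case (Suc k)
  from Suc.prems obtain D where D: "\<And>x. (f has_derivative D x) (at x)" "\<And>v. C_k (Suc k) (\<lambda>x. D x v)"
    by (rule C_k_SucE) blast
  show ?case
    by (rule C_k_SucI[OF D(1)]) (rule Suc.IH[OF D(2)])
qed

lemma C_k_0D: "C_k k f \<Longrightarrow> continuous_on UNIV f"
  by (induction k) (use C_k_Suc_imp in force)+

lemma C_k_const: "C_k k (\<lambda>x. c)"
proof (induction k arbitrary: c)
  case 0
  then show ?case by (auto intro: continuous_intros)
next
  case (Suc k)
  show ?case by (rule C_k_SucI[where D = "\<lambda>x h. 0"]) (auto intro: derivative_eq_intros Suc)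
qed

lemma C_k_bounded_linear: "bounded_linear L \<Longrightarrow> C_k k L"
proof (cases k)
  case 0
  assume "bounded_linear L" then show ?thesis
    using 0 by (simp add: linear_continuous_on)
next
  case (Suc m)
  assume L: "bounded_linear L"
  show ?thesis unfolding Suc
    by (rule C_k_SucI[where D = "\<lambda>x. L"]) (auto intro: bounded_linear_imp_has_derivative L C_k_const)
qed

lemma C_k_bounded_linear_comp: "bounded_linear L \<Longrightarrow> C_k k f \<Longrightarrow> C_k k (\<lambda>x. L (f x))"
proof (induction k arbitrary: f)
  case 0
  then show ?case by (simp add: bounded_linear.continuous_on)
next
  case (Suc k)
  from Suc.prems(2) obtain D where D: "\<And>x. (f has_derivative D x) (at x)" "\<And>v. C_k k (\<lambda>x. D x v)"
    by (rule C_k_SucE) blast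
  show ?case
    by (rule C_k_SucI[where D = "\<lambda>x h. L (D x h)"])
      (auto intro: bounded_linear.has_derivative Suc D)
qed

lemma C_k_add: "C_k k f \<Longrightarrow> C_k k g \<Longrightarrow> C_k k (\<lambda>x. f x + g x)"
proof (induction k arbitrary: f g)
  case 0
  then show ?case by (auto intro: continuous_intros)
next
  case (Suc k)
  from Suc.prems(1) obtain D where D: "\<And>x. (f has_derivative D x) (at x)" "\<And>v. C_k k (\<lambda>x. D x v)"
    by (rule C_k_SucE) blast
  from Suc.prems(2) obtain D' where D': "\<And>x. (g has_derivative D' x) (at x)" "\<And>v. C_k k (\<lambda>x. D' x v)"
    by (rule C_k_SucE) blast
  show ?case
    by (rule C_k_SucI[where D = "\<lambda>x h. D x h + D' x h"])
      (auto intro: has_derivative_add Suc.IH D D')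
qed

lemma C_k_sum: "(\<And>i. i \<in> I \<Longrightarrow> C_k k (f i)) \<Longrightarrow> C_k k (\<lambda>x. \<Sum>i\<in>I. f i x)"
  by (induction I rule: infinite_finite_induct) (auto intro: C_k_const C_k_add)

lemma C_k_bilinear:
  fixes pr :: "'b::euclidean_space \<Rightarrow> 'c::euclidean_space \<Rightarrow> 'd::euclidean_space"
  assumes bilin: "bounded_bilinear pr"
  shows "C_k k f \<Longrightarrow> C_k k g \<Longrightarrow> C_k k (\<lambda>x. pr (f x) (g x))"
proof (induction k arbitrary: f g)
  case 0
  then show ?case by (auto intro: bounded_bilinear.continuous_on[OF bilin])
next
  case (Suc k)
  from Suc.prems(1) obtain D where D: "\<And>x. (f has_derivative D x) (at x)" "\<And>v. C_k k (\<lambda>x. D x v)"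
    by (rule C_k_SucE) blast
  from Suc.prems(2) obtain D' where D': "\<And>x. (g has_derivative D' x) (at x)" "\<And>v. C_k k (\<lambda>x. D' x v)"
    by (rule C_k_SucE) blast
  show ?case
    by (rule C_k_SucI[where D = "\<lambda>x h. pr (f x) (D' x h) + pr (D x h) (g x)"])
      (auto intro!: bounded_bilinear.FDERIV[OF bilin] C_k_add Suc.IH D D' C_k_Suc_imp[OF Suc.prems(1)] C_k_Suc_imp[OF Suc.prems(2)])
qed

lemmas C_k_scaleR = C_k_bilinear[OF bounded_bilinear_scaleR]
lemmas C_k_mult = C_k_bilinear[OF bounded_bilinear_mult]
lemmas C_k_inner = C_k_bilinear[OF bounded_bilinear_inner]

lemma C_k_minus: "C_k k f \<Longrightarrow> C_k k (\<lambda>x. - f x)"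
  by (rule C_k_bounded_linear_comp[OF bounded_linear_minus[OF bounded_linear_ident]])

lemma C_k_diff: "C_k k f \<Longrightarrow> C_k k g \<Longrightarrow> C_k k (\<lambda>x. f x - g x)"
  using C_k_add[OF _ C_k_minus, of k f g] by simp

lemma C_k_compose: "C_k k g \<Longrightarrow> C_k k f \<Longrightarrow> C_k k (\<lambda>x. g (f x))"
proof (induction k arbitrary: f g)
  case 0
  then show ?case by (auto intro: continuous_on_compose2)
next
  case (Suc k)
  from Suc.prems(1) obtain D where D: "\<And>x. (g has_derivative D x) (at x)" "\<And>v. C_k k (\<lambda>x. D x v)"
    by (rule C_k_SucE) blast
  from Suc.prems(2) obtain D' where D': "\<And>x. (f has_derivative D' x) (at x)" "\<And>v. C_k k (\<lambda>x. D' x v)"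
    by (rule C_k_SucE) blast
  have eq: "D (f x) (D' x v) = (\<Sum>b\<in>Basis. (D' x v \<bullet> b) *\<^sub>R D (f x) b)" for x v
  proof -
    interpret bounded_linear "D (f x)" using has_derivative_bounded_linear[OF D(1)] .
    have "D (f x) (D' x v) = D (f x) (\<Sum>b\<in>Basis. (D' x v \<bullet> b) *\<^sub>R b)"
      by (simp add: euclidean_representation)
    also have "\<dots> = (\<Sum>b\<in>Basis. (D' x v \<bullet> b) *\<^sub>R D (f x) b)"
      by (simp add: sum scaleR)
    finally show ?thesis .
  qed
  show ?case
  proof (rule C_k_SucI)
    show "((\<lambda>x. g (f x)) has_derivative (\<lambda>v. D (f x) (D' x v))) (at x)" for x
      using has_derivative_compose[OF D'(1) D(1)] .
    show "C_k k (\<lambda>x. D (f x) (D' x v))" for v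
      unfolding eq
      by (intro C_k_sum C_k_scaleR C_k_inner C_k_const D' Suc.IH[OF D(2) C_k_Suc_imp[OF Suc.prems(2)]])
  qed
qed

lemma C_k_vec:
  fixes f :: "'a::euclidean_space \<Rightarrow> real^'n"
  shows "C_k k f \<longleftrightarrow> (\<forall>i. C_k k (\<lambda>x. f x $ i))"
proof
  assume "C_k k f"
  then show "\<forall>i. C_k k (\<lambda>x. f x $ i)"
    by (auto intro: C_k_bounded_linear_comp bounded_linear_vec_nth)
next
  assume *: "\<forall>i. C_k k (\<lambda>x. f x $ i)"
  have eq: "f = (\<lambda>x. \<Sum>i\<in>UNIV. f x $ i *\<^sub>R axis i 1)"
    by (auto simp: fun_eq_iff vec_eq_iff axis_def if_distrib cong: if_cong)
  show "C_k k f"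
    by (subst eq) (intro C_k_sum C_k_scaleR C_k_const, use * in blast)
qed

lemma C_k_real_polynomial: "real_polynomial_function p \<Longrightarrow> C_k k p"
  by (induction rule: real_polynomial_function.induct)
    (auto intro: C_k_bounded_linear C_k_const C_k_add C_k_mult)

lemma C_1I:
  assumes "\<And>x. (f has_derivative D x) (at x)" and "\<And>v. continuous_on UNIV (\<lambda>x. D x v)"
  shows "C_k 1 f"
  using C_k_SucI[of f D 0] assms by simp

lemma C_1_differentiable: "C_k 1 f \<Longrightarrow> f differentiable (at x)"
  by simp

lemma C_1_continuous_derivative: "C_k 1 f \<Longrightarrow> continuous_on UNIV (\<lambda>x. frechet_derivative f (at x) v)"
  by simp

lemma C_infinityD: "C_infinity f \<Longrightarrow> C_k k f"
  by (simp add: C_infinity_def)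


section \<open>Gradient and divergence\<close>

lemma grad_eqI: "(f has_derivative (\<lambda>h. g \<bullet> h)) (at x) \<Longrightarrow> grad f x = g"
  by (simp add: grad_def frechet_derivative_at[symmetric] vec_eq_iff inner_axis)

lemma grad_has_derivative:
  assumes "f differentiable (at x)"
  shows "(f has_derivative (\<lambda>h. grad f x \<bullet> h)) (at x)"
proof -
  let ?D = "frechet_derivative f (at x)"
  have D: "(f has_derivative ?D) (at x)"
    using assms by (simp add: frechet_derivative_works)
  interpret bounded_linear ?D using has_derivative_bounded_linear[OF D] .
  have "?D h = grad f x \<bullet> h" for h
  proof -
    have "h = (\<Sum>i\<in>UNIV. (h $ i) *\<^sub>R axis i 1)"
      by (auto simp: vec_eq_iff axis_def if_distrib cong: if_cong)
    then have "?D h = (\<Sum>i\<in>UNIV. (h $ i) *\<^sub>R ?D (axis i 1))"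
      using sum[of "\<lambda>i. (h $ i) *\<^sub>R axis i 1" UNIV] by (simp add: scaleR)
    then show ?thesis
      by (simp add: grad_def inner_vec_def mult.commute)
  qed
  then have "?D = (\<lambda>h. grad f x \<bullet> h)" by blast
  then show ?thesis using D by simp
qed

lemma grad_nth: "grad f x $ i = frechet_derivative f (at x) (axis i 1)"
  by (simp add: grad_def)

lemma frechet_derivative_grad: "f differentiable (at x) \<Longrightarrow> frechet_derivative f (at x) h = grad f x \<bullet> h"
  using frechet_derivative_at[OF grad_has_derivative[of f x]] by metis

lemma C_k_grad: "C_k (Suc k) f \<Longrightarrow> C_k k (grad f)"
  by (subst C_k_vec) (simp add: grad_nth)

lemma continuous_grad: "C_k 1 f \<Longrightarrow> continuous_on UNIV (grad f)"
  using C_k_grad[of 0 f] by simp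

lemma divergence_eqI: "(T has_derivative D) (at x) \<Longrightarrow> divergence T x = (\<Sum>i\<in>UNIV. D (axis i 1) $ i)"
  by (simp add: divergence_def frechet_derivative_at[symmetric])

lemma divergence_components:
  assumes "T differentiable (at x)"
  shows "divergence T x = (\<Sum>i\<in>UNIV. grad (\<lambda>y. T y $ i) x $ i)"
proof -
  let ?D = "frechet_derivative T (at x)"
  have D: "(T has_derivative ?D) (at x)"
    using assms by (simp add: frechet_derivative_works)
  have "((\<lambda>y. T y $ i) has_derivative (\<lambda>h. ?D h $ i)) (at x)" for i
    by (rule bounded_linear.has_derivative[OF bounded_linear_vec_nth D])
  from frechet_derivative_at[OF this, symmetric] show ?thesis
    by (simp add: divergence_def grad_nth)
qed

lemma divergence_scaleR:
  assumes "u differentiable (at x)" "T differentiable (at x)"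
  shows "divergence (\<lambda>y. u y *\<^sub>R T y) x = u x * divergence T x + grad u x \<bullet> T x"
proof -
  have D: "(T has_derivative frechet_derivative T (at x)) (at x)"
    using assms by (simp add: frechet_derivative_works)
  have "((\<lambda>y. u y *\<^sub>R T y) has_derivative
     (\<lambda>h. u x *\<^sub>R frechet_derivative T (at x) h + (grad u x \<bullet> h) *\<^sub>R T x)) (at x)"
    by (rule has_derivative_scaleR[OF grad_has_derivative[OF assms(1)] D])
  from divergence_eqI[OF this] show ?thesis
    by (simp add: divergence_def sum.distrib sum_distrib_left inner_axis) (simp add: inner_vec_def)
qed

lemma divergence_diff:
  assumes "S differentiable (at x)" "T differentiable (at x)"
  shows "divergence (\<lambda>y. S y - T y) x = divergence S x - divergence T x"
proof -
  have "((\<lambda>y. S y - T y) has_derivative (\<lambda>h. frechet_derivative S (at x) h - frechet_derivative T (at x) h)) (at x)"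
    using assms by (intro has_derivative_diff) (simp_all add: frechet_derivative_works)
  from divergence_eqI[OF this] show ?thesis
    by (simp add: divergence_def sum_subtractf)
qed

lemma divergence_sum:
  assumes "\<And>i. i \<in> I \<Longrightarrow> T i differentiable (at x)"
  shows "divergence (\<lambda>y. \<Sum>i\<in>I. T i y) x = (\<Sum>i\<in>I. divergence (T i) x)"
proof -
  have "((\<lambda>y. \<Sum>i\<in>I. T i y) has_derivative (\<lambda>h. \<Sum>i\<in>I. frechet_derivative (T i) (at x) h)) (at x)"
    using assms by (intro has_derivative_sum) (simp add: frechet_derivative_works)
  from divergence_eqI[OF this] show ?thesis
    by (simp add: divergence_def) (rule sum.swap)
qed

lemma grad_mult:
  assumes "u differentiable (at x)" "v differentiable (at x)"
  shows "grad (\<lambda>y. u y * v y) x = u x *\<^sub>R grad v x + v x *\<^sub>R grad u x"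
  by (rule grad_eqI)
    (use has_derivative_mult[OF grad_has_derivative[OF assms(1)] grad_has_derivative[OF assms(2)]]
      in \<open>simp add: inner_add_left algebra_simps\<close>)

lemma grad_compose_real:
  assumes "(g has_real_derivative g') (at (u x))" "u differentiable (at x)"
  shows "grad (\<lambda>y. g (u y)) x = g' *\<^sub>R grad u x"
proof (rule grad_eqI)
  have "(g has_derivative (\<lambda>h. g' * h)) (at (u x))"
    using assms(1) by (simp add: has_field_derivative_def)
  from has_derivative_compose[OF grad_has_derivative[OF assms(2)] this]
  show "((\<lambda>y. g (u y)) has_derivative (\<lambda>h. (g' *\<^sub>R grad u x) \<bullet> h)) (at x)"
    by simp
qed

lemma continuous_divergence: "C_k 1 T \<Longrightarrow> continuous_on UNIV (divergence T)"
  unfolding divergence_def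
  by (intro continuous_intros C_1_continuous_derivative)


section \<open>Composition with a polynomial harmonic morphism\<close>

lemma homogeneous_polynomial_real_polynomial:
  assumes "homogeneous_polynomial d p"
  shows "real_polynomial_function p"
proof -
  obtain c where c: "\<And>x. p x = (\<Sum>\<alpha> | (\<Sum>i\<in>UNIV. \<alpha> i) = d. c \<alpha> * (\<Prod>i\<in>UNIV. (x $ i) ^ \<alpha> i))"
    using assms unfolding homogeneous_polynomial_def by blast
  have "real_polynomial_function (\<lambda>x. \<Sum>\<alpha>\<in>A. c \<alpha> * (\<Prod>i\<in>UNIV. (x $ i) ^ \<alpha> i))" for A
  proof (cases "finite A")
    case True
    then show ?thesis
      by (intro real_polynomial_function_sum real_polynomial_function.intros(4)
          real_polynomial_function.intros(2) real_polynomial_function_prod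
          real_polynomial_function_power real_polynomial_function.intros(1) bounded_linear_vec_nth) auto
  next
    case False
    then show ?thesis by (simp add: real_polynomial_function.intros(2))
  qed
  moreover have "p = (\<lambda>x. \<Sum>\<alpha> | (\<Sum>i\<in>UNIV. \<alpha> i) = d. c \<alpha> * (\<Prod>i\<in>UNIV. (x $ i) ^ \<alpha> i))"
    using c by blast
  ultimately show ?thesis by simp
qed

lemma homogeneous_polynomial_scaleR:
  assumes "homogeneous_polynomial d p"
  shows "p (t *\<^sub>R x) = t ^ d * p x"
proof -
  obtain c where c: "\<And>x. p x = (\<Sum>\<alpha> | (\<Sum>i\<in>UNIV. \<alpha> i) = d. c \<alpha> * (\<Prod>i\<in>UNIV. (x $ i) ^ \<alpha> i))"
    using assms unfolding homogeneous_polynomial_def by blast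
  show ?thesis
    unfolding c sum_distrib_left
    by (intro sum.cong) (auto simp: power_mult_distrib prod.distrib power_sum algebra_simps)
qed

lemma euler_identity:
  assumes p: "homogeneous_polynomial d p"
  shows "grad p y \<bullet> y = real d * p y"
proof -
  have "p differentiable (at y)"
    using C_k_real_polynomial[OF homogeneous_polynomial_real_polynomial[OF p], of 1] by simp
  then have "(p has_derivative (\<lambda>h. grad p y \<bullet> h)) (at ((1::real) *\<^sub>R y))"
    by (simp add: grad_has_derivative)
  moreover have "((\<lambda>t::real. t *\<^sub>R y) has_derivative (\<lambda>s. s *\<^sub>R y)) (at 1)"
    by (auto intro: derivative_eq_intros)
  ultimately have 1: "((\<lambda>t::real. p (t *\<^sub>R y)) has_derivative (\<lambda>s. grad p y \<bullet> (s *\<^sub>R y))) (at 1)"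
    using has_derivative_compose[where f = "\<lambda>t::real. t *\<^sub>R y" and g = p] by blast
  have 2: "((\<lambda>t::real. t ^ d * p y) has_derivative (\<lambda>s. s * (real d * p y))) (at 1)"
    by (auto intro!: derivative_eq_intros)
  have "(\<lambda>s::real. grad p y \<bullet> (s *\<^sub>R y)) = (\<lambda>s. s * (real d * p y))"
    using has_derivative_unique[OF 1[unfolded homogeneous_polynomial_scaleR[OF p]] 2] .
  from fun_cong[OF this, of 1] show ?thesis by simp
qed

lemma grad_compose:
  fixes \<phi> :: "real^'n \<Rightarrow> real^'m"
  assumes \<phi>: "\<phi> differentiable (at x)" and K: "K differentiable (at (\<phi> x))"
  shows "grad (\<lambda>y. K (\<phi> y)) x = (\<Sum>a\<in>UNIV. (grad K (\<phi> x) $ a) *\<^sub>R grad (\<lambda>y. \<phi> y $ a) x)"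
proof (rule grad_eqI)
  let ?D = "frechet_derivative \<phi> (at x)"
  have D: "(\<phi> has_derivative ?D) (at x)" using \<phi> by (simp add: frechet_derivative_works)
  have "((\<lambda>y. \<phi> y $ a) has_derivative (\<lambda>h. ?D h $ a)) (at x)" for a
    by (rule bounded_linear.has_derivative[OF bounded_linear_vec_nth D])
  then have "?D h $ a = grad (\<lambda>y. \<phi> y $ a) x \<bullet> h" for a h
    by (metis (no_types, lifting) differentiable_def frechet_derivative_at frechet_derivative_grad)
  then have "grad K (\<phi> x) \<bullet> ?D h = (\<Sum>a\<in>UNIV. (grad K (\<phi> x) $ a) *\<^sub>R grad (\<lambda>y. \<phi> y $ a) x) \<bullet> h" for h
    by (subst inner_vec_def) (simp add: inner_sum_left)
  then show "((\<lambda>y. K (\<phi> y)) has_derivative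
      (\<lambda>h. (\<Sum>a\<in>UNIV. (grad K (\<phi> x) $ a) *\<^sub>R grad (\<lambda>y. \<phi> y $ a) x) \<bullet> h)) (at x)"
    using has_derivative_compose[OF D grad_has_derivative[OF K]] by simp
qed

locale harmonic_morphism =
  fixes d :: nat and \<phi> :: "real^'n \<Rightarrow> real^'m" and lam :: "real^'n \<Rightarrow> real"
  assumes morphism: "polynomial_harmonic_morphism d \<phi> lam"
begin

lemma smooth: "C_k k \<phi>"
  unfolding C_k_vec
proof
  fix i
  have "real_polynomial_function (\<lambda>x. \<phi> x $ i)"
    using morphism by (intro homogeneous_polynomial_real_polynomial)
      (auto simp: polynomial_harmonic_morphism_def)
  then show "C_k k (\<lambda>x. \<phi> x $ i)" by (rule C_k_real_polynomial)
qed

lemma differentiable: "\<phi> differentiable (at x)"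
  using smooth[of 1] by simp

lemma conformal:
  "grad (\<lambda>x. \<phi> x $ i) x \<bullet> grad (\<lambda>x. \<phi> x $ j) x = (if i = j then (lam x)\<^sup>2 else 0)"
  using morphism by (simp add: polynomial_harmonic_morphism_def)

lemma harmonic: "laplacian (\<lambda>x. \<phi> x $ i) x = 0"
  using morphism by (simp add: polynomial_harmonic_morphism_def)

lemma lam_sq_eq: "(\<lambda>x. (lam x)\<^sup>2) = (\<lambda>x. grad (\<lambda>x. \<phi> x $ i) x \<bullet> grad (\<lambda>x. \<phi> x $ i) x)"
  by (simp add: conformal)

lemma lam_sq_smooth: "C_k k (\<lambda>x. (lam x)\<^sup>2)"
  unfolding lam_sq_eq[of undefined]
  by (intro C_k_inner C_k_grad) (use smooth[of "Suc k"] C_k_vec in blast)+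

text \<open>In terms of the gradients of the components of \<open>\<phi>\<close> the inner product is a double sum, of which
  conformality leaves the diagonal.\<close>

lemma grad_inner_grad:
  assumes K: "K differentiable (at (\<phi> x))" and L: "L differentiable (at (\<phi> x))"
  shows "grad (\<lambda>y. K (\<phi> y)) x \<bullet> grad (\<lambda>y. L (\<phi> y)) x
    = (lam x)\<^sup>2 * (grad K (\<phi> x) \<bullet> grad L (\<phi> x))"
proof -
  have "grad (\<lambda>y. K (\<phi> y)) x \<bullet> grad (\<lambda>y. L (\<phi> y)) x
    = (\<Sum>a\<in>UNIV. \<Sum>b\<in>UNIV. grad K (\<phi> x) $ a * grad L (\<phi> x) $ b * (if a = b then (lam x)\<^sup>2 else 0))"
    unfolding grad_compose[OF differentiable K] grad_compose[OF differentiable L]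
    by (simp add: inner_sum_left inner_sum_right conformal mult.assoc sum_distrib_left)
      (subst sum.swap, simp add: mult.left_commute)
  also have "\<dots> = (lam x)\<^sup>2 * (grad K (\<phi> x) \<bullet> grad L (\<phi> x))"
    by (subst inner_vec_def) (simp add: if_distrib sum_distrib_left algebra_simps cong: if_cong)
  finally show ?thesis .
qed

text \<open>The chain rule for the Laplacian: harmonicity of the components kills the first-order
  term and conformality reduces the second-order term to a trace.\<close>

lemma laplacian_compose:
  assumes H: "C_k 2 H"
  shows "laplacian (\<lambda>y. H (\<phi> y)) x = (lam x)\<^sup>2 * laplacian H (\<phi> x)"
proof -
  have H2: "C_k (Suc (Suc 0)) H" using H by (simp only: numeral_2_eq_2)
  have gH: "C_k 1 (grad H)" using C_k_grad[OF H2] by simp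
  then have dH: "(\<lambda>y. grad H y $ a) differentiable (at z)" for a z
    using C_k_vec[of 1 "grad H"] C_1_differentiable by blast
  have H1: "H differentiable (at z)" for z using C_k_Suc_imp[OF H2] by simp
  have d\<phi>: "C_k 1 (grad (\<lambda>y. \<phi> y $ a))" for a
    using C_k_grad[of "Suc 0" "\<lambda>y. \<phi> y $ a"] smooth[of "Suc (Suc 0)", unfolded C_k_vec] by (metis One_nat_def)
  have dcomp: "(\<lambda>y. grad H (\<phi> y) $ a) differentiable (at x)" for a
    using differentiable_chain_at[OF differentiable dH] by (simp add: o_def)
  have "laplacian (\<lambda>y. H (\<phi> y)) x
    = divergence (\<lambda>y. \<Sum>a\<in>UNIV. (grad H (\<phi> y) $ a) *\<^sub>R grad (\<lambda>y. \<phi> y $ a) y) x"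
    unfolding laplacian_def using grad_compose[OF differentiable H1] by presburger
  also have "\<dots> = (\<Sum>a\<in>UNIV. divergence (\<lambda>y. (grad H (\<phi> y) $ a) *\<^sub>R grad (\<lambda>y. \<phi> y $ a) y) x)"
    by (intro divergence_sum differentiable_scaleR dcomp C_1_differentiable d\<phi>)
  also have "\<dots> = (\<Sum>a\<in>UNIV. (lam x)\<^sup>2 * (grad (\<lambda>y. grad H y $ a) (\<phi> x) $ a))"
  proof (rule sum.cong)
    fix a
    have "divergence (\<lambda>y. (grad H (\<phi> y) $ a) *\<^sub>R grad (\<lambda>y. \<phi> y $ a) y) x
      = grad (\<lambda>y. grad H (\<phi> y) $ a) x \<bullet> grad (\<lambda>y. \<phi> y $ a) x"
      using divergence_scaleR[OF dcomp C_1_differentiable[OF d\<phi>], of a a] harmonic[of a x]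
      by (simp add: laplacian_def)
    also have "\<dots> = (lam x)\<^sup>2 * (grad (\<lambda>y. grad H y $ a) (\<phi> x) \<bullet> grad (\<lambda>y. y $ a) (\<phi> x))"
      by (rule grad_inner_grad[of "\<lambda>y. grad H y $ a" x "\<lambda>y. y $ a"])
        (auto intro: dH bounded_linear_imp_differentiable bounded_linear_vec_nth)
    also have "grad (\<lambda>y. y $ a) (\<phi> x) = axis a 1"
      by (rule grad_eqI) (simp add: inner_axis' bounded_linear_imp_has_derivative bounded_linear_vec_nth)
    finally show "divergence (\<lambda>y. (grad H (\<phi> y) $ a) *\<^sub>R grad (\<lambda>y. \<phi> y $ a) y) x
      = (lam x)\<^sup>2 * (grad (\<lambda>y. grad H y $ a) (\<phi> x) $ a)"
      by (simp add: inner_axis)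
  qed simp
  also have "\<dots> = (lam x)\<^sup>2 * laplacian H (\<phi> x)"
    unfolding laplacian_def divergence_components[OF C_1_differentiable[OF gH]] sum_distrib_left ..
  finally show ?thesis .
qed

text \<open>By conformality \<open>\<bar>\<nabla>G\<bar>\<^sup>2 = \<lambda>\<^sup>2 (W \<circ> \<phi>)\<close> everywhere, so its derivative along \<open>\<nabla>G\<close> splits
  into \<open>\<lambda>\<^sup>4 \<nabla>W \<bullet> \<nabla>H\<close> and a term with \<open>\<nabla>\<lambda>\<^sup>2 \<bullet> \<nabla>G = dH(d\<phi>(\<nabla>\<lambda>\<^sup>2)) = \<eta> dH(\<phi>)\<close>, which Euler's
  identity evaluates.\<close>

lemma level_op_compose:
  assumes H: "homogeneous_polynomial l H"
    and \<eta>: "frechet_derivative \<phi> (at x) (grad (\<lambda>y. (lam y)\<^sup>2) x) = \<eta> *\<^sub>R \<phi> x"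
  shows "level_op (\<lambda>y. H (\<phi> y)) x = (lam x)^4 * level_op H (\<phi> x)
    - real l * \<eta> / 2 * (H (\<phi> x) * (norm (grad H (\<phi> x)))\<^sup>2)"
proof -
  define W where "W y = (norm (grad H y))\<^sup>2" for y
  define G where "G y = H (\<phi> y)" for y
  have H_smooth: "C_k k H" for k
    by (rule C_k_real_polynomial[OF homogeneous_polynomial_real_polynomial[OF H]])
  then have dH: "H differentiable (at y)" for y using C_1_differentiable by blast
  have W_smooth: "C_k k W" for k
    unfolding W_def power2_norm_eq_inner by (intro C_k_inner C_k_grad H_smooth)
  then have dW: "W differentiable (at y)" for y using C_1_differentiable by blast
  have nG: "(norm (grad G y))\<^sup>2 = (lam y)\<^sup>2 * W (\<phi> y)" for y
    unfolding power2_norm_eq_inner W_def G_def by (rule grad_inner_grad[OF dH dH])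
  have dW\<phi>: "(\<lambda>y. W (\<phi> y)) differentiable (at x)"
    using differentiable_chain_at[OF differentiable dW] by (simp add: o_def)
  have dlam: "(\<lambda>y. (lam y)\<^sup>2) differentiable (at x)"
    using lam_sq_smooth C_1_differentiable by blast
  have D: "(\<phi> has_derivative frechet_derivative \<phi> (at x)) (at x)"
    using differentiable by (simp add: frechet_derivative_works)
  have dG: "(G has_derivative (\<lambda>h. grad H (\<phi> x) \<bullet> frechet_derivative \<phi> (at x) h)) (at x)"
    unfolding G_def by (rule has_derivative_compose[OF D grad_has_derivative[OF dH]])
  have "grad G x \<bullet> grad (\<lambda>y. (lam y)\<^sup>2) x = grad H (\<phi> x) \<bullet> (\<eta> *\<^sub>R \<phi> x)"
    using frechet_derivative_grad[of G x] dG \<eta> frechet_derivative_at[OF dG] differentiable_def by metis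
  also have "\<dots> = \<eta> * (real l * H (\<phi> x))"
    using euler_identity[OF H] by simp
  finally have 1: "grad (\<lambda>y. (lam y)\<^sup>2) x \<bullet> grad G x = \<eta> * (real l * H (\<phi> x))"
    by (simp add: inner_commute)
  have 2: "grad (\<lambda>y. W (\<phi> y)) x \<bullet> grad G x = (lam x)\<^sup>2 * (grad W (\<phi> x) \<bullet> grad H (\<phi> x))"
    unfolding G_def by (rule grad_inner_grad[OF dW dH])
  have p4: "(lam x)^4 = (lam x)\<^sup>2 * (lam x)\<^sup>2" by (simp add: power2_eq_square power4_eq_xxxx)
  have "grad (\<lambda>y. (norm (grad G y))\<^sup>2) x \<bullet> grad G x
      = (lam x)^4 * (grad W (\<phi> x) \<bullet> grad H (\<phi> x)) + W (\<phi> x) * (\<eta> * (real l * H (\<phi> x)))"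
    unfolding nG grad_mult[OF dlam dW\<phi>] p4 inner_add_left inner_scaleR_left 1 2 by (simp only: mult.assoc)
  moreover have "laplacian G x = (lam x)\<^sup>2 * laplacian H (\<phi> x)"
    unfolding G_def by (rule laplacian_compose[OF H_smooth])
  ultimately show ?thesis
    unfolding level_op_def nG G_def[symmetric] W_def[symmetric] p4
    by (simp add: algebra_simps)
qed

lemma level_op_sign:
  assumes H: "homogeneous_polynomial l H"
    and \<eta>: "frechet_derivative \<phi> (at x) (grad (\<lambda>y. (lam y)\<^sup>2) x) = \<eta> *\<^sub>R \<phi> x"
    and x: "x \<in> regular_set \<phi>" "\<phi> x \<noteq> 0"
    and \<kappa>: "(norm (\<phi> x))\<^sup>2 * \<eta> / (2 * (lam x)^4) \<le> \<kappa>"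
    and ineq: "(norm (\<phi> x))\<^sup>2 * H (\<phi> x) * level_op H (\<phi> x)
      \<ge> \<kappa> * real l * (H (\<phi> x))\<^sup>2 * (norm (grad H (\<phi> x)))\<^sup>2"
  shows "H (\<phi> x) * level_op (\<lambda>y. H (\<phi> y)) x \<ge> 0"
proof -
  define r h w L q where "r = (norm (\<phi> x))\<^sup>2" and "h = H (\<phi> x)"
    and "w = (norm (grad H (\<phi> x)))\<^sup>2" and "L = level_op H (\<phi> x)" and "q = (lam x)^4"
  have "r > 0" using x by (simp add: r_def)
  have "lam x > 0" using morphism x by (simp add: polynomial_harmonic_morphism_def)
  then have "q > 0" by (simp add: q_def)
  have "r * \<eta> \<le> 2 * q * \<kappa>"
    using \<kappa> \<open>q > 0\<close> by (simp add: r_def[symmetric] q_def[symmetric] field_simps)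
  then have "(real l * h\<^sup>2 * w / 2) * (r * \<eta>) \<le> (real l * h\<^sup>2 * w / 2) * (2 * q * \<kappa>)"
    by (intro mult_left_mono) (auto simp: w_def)
  moreover have "q * (\<kappa> * real l * h\<^sup>2 * w) \<le> q * (r * h * L)"
    using ineq \<open>q > 0\<close> by (intro mult_left_mono) (auto simp: r_def h_def L_def w_def)
  ultimately have "0 \<le> r * (h * (q * L - real l * \<eta> / 2 * (h * w)))"
    by (simp add: algebra_simps power2_eq_square)
  then show ?thesis
    using \<open>r > 0\<close> zero_le_mult_iff[of r] unfolding level_op_compose[OF H \<eta>] h_def w_def L_def q_def by simp
qed

end


section \<open>Sets of vanishing codimension-one measure\<close>

text \<open>This is the condition \<open>\<H>\<^sup>N\<^sup>-\<^sup>1(A) = 0\<close>, expressed through coverings by balls.\<close>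

definition codim1_null :: "(real^'n) set \<Rightarrow> bool" where
  "codim1_null A \<longleftrightarrow> (\<forall>e>0. \<exists>(a :: nat \<Rightarrow> real^'n) r. (\<forall>k. r k \<ge> 0) \<and> A \<subseteq> (\<Union>k. ball (a k) (r k)) \<and>
     (\<Sum>k. ennreal (r k ^ (CARD('n) - 1))) \<le> ennreal e)"

lemma codim1_null_subset: "codim1_null B \<Longrightarrow> A \<subseteq> B \<Longrightarrow> codim1_null A"
  unfolding codim1_null_def by (meson subset_trans)

lemma codim1_null_Union_nat:
  fixes A :: "nat \<Rightarrow> (real^'n) set"
  assumes "\<And>i. codim1_null (A i)"
  shows "codim1_null (\<Union>i. A i)"
  unfolding codim1_null_def
proof (intro allI impI)
  fix e :: real assume "e > 0"
  have "\<exists>c. (\<forall>k. snd c k \<ge> 0) \<and> A i \<subseteq> (\<Union>k::nat. ball (fst c k) (snd c k)) \<and>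
     (\<Sum>k. ennreal (snd c k ^ (CARD('n) - 1))) \<le> ennreal (e * (1/2) ^ Suc i)" for i
  proof -
    have "e * (1/2) ^ Suc i > 0" using \<open>e > 0\<close> by simp
    then obtain a r where "\<forall>k. r k \<ge> 0" "A i \<subseteq> (\<Union>k::nat. ball (a k) (r k))"
      "(\<Sum>k. ennreal (r k ^ (CARD('n) - 1))) \<le> ennreal (e * (1/2) ^ Suc i)"
      using assms[of i, unfolded codim1_null_def, rule_format, OF \<open>e * (1/2) ^ Suc i > 0\<close>]
      by (elim exE conjE)
    then show ?thesis by (intro exI[of _ "(a, r)"]) simp
  qed
  then obtain c where c: "\<And>i. (\<forall>k. snd (c i) k \<ge> 0) \<and> A i \<subseteq> (\<Union>k::nat. ball (fst (c i) k) (snd (c i) k)) \<and>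
     (\<Sum>k. ennreal (snd (c i) k ^ (CARD('n) - 1))) \<le> ennreal (e * (1/2) ^ Suc i)"
    using choice[of "\<lambda>i c. (\<forall>k. snd c k \<ge> 0) \<and> A i \<subseteq> (\<Union>k::nat. ball (fst c k) (snd c k)) \<and>
     (\<Sum>k. ennreal (snd c k ^ (CARD('n) - 1))) \<le> ennreal (e * (1/2) ^ Suc i)"] by blast
  define a r where "a i = fst (c i)" and "r i = snd (c i)" for i
  have r: "\<And>i k. r i k \<ge> 0" and A: "\<And>i. A i \<subseteq> (\<Union>k::nat. ball (a i k) (r i k))"
    and s: "\<And>i. (\<Sum>k. ennreal (r i k ^ (CARD('n) - 1))) \<le> ennreal (e * (1/2) ^ Suc i)"
    using c by (auto simp: a_def r_def)
  define a' r' where "a' k = (case prod_decode k of (i, j) \<Rightarrow> a i j)"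
    and "r' k = (case prod_decode k of (i, j) \<Rightarrow> r i j)" for k
  have "(\<Sum>k. ennreal (r' k ^ (CARD('n) - 1)))
      = (\<Sum>i. \<Sum>k. ennreal (r i k ^ (CARD('n) - 1)))"
    using suminf_ennreal_2dimen[of "\<lambda>i. \<Sum>k. ennreal (r i k ^ (CARD('n) - 1))"
        "\<lambda>(i, k). ennreal (r i k ^ (CARD('n) - 1))"]
    by (simp add: r'_def split_beta)
  also have "\<dots> \<le> (\<Sum>i. ennreal (e * (1/2) ^ Suc i))"
    using s by (intro suminf_le) auto
  also have "\<dots> = ennreal e"
    using sums_mult[OF power_half_series, of e] \<open>e > 0\<close> by (intro suminf_ennreal_eq) auto
  finally have "(\<Sum>k. ennreal (r' k ^ (CARD('n) - 1))) \<le> ennreal e" .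
  moreover have "(\<Union>i. A i) \<subseteq> (\<Union>k. ball (a' k) (r' k))"
  proof
    fix x assume "x \<in> (\<Union>i. A i)"
    then obtain i k where "x \<in> ball (a i k) (r i k)" using A by blast
    then have "x \<in> ball (a' (prod_encode (i, k))) (r' (prod_encode (i, k)))"
      by (simp add: a'_def r'_def)
    then show "x \<in> (\<Union>k. ball (a' k) (r' k))" by blast
  qed
  moreover have "\<forall>k. r' k \<ge> 0" by (simp add: r'_def r split_beta)
  ultimately show "\<exists>a r. (\<forall>k. r k \<ge> 0) \<and> (\<Union>i. A i) \<subseteq> (\<Union>k::nat. ball (a k) (r k)) \<and>
     (\<Sum>k. ennreal (r k ^ (CARD('n) - 1))) \<le> ennreal e" by blast
qed

lemma codim1_null_finite_cover:
  fixes A :: "(real^'n) set"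
  assumes N: "CARD('n) \<ge> 2"
    and cover: "\<And>e. e > 0 \<Longrightarrow> \<exists>(I :: 'i set) a r. finite I \<and> (\<forall>i\<in>I. r i \<ge> 0) \<and>
      A \<subseteq> (\<Union>i\<in>I. ball (a i) (r i)) \<and> (\<Sum>i\<in>I. r i ^ (CARD('n) - 1)) \<le> e"
  shows "codim1_null A"
  unfolding codim1_null_def
proof (intro allI impI)
  fix e :: real assume "e > 0"
  from cover[OF this] obtain I :: "'i set" and a r where I: "finite I" "\<And>i. i \<in> I \<Longrightarrow> r i \<ge> 0"
    "A \<subseteq> (\<Union>i\<in>I. ball (a i) (r i))" "(\<Sum>i\<in>I. r i ^ (CARD('n) - 1)) \<le> e" by blast
  obtain h where h: "bij_betw h {0..<card I} I"
    using ex_bij_betw_nat_finite[OF I(1)] by blast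
  define r' where "r' k = (if k < card I then r (h k) else 0)" for k
  have hI: "k < card I \<Longrightarrow> h k \<in> I" for k using h by (auto simp: bij_betw_def)
  have "(\<Sum>k. ennreal (r' k ^ (CARD('n) - 1))) = (\<Sum>k\<in>{0..<card I}. ennreal (r' k ^ (CARD('n) - 1)))"
    using N by (intro suminf_finite) (auto simp: r'_def)
  also have "\<dots> = ennreal (\<Sum>k\<in>{0..<card I}. r (h k) ^ (CARD('n) - 1))"
    using I(2) hI by (subst sum_ennreal[symmetric]) (auto simp: r'_def intro!: sum.cong)
  also have "(\<Sum>k\<in>{0..<card I}. r (h k) ^ (CARD('n) - 1)) = (\<Sum>i\<in>I. r i ^ (CARD('n) - 1))"
    by (rule sum.reindex_bij_betw[OF h])
  finally have "(\<Sum>k. ennreal (r' k ^ (CARD('n) - 1))) \<le> ennreal e"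
    using I(4) by (simp add: ennreal_leI)
  moreover have "A \<subseteq> (\<Union>k. ball (a (h k)) (r' k))"
  proof
    fix x assume "x \<in> A"
    then obtain i where "i \<in> I" "x \<in> ball (a i) (r i)" using I(3) by blast
    moreover have "i \<in> h ` {0..<card I}" using h \<open>i \<in> I\<close> by (simp add: bij_betw_def)
    then obtain k where "k < card I" "h k = i" by auto
    ultimately have "x \<in> ball (a (h k)) (r' k)" by (simp add: r'_def)
    then show "x \<in> (\<Union>k. ball (a (h k)) (r' k))" by blast
  qed
  moreover have "\<forall>k. r' k \<ge> 0" using I(2) hI by (simp add: r'_def)
  ultimately show "\<exists>a r. (\<forall>k. r k \<ge> 0) \<and> A \<subseteq> (\<Union>k::nat. ball (a k) (r k)) \<and>
     (\<Sum>k. ennreal (r k ^ (CARD('n) - 1))) \<le> ennreal e"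
    by (intro exI[of _ "\<lambda>k. a (h k)"] exI[of _ r']) blast
qed

lemma codim1_null_empty: "CARD('n) \<ge> 2 \<Longrightarrow> codim1_null ({} :: (real^'n) set)"
  by (rule codim1_null_finite_cover[where 'i = nat]) (auto intro: exI[of _ "{}"])

lemma codim1_null_UN:
  fixes A :: "'i \<Rightarrow> (real^'n) set"
  assumes "CARD('n) \<ge> 2" "countable I" "\<And>i. i \<in> I \<Longrightarrow> codim1_null (A i)"
  shows "codim1_null (\<Union>i\<in>I. A i)"
proof (cases "I = {}")
  case True
  then show ?thesis using codim1_null_empty[OF assms(1)] by simp
next
  case False
  have "(\<Union>i\<in>I. A i) = (\<Union>k. A (from_nat_into I k))"
    using range_from_nat_into[OF False assms(2)] by (metis image_image)
  moreover have "codim1_null (\<Union>k. A (from_nat_into I k))"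
    using assms(3) from_nat_into[OF False] by (intro codim1_null_Union_nat) blast
  ultimately show ?thesis by simp
qed

text \<open>By the Lindeloef property, countably many of the neighbourhoods suffice.\<close>

lemma codim1_null_local:
  fixes A :: "(real^'n) set"
  assumes N: "CARD('n) \<ge> 2"
    and loc: "\<And>x. x \<in> A \<Longrightarrow> \<exists>U. open U \<and> x \<in> U \<and> codim1_null (A \<inter> U)"
  shows "codim1_null A"
proof -
  let ?F = "{U. open U \<and> codim1_null (A \<inter> U)}"
  obtain F' where F': "F' \<subseteq> ?F" "countable F'" "\<Union>F' = \<Union>?F"
    using Lindelof[of ?F] by auto
  have "codim1_null (\<Union>U\<in>F'. A \<inter> U)"
    using F' by (intro codim1_null_UN N) auto
  moreover have "A \<subseteq> (\<Union>U\<in>F'. A \<inter> U)"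
    using loc F'(3) by blast
  ultimately show ?thesis by (rule codim1_null_subset)
qed

text \<open>A bounded piece of a Lipschitz graph over \<open>N - 2\<close> of the coordinates is covered by
  \<open>O(k\<^sup>N\<^sup>-\<^sup>2)\<close> balls of radius \<open>O(1/k)\<close>: one for each grid cell of side \<open>1/k\<close> in those coordinates.\<close>

lemma codim1_null_lipschitz_graph:
  fixes M :: "(real^'n) set"
  assumes ab: "a \<noteq> b" and bdd: "\<And>p j. p \<in> M \<Longrightarrow> \<bar>p $ j\<bar> \<le> R"
    and lip: "\<And>p q t. p \<in> M \<Longrightarrow> q \<in> M \<Longrightarrow> t \<ge> 0 \<Longrightarrow> (\<And>j. j \<noteq> a \<Longrightarrow> j \<noteq> b \<Longrightarrow> \<bar>p $ j - q $ j\<bar> \<le> t)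
      \<Longrightarrow> \<bar>p $ a - q $ a\<bar> \<le> L * t \<and> \<bar>p $ b - q $ b\<bar> \<le> L * t"
    and L: "L \<ge> 0"
  shows "codim1_null M"
proof -
  have N: "CARD('n) \<ge> 2"
    using ab card_mono[of "UNIV :: 'n set" "{a, b}"] by simp
  show ?thesis
  proof (rule codim1_null_finite_cover[OF N])
    fix e :: real assume e: "e > 0"
    define R' where "R' = max R 0"
    define C where "C = real CARD('n) * (L + 1) + 1"
    have C: "C > 0" using L by (simp add: C_def add_nonneg_pos)
    define D where "D = (2 * R' + 3) ^ (CARD('n) - 2) * C ^ (CARD('n) - 1)"
    have "D \<ge> 0" using C by (simp add: D_def R'_def)
    obtain k :: nat where k: "D / e < real k" using reals_Archimedean2 by blast
    then have k0: "k > 0" using \<open>D \<ge> 0\<close> e by (metis divide_nonneg_pos gr0I not_less of_nat_0)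
    define cell where "cell p = (\<lambda>j. if j = a \<or> j = b then 0 else \<lfloor>real k * p $ j\<rfloor>)" for p :: "real^'n"
    define I where "I = cell ` M"
    define box where "box = (\<Pi>\<^sub>E j\<in>UNIV. if j = a \<or> j = b then {0} else {-\<lceil>real k * R'\<rceil> .. \<lceil>real k * R'\<rceil>})"
    have "I \<subseteq> box"
    proof
      fix c assume "c \<in> I"
      then obtain p where p: "p \<in> M" "c = cell p" by (auto simp: I_def)
      have "-\<lceil>real k * R'\<rceil> \<le> \<lfloor>real k * p $ j\<rfloor> \<and> \<lfloor>real k * p $ j\<rfloor> \<le> \<lceil>real k * R'\<rceil>" for j
      proof -
        have "\<bar>p $ j\<bar> \<le> R'" using bdd[OF p(1), of j] by (simp add: R'_def)
        then have "\<bar>real k * p $ j\<bar> \<le> real k * R'" by (simp add: abs_mult mult_left_mono)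
        then show ?thesis by linarith
      qed
      then show "c \<in> box" by (auto simp: box_def cell_def p)
    qed
    have fin_box: "finite box" by (auto simp: box_def intro!: finite_PiE)
    then have fin: "finite I" using \<open>I \<subseteq> box\<close> finite_subset by blast
    have "real (card I) \<le> real (card box)"
      using card_mono[OF fin_box \<open>I \<subseteq> box\<close>] by simp
    also have "real (card box) = (\<Prod>j\<in>UNIV. if j = a \<or> j = b then 1 else real (nat (2 * \<lceil>real k * R'\<rceil> + 1)))"
      unfolding box_def by (subst card_PiE) (auto intro!: prod.cong)
    also have "\<dots> = (\<Prod>j\<in>UNIV - {a, b}. real (nat (2 * \<lceil>real k * R'\<rceil> + 1)))"
      by (rule prod.mono_neutral_cong_right) auto
    also have "\<dots> = real (nat (2 * \<lceil>real k * R'\<rceil> + 1)) ^ (CARD('n) - 2)"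
      using ab by (simp add: card_Diff_subset numeral_2_eq_2)
    also have "\<dots> \<le> (real k * (2 * R' + 3)) ^ (CARD('n) - 2)"
    proof (rule power_mono)
      have "real k * R' \<ge> 0" by (simp add: R'_def)
      then have "\<lceil>real k * R'\<rceil> \<ge> 0" by linarith
      then have "real (nat (2 * \<lceil>real k * R'\<rceil> + 1)) = 2 * of_int \<lceil>real k * R'\<rceil> + 1" by simp
      also have "\<dots> \<le> 2 * (real k * R') + 3" by linarith
      also have "\<dots> \<le> real k * (2 * R' + 3)" using k0 by (simp add: algebra_simps)
      finally show "real (nat (2 * \<lceil>real k * R'\<rceil> + 1)) \<le> real k * (2 * R' + 3)" .
    qed simp
    finally have card: "real (card I) \<le> (real k * (2 * R' + 3)) ^ (CARD('n) - 2)" .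
    show "\<exists>(I :: ('n \<Rightarrow> int) set) a r. finite I \<and> (\<forall>i\<in>I. r i \<ge> 0) \<and>
      M \<subseteq> (\<Union>i\<in>I. ball (a i) (r i)) \<and> (\<Sum>i\<in>I. r i ^ (CARD('n) - 1)) \<le> e"
    proof (intro exI conjI ballI)
      define pt where "pt c = (SOME p. p \<in> M \<and> cell p = c)" for c
      have pt: "pt c \<in> M \<and> cell (pt c) = c" if "c \<in> I" for c
        unfolding pt_def by (rule someI_ex) (use that in \<open>auto simp: I_def\<close>)
      show "finite I" by (rule fin)
      show "C / real k \<ge> 0" using C by simp
      show "M \<subseteq> (\<Union>c\<in>I. ball (pt c) (C / real k))"
      proof
        fix p assume p: "p \<in> M"
        define q where "q = pt (cell p)"
        have q: "q \<in> M" "cell q = cell p" using pt[of "cell p"] p by (auto simp: q_def I_def)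
        have near: "\<bar>q $ j - p $ j\<bar> \<le> 1 / real k" if "j \<noteq> a" "j \<noteq> b" for j
        proof -
          have "\<lfloor>real k * q $ j\<rfloor> = \<lfloor>real k * p $ j\<rfloor>"
            using fun_cong[OF q(2), of j] that by (simp add: cell_def)
          then have "\<bar>real k * q $ j - real k * p $ j\<bar> \<le> 1" by linarith
          then have "real k * \<bar>q $ j - p $ j\<bar> \<le> 1"
            by (simp add: abs_mult flip: right_diff_distrib)
          then show ?thesis using k0 by (simp add: field_simps)
        qed
        have ab': "\<bar>q $ a - p $ a\<bar> \<le> L * (1 / real k) \<and> \<bar>q $ b - p $ b\<bar> \<le> L * (1 / real k)"
          by (rule lip[OF q(1) p]) (use near in auto)
        have all: "\<bar>(q - p) $ j\<bar> \<le> (L + 1) / real k" for j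
        proof (cases "j = a \<or> j = b")
          case True
          then have "\<bar>q $ j - p $ j\<bar> \<le> L / real k" using ab' by auto
          also have "\<dots> \<le> (L + 1) / real k" by (simp add: divide_right_mono)
          finally show ?thesis by simp
        next
          case False
          then have "\<bar>q $ j - p $ j\<bar> \<le> 1 / real k" using near by blast
          also have "\<dots> \<le> (L + 1) / real k" using L by (simp add: divide_right_mono)
          finally show ?thesis by simp
        qed
        have "norm (q - p) \<le> (\<Sum>j\<in>UNIV. \<bar>(q - p) $ j\<bar>)" by (rule norm_le_l1_cart)
        also have "\<dots> \<le> real CARD('n) * ((L + 1) / real k)"
          by (rule order_trans[OF sum_bounded_above[of UNIV _ "(L + 1) / real k", OF all]]) simp
        also have "\<dots> < C / real k"
          using k0 by (simp add: C_def divide_strict_right_mono)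
        finally have "p \<in> ball q (C / real k)" by (simp add: dist_norm)
        then show "p \<in> (\<Union>c\<in>I. ball (pt c) (C / real k))"
          using p by (auto simp: q_def I_def)
      qed
      have "(\<Sum>c\<in>I. (C / real k) ^ (CARD('n) - 1)) = real (card I) * (C / real k) ^ (CARD('n) - 1)"
        by simp
      also have "\<dots> \<le> (real k * (2 * R' + 3)) ^ (CARD('n) - 2) * (C / real k) ^ (CARD('n) - 1)"
        using C by (intro mult_right_mono card) simp
      also have "\<dots> = D / real k"
      proof -
        have "CARD('n) - 1 = Suc (CARD('n) - 2)" using N by simp
        then show ?thesis
          using k0 by (simp add: D_def power_mult_distrib power_divide)
      qed
      also have "\<dots> \<le> e" using k k0 e by (simp add: field_simps)
      finally show "(\<Sum>c\<in>I. (C / real k) ^ (CARD('n) - 1)) \<le> e" .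
    qed
  qed
qed


lemma C1_linearization_bound:
  fixes u :: "real^'n \<Rightarrow> real"
  assumes u: "C_k 1 u" and osc: "\<And>y. y \<in> ball x \<delta> \<Longrightarrow> norm (grad u y - grad u x) \<le> e"
    and "p \<in> ball x \<delta>" "q \<in> ball x \<delta>"
  shows "\<bar>u p - u q - grad u x \<bullet> (p - q)\<bar> \<le> e * norm (p - q)"
proof -
  have "norm ((u p - grad u x \<bullet> p) - (u q - grad u x \<bullet> q)) \<le> e * norm (p - q)"
  proof (rule differentiable_bound[OF convex_ball _ _ assms(3,4)])
    fix y assume y: "y \<in> ball x \<delta>"
    show "((\<lambda>z. u z - grad u x \<bullet> z) has_derivative (\<lambda>h. (grad u y - grad u x) \<bullet> h)) (at y within ball x \<delta>)"
      using has_derivative_at_withinI[OF grad_has_derivative[OF C_1_differentiable[OF u]]]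
      by (auto intro!: derivative_eq_intros simp: inner_diff_left)
    show "onorm (\<lambda>h. (grad u y - grad u x) \<bullet> h) \<le> e"
    proof (rule onorm_le)
      fix h
      show "norm ((grad u y - grad u x) \<bullet> h) \<le> e * norm h"
        using Cauchy_Schwarz_ineq2[of "grad u y - grad u x" h] osc[OF y]
        by (simp add: mult_right_mono order_trans[of _ "norm (grad u y - grad u x) * norm h"])
    qed
  qed
  then show ?thesis by (simp add: algebra_simps)
qed

lemma C1_strict_derivative:
  fixes u :: "real^'n \<Rightarrow> real"
  assumes u: "C_k 1 u" and e: "e > 0"
  shows "\<exists>\<delta>>0. \<forall>p\<in>ball x \<delta>. \<forall>q\<in>ball x \<delta>. \<bar>u p - u q - grad u x \<bullet> (p - q)\<bar> \<le> e * norm (p - q)"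
proof -
  have "isCont (grad u) x"
    using continuous_grad[OF u] by (simp add: continuous_on_eq_continuous_at)
  then obtain \<delta> where \<delta>: "\<delta> > 0" "\<And>y. dist y x < \<delta> \<Longrightarrow> dist (grad u y) (grad u x) < e"
    using e unfolding continuous_at_eps_delta by blast
  have "norm (grad u y - grad u x) \<le> e" if "y \<in> ball x \<delta>" for y
    using \<delta>(2)[of y] that by (simp add: dist_commute) (simp add: dist_norm norm_minus_commute)
  then show ?thesis using \<delta>(1) C1_linearization_bound[OF u] by blast
qed

text \<open>The two linearised equations, solved for the increments of the coordinates \<open>a\<close> and \<open>b\<close> by
  Cramer's rule, bound these increments by those of the other coordinates. Hence each point has a
  neighbourhood in which the set is contained in a Lipschitz graph.\<close>

lemma codim1_null_codim_two:
  fixes u v :: "real^'n \<Rightarrow> real"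
  assumes ab: "a \<noteq> b" and u: "C_k 1 u" and v: "C_k 1 v"
  shows "codim1_null {x. u x = 0 \<and> v x = 0 \<and>
    grad u x $ a * grad v x $ b - grad u x $ b * grad v x $ a \<noteq> 0}" (is "codim1_null ?M")
proof (rule codim1_null_local)
  show "CARD('n) \<ge> 2"
    using ab card_mono[of "UNIV :: 'n set" "{a, b}"] by simp
  fix x assume x: "x \<in> ?M"
  define g h where "g = grad u x" and "h = grad v x"
  define \<Delta> where "\<Delta> = \<bar>g $ a * h $ b - g $ b * h $ a\<bar>"
  define K where "K = norm g + norm h + 1"
  define n where "n = real CARD('n)"
  \<comment> \<open>With this linearisation error at most half of the left-hand side has to be absorbed at the end.\<close>
  define e where "e = \<Delta> / (8 * K)"
  have \<Delta>: "\<Delta> > 0" using x by (simp add: \<Delta>_def g_def h_def)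
  have K: "K > 0" by (simp add: K_def add_nonneg_pos)
  have e: "e > 0" using \<Delta> K by (simp add: e_def)
  obtain \<delta>1 where \<delta>1: "\<delta>1 > 0" "\<And>p q. p \<in> ball x \<delta>1 \<Longrightarrow> q \<in> ball x \<delta>1 \<Longrightarrow> \<bar>u p - u q - g \<bullet> (p - q)\<bar> \<le> e * norm (p - q)"
    using C1_strict_derivative[OF u e, of x] unfolding g_def by blast
  obtain \<delta>2 where \<delta>2: "\<delta>2 > 0" "\<And>p q. p \<in> ball x \<delta>2 \<Longrightarrow> q \<in> ball x \<delta>2 \<Longrightarrow> \<bar>v p - v q - h \<bullet> (p - q)\<bar> \<le> e * norm (p - q)"
    using C1_strict_derivative[OF v e, of x] unfolding h_def by blast
  define \<delta> where "\<delta> = min \<delta>1 \<delta>2"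
  define L where "L = 8 * K * n * (K + e) / \<Delta>"
  have "codim1_null (?M \<inter> ball x \<delta>)"
  proof (rule codim1_null_lipschitz_graph[OF ab])
    fix p j assume "p \<in> ?M \<inter> ball x \<delta>"
    then have "norm (p - x) \<le> \<delta>" by (simp add: dist_norm norm_minus_commute)
    moreover have "\<bar>p $ j\<bar> \<le> norm p" by (rule component_le_norm_cart)
    ultimately show "\<bar>p $ j\<bar> \<le> norm x + \<delta>" using norm_triangle_sub[of p x] by linarith
  next
    show "L \<ge> 0" using K e \<Delta> by (simp add: L_def n_def)
  next
    fix p q and t :: real
    assume p: "p \<in> ?M \<inter> ball x \<delta>" and q: "q \<in> ?M \<inter> ball x \<delta>" and t: "t \<ge> 0"
      and near: "\<And>j. j \<noteq> a \<Longrightarrow> j \<noteq> b \<Longrightarrow> \<bar>p $ j - q $ j\<bar> \<le> t"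
    define w where "w = p - q"
    define s where "s = \<bar>w $ a\<bar> + \<bar>w $ b\<bar>"
    have split: "(\<Sum>j\<in>UNIV. f j) = f a + f b + (\<Sum>j\<in>UNIV - {a, b}. f j)" for f :: "'n \<Rightarrow> real"
      using ab by (subst sum.subset_diff[of "{a, b}"]) auto
    have near': "\<bar>w $ j\<bar> \<le> t" if "j \<in> UNIV - {a, b}" for j
      using near that by (simp add: w_def)
    have card: "real (card (UNIV - {a, b} :: 'n set)) \<le> n"
      unfolding n_def by (simp add: card_mono)
    have "norm w \<le> (\<Sum>j\<in>UNIV. \<bar>w $ j\<bar>)" by (rule norm_le_l1_cart)
    also have "\<dots> = s + (\<Sum>j\<in>UNIV - {a, b}. \<bar>w $ j\<bar>)" by (simp add: split s_def)
    also have "(\<Sum>j\<in>UNIV - {a, b}. \<bar>w $ j\<bar>) \<le> real (card (UNIV - {a, b} :: 'n set)) * t"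
      using sum_bounded_above[of "UNIV - {a, b}" "\<lambda>j. \<bar>w $ j\<bar>" t] near' by simp
    also have "\<dots> \<le> n * t" by (rule mult_right_mono[OF card t])
    finally have w: "norm w \<le> s + n * t" by simp
    define B where "B = K * n * t + e * (s + n * t)"
    have lin: "\<bar>k $ a * w $ a + k $ b * w $ b\<bar> \<le> B"
      if k: "norm k \<le> K" and kw: "\<bar>k \<bullet> w\<bar> \<le> e * norm w" for k
    proof -
      have "k \<bullet> w = k $ a * w $ a + k $ b * w $ b + (\<Sum>j\<in>UNIV - {a, b}. k $ j * w $ j)"
        by (simp add: inner_vec_def split)
      moreover have "\<bar>\<Sum>j\<in>UNIV - {a, b}. k $ j * w $ j\<bar> \<le> K * n * t"
      proof -
        have "\<bar>\<Sum>j\<in>UNIV - {a, b}. k $ j * w $ j\<bar> \<le> (\<Sum>j\<in>UNIV - {a, b}. \<bar>k $ j * w $ j\<bar>)"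
          by (rule sum_abs)
        also have "\<dots> \<le> (\<Sum>j\<in>UNIV - {a, b}. K * t)"
          unfolding abs_mult using near' k component_le_norm_cart[of k] K
          by (intro sum_mono mult_mono) (auto intro: order_trans)
        also have "\<dots> = real (card (UNIV - {a, b} :: 'n set)) * (K * t)" by simp
        also have "\<dots> \<le> n * (K * t)" using K t by (intro mult_right_mono[OF card]) simp
        finally show ?thesis by (simp add: algebra_simps)
      qed
      moreover have "e * norm w \<le> e * (s + n * t)" using w e by simp
      ultimately show ?thesis using kw unfolding B_def by linarith
    qed
    have "\<bar>g \<bullet> w\<bar> \<le> e * norm w" "\<bar>h \<bullet> w\<bar> \<le> e * norm w"
      using \<delta>1(2)[of p q] \<delta>2(2)[of p q] p q by (auto simp: \<delta>_def w_def)
    then have G: "\<bar>g $ a * w $ a + g $ b * w $ b\<bar> \<le> B" and H: "\<bar>h $ a * w $ a + h $ b * w $ b\<bar> \<le> B"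
      by (auto intro!: lin simp: K_def)
    have comp: "\<bar>g $ j\<bar> \<le> K" "\<bar>h $ j\<bar> \<le> K" for j
      using component_le_norm_cart[of g j] component_le_norm_cart[of h j] norm_ge_zero[of g] norm_ge_zero[of h]
      unfolding K_def by linarith+
    have two: "\<bar>y * c - z * d\<bar> \<le> 2 * K * B" if "\<bar>y\<bar> \<le> B" "\<bar>z\<bar> \<le> B" "\<bar>c\<bar> \<le> K" "\<bar>d\<bar> \<le> K" for y z c d
    proof -
      have "\<bar>y * c\<bar> \<le> B * K" "\<bar>z * d\<bar> \<le> B * K"
        unfolding abs_mult using that by (auto intro!: mult_mono)
      then have "\<bar>y * c - z * d\<bar> \<le> 2 * (B * K)" by linarith
      then show ?thesis by (simp add: mult_ac)
    qed
    have "\<Delta> * \<bar>w $ a\<bar> = \<bar>(g $ a * w $ a + g $ b * w $ b) * h $ b - (h $ a * w $ a + h $ b * w $ b) * g $ b\<bar>"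
      unfolding \<Delta>_def abs_mult[symmetric] by (simp add: algebra_simps)
    also have "\<dots> \<le> 2 * K * B" by (rule two[OF G H comp(2) comp(1)])
    finally have wa: "\<Delta> * \<bar>w $ a\<bar> \<le> 2 * K * B" .
    have "\<Delta> * \<bar>w $ b\<bar> = \<bar>(h $ a * w $ a + h $ b * w $ b) * g $ a - (g $ a * w $ a + g $ b * w $ b) * h $ a\<bar>"
      unfolding \<Delta>_def abs_mult[symmetric] by (simp add: algebra_simps)
    also have "\<dots> \<le> 2 * K * B" by (rule two[OF H G comp(1) comp(2)])
    finally have "\<Delta> * s \<le> 4 * K * B" using wa by (simp add: s_def algebra_simps)
    also have "4 * K * B = 4 * K * n * (K + e) * t + (4 * K * e) * s"
      by (simp add: B_def algebra_simps)
    also have "4 * K * e = \<Delta> / 2" using K by (simp add: e_def)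
    finally have "\<Delta> * s \<le> 8 * K * n * (K + e) * t" by simp
    then have "s \<le> L * t" using \<Delta> by (simp add: L_def field_simps)
    then show "\<bar>p $ a - q $ a\<bar> \<le> L * t \<and> \<bar>p $ b - q $ b\<bar> \<le> L * t"
      using abs_ge_zero[of "w $ a"] abs_ge_zero[of "w $ b"] unfolding s_def w_def vector_minus_component
      by (intro conjI; linarith)
  qed
  then show "\<exists>U. open U \<and> x \<in> U \<and> codim1_null (?M \<inter> U)"
    using \<delta>1(1) \<delta>2(1) by (intro exI[of _ "ball x \<delta>"]) (simp add: \<delta>_def)
qed


section \<open>Algebraic sets of codimension two\<close>

text \<open>A polynomial is given by its coefficients, because algebraic dependence provides nonzero
  coefficients; that these remain nonzero under differentiation is visible without knowing that the
  polynomial is a nonzero function.\<close>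

definition formal_poly :: "('n::finite \<Rightarrow> nat) set \<Rightarrow> (('n \<Rightarrow> nat) \<Rightarrow> real) \<Rightarrow> real^'n \<Rightarrow> real" where
  "formal_poly A c x = (\<Sum>\<alpha>\<in>A. c \<alpha> * (\<Prod>i\<in>UNIV. (x $ i) ^ \<alpha> i))"

lemma formal_poly_smooth:
  assumes "finite A"
  shows "C_k k (formal_poly A c)"
proof -
  have "real_polynomial_function (\<lambda>x. \<Sum>\<alpha>\<in>A. c \<alpha> * (\<Prod>i\<in>UNIV. (x $ i) ^ \<alpha> i))"
    using assms by (intro real_polynomial_function_sum real_polynomial_function.intros(4)
          real_polynomial_function.intros(2) real_polynomial_function_prod
          real_polynomial_function_power real_polynomial_function.intros(1) bounded_linear_vec_nth) auto
  then show ?thesis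
    using C_k_real_polynomial unfolding formal_poly_def[abs_def] by blast
qed

lemma grad_nth_directional:
  fixes f :: "real^'n \<Rightarrow> real"
  assumes f: "f differentiable (at x)"
    and D: "((\<lambda>t. f (x + t *\<^sub>R axis j 1)) has_real_derivative D) (at 0)"
  shows "grad f x $ j = D"
proof -
  have "(f has_derivative (\<lambda>h. grad f x \<bullet> h)) (at (x + (0::real) *\<^sub>R axis j 1))"
    using grad_has_derivative[OF f] by simp
  moreover have "((\<lambda>t::real. x + t *\<^sub>R axis j 1) has_derivative (\<lambda>s. s *\<^sub>R axis j 1)) (at 0)"
    by (auto intro!: derivative_eq_intros)
  ultimately have "((\<lambda>t. f (x + t *\<^sub>R axis j 1)) has_derivative (\<lambda>s. grad f x \<bullet> (s *\<^sub>R axis j 1))) (at 0)"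
    using has_derivative_compose[where f = "\<lambda>t::real. x + t *\<^sub>R axis j 1" and g = f] by blast
  moreover have "((\<lambda>t. f (x + t *\<^sub>R axis j 1)) has_derivative (\<lambda>s. D * s)) (at 0)"
    using D by (simp add: has_field_derivative_def)
  ultimately have "(\<lambda>s. grad f x \<bullet> (s *\<^sub>R axis j 1)) = (\<lambda>s. D * s)"
    by (rule has_derivative_unique)
  from fun_cong[OF this, of 1] show ?thesis by (simp add: inner_axis)
qed

lemma formal_poly_independent:
  fixes A :: "('n::finite \<Rightarrow> nat) set"
  assumes "finite A" "\<And>\<alpha>. \<alpha> \<in> A \<Longrightarrow> \<alpha> j = 0"
  shows "grad (formal_poly A c) x $ j = 0"
proof (rule grad_nth_directional)
  show "formal_poly A c differentiable (at x)"
    using formal_poly_smooth[OF assms(1)] C_1_differentiable by blast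
  have "formal_poly A c (x + t *\<^sub>R axis j 1) = formal_poly A c x" for t
    unfolding formal_poly_def
  proof (intro sum.cong arg_cong2[where f = "(*)"] prod.cong refl)
    fix \<alpha> i assume "\<alpha> \<in> A"
    then show "(x + t *\<^sub>R axis j 1) $ i ^ \<alpha> i = x $ i ^ \<alpha> i"
      using assms(2)[of \<alpha>] by (cases "i = j") (auto simp: axis_def)
  qed
  then show "((\<lambda>t. formal_poly A c (x + t *\<^sub>R axis j 1)) has_real_derivative 0) (at 0)"
    by simp
qed

lemma formal_poly_partial:
  fixes A :: "('n::finite \<Rightarrow> nat) set"
  assumes A: "finite A"
  shows "grad (formal_poly A c) x $ j =
    formal_poly ((\<lambda>\<alpha>. \<alpha>(j := \<alpha> j - 1)) ` {\<alpha> \<in> A. \<alpha> j > 0})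
      (\<lambda>\<beta>. c (\<beta>(j := Suc (\<beta> j))) * real (Suc (\<beta> j))) x"
proof (rule grad_nth_directional)
  show "formal_poly A c differentiable (at x)"
    using formal_poly_smooth[OF A] C_1_differentiable by blast
  have prod_split: "(\<Prod>i\<in>UNIV. f i) = f j * (\<Prod>i\<in>UNIV - {j}. f i)" for f :: "'n \<Rightarrow> real"
    by (rule prod.remove) auto
  define m where "m \<alpha> = (\<Prod>i\<in>UNIV - {j}. (x $ i) ^ \<alpha> i)" for \<alpha>
  have line: "formal_poly A c (x + t *\<^sub>R axis j 1) = (\<Sum>\<alpha>\<in>A. c \<alpha> * ((x $ j + t) ^ \<alpha> j * m \<alpha>))" for t
    unfolding formal_poly_def prod_split m_def
    by (intro sum.cong arg_cong2[where f = "(*)"] prod.cong refl) (auto simp: axis_def)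
  have "((\<lambda>t. \<Sum>\<alpha>\<in>A. c \<alpha> * ((x $ j + t) ^ \<alpha> j * m \<alpha>)) has_real_derivative
      (\<Sum>\<alpha>\<in>A. c \<alpha> * (real (\<alpha> j) * (x $ j) ^ (\<alpha> j - 1) * m \<alpha>))) (at 0)"
    by (rule derivative_eq_intros refl | simp)+ (simp add: mult_ac)
  also have "(\<Sum>\<alpha>\<in>A. c \<alpha> * (real (\<alpha> j) * (x $ j) ^ (\<alpha> j - 1) * m \<alpha>))
    = (\<Sum>\<alpha> | \<alpha> \<in> A \<and> \<alpha> j > 0. c \<alpha> * (real (\<alpha> j) * (x $ j) ^ (\<alpha> j - 1) * m \<alpha>))"
    using A by (intro sum.mono_neutral_right) auto
  also have "\<dots> = formal_poly ((\<lambda>\<alpha>. \<alpha>(j := \<alpha> j - 1)) ` {\<alpha> \<in> A. \<alpha> j > 0})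
      (\<lambda>\<beta>. c (\<beta>(j := Suc (\<beta> j))) * real (Suc (\<beta> j))) x"
    unfolding formal_poly_def
  proof (subst sum.reindex)
    show "inj_on (\<lambda>\<alpha>. \<alpha>(j := \<alpha> j - 1)) {\<alpha> \<in> A. \<alpha> j > 0}"
    proof (rule inj_onI)
      fix \<alpha> \<beta> assume "\<alpha> \<in> {\<alpha> \<in> A. \<alpha> j > 0}" "\<beta> \<in> {\<alpha> \<in> A. \<alpha> j > 0}"
        and eq: "\<alpha>(j := \<alpha> j - 1) = \<beta>(j := \<beta> j - 1)"
      then have pos: "\<alpha> j > 0" "\<beta> j > 0" by auto
      show "\<alpha> = \<beta>"
      proof
        fix i show "\<alpha> i = \<beta> i"
          using fun_cong[OF eq, of i] pos by (cases "i = j") auto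
      qed
    qed
    show "(\<Sum>\<alpha> | \<alpha> \<in> A \<and> 0 < \<alpha> j. c \<alpha> * (real (\<alpha> j) * (x $ j) ^ (\<alpha> j - 1) * m \<alpha>)) =
      sum ((\<lambda>\<alpha>. c (\<alpha>(j := Suc (\<alpha> j))) * real (Suc (\<alpha> j)) * (\<Prod>i\<in>UNIV. x $ i ^ \<alpha> i)) \<circ>
        (\<lambda>\<alpha>. \<alpha>(j := \<alpha> j - 1))) {\<alpha> \<in> A. 0 < \<alpha> j}"
    proof (rule sum.cong)
      fix \<alpha> assume \<alpha>: "\<alpha> \<in> {\<alpha> \<in> A. 0 < \<alpha> j}"
      have "(\<Prod>i\<in>UNIV - {j}. x $ i ^ (\<alpha>(j := \<alpha> j - 1)) i) = m \<alpha>"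
        unfolding m_def by (rule prod.cong) auto
      then show "c \<alpha> * (real (\<alpha> j) * (x $ j) ^ (\<alpha> j - 1) * m \<alpha>) =
        ((\<lambda>\<alpha>. c (\<alpha>(j := Suc (\<alpha> j))) * real (Suc (\<alpha> j)) * (\<Prod>i\<in>UNIV. x $ i ^ \<alpha> i)) \<circ>
        (\<lambda>\<alpha>. \<alpha>(j := \<alpha> j - 1))) \<alpha>"
        using \<alpha> by (simp add: prod_split)
    qed simp
  qed
  finally show "((\<lambda>t. formal_poly A c (x + t *\<^sub>R axis j 1)) has_real_derivative
    formal_poly ((\<lambda>\<alpha>. \<alpha>(j := \<alpha> j - 1)) ` {\<alpha> \<in> A. \<alpha> j > 0})
      (\<lambda>\<beta>. c (\<beta>(j := Suc (\<beta> j))) * real (Suc (\<beta> j))) x) (at 0)"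
    unfolding line .
qed

text \<open>At a zero of a polynomial some iterated partial derivative vanishes with nonzero gradient,
  because repeated differentiation ends at a nonzero constant. All partial derivatives omit
  the variables that the polynomial omits.\<close>

lemma formal_poly_strata:
  fixes A :: "('n::finite \<Rightarrow> nat) set"
  assumes "finite A" "\<And>\<alpha>. \<alpha> \<in> A \<Longrightarrow> \<alpha> l = 0" "\<And>\<alpha>. \<alpha> \<in> A \<Longrightarrow> c \<alpha> \<noteq> 0" "A \<noteq> {}"
    and "\<And>\<alpha>. \<alpha> \<in> A \<Longrightarrow> (\<Sum>i\<in>UNIV. \<alpha> i) \<le> n"
  shows "\<exists>\<Q>. finite \<Q> \<and> (\<forall>Q\<in>\<Q>. C_k 1 Q \<and> (\<forall>x. grad Q x $ l = 0)) \<and>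
    (\<forall>x. formal_poly A c x = 0 \<longrightarrow> (\<exists>Q\<in>\<Q>. Q x = 0 \<and> grad Q x \<noteq> 0))"
  using assms
proof (induction n arbitrary: A c)
  case 0
  then have "\<alpha> = (\<lambda>_. 0)" if "\<alpha> \<in> A" for \<alpha> using that by (auto simp: fun_eq_iff)
  then have "A = {\<lambda>_. 0}" using 0 by blast
  then have "formal_poly A c x \<noteq> 0" for x using 0 by (simp add: formal_poly_def)
  then show ?case by (intro exI[of _ "{}"]) auto
next
  case (Suc n)
  show ?case
  proof (cases "\<exists>\<alpha>\<in>A. \<exists>j. \<alpha> j > 0")
    case False
    then have "\<alpha> = (\<lambda>_. 0)" if "\<alpha> \<in> A" for \<alpha> using that by (auto simp: fun_eq_iff)
    then have "A = {\<lambda>_. 0}" using Suc.prems(4) by blast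
    then have "formal_poly A c x \<noteq> 0" for x using Suc.prems(3) by (simp add: formal_poly_def)
    then show ?thesis by (intro exI[of _ "{}"]) auto
  next
    case True
    then obtain \<alpha> j where \<alpha>: "\<alpha> \<in> A" "\<alpha> j > 0" by blast
    define A' where "A' = (\<lambda>\<alpha>. \<alpha>(j := \<alpha> j - 1)) ` {\<alpha> \<in> A. \<alpha> j > 0}"
    define c' where "c' \<beta> = c (\<beta>(j := Suc (\<beta> j))) * real (Suc (\<beta> j))" for \<beta> :: "'n \<Rightarrow> nat"
    have partial: "grad (formal_poly A c) x $ j = formal_poly A' c' x" for x
      unfolding A'_def c'_def by (rule formal_poly_partial[OF Suc.prems(1)])
    have "\<exists>\<Q>. finite \<Q> \<and> (\<forall>Q\<in>\<Q>. C_k 1 Q \<and> (\<forall>x. grad Q x $ l = 0)) \<and>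
      (\<forall>x. formal_poly A' c' x = 0 \<longrightarrow> (\<exists>Q\<in>\<Q>. Q x = 0 \<and> grad Q x \<noteq> 0))"
    proof (rule Suc.IH)
      show "finite A'" using Suc.prems(1) by (simp add: A'_def)
      show "\<beta> l = 0" if "\<beta> \<in> A'" for \<beta> using that Suc.prems(2) by (fastforce simp: A'_def)
      show "c' \<beta> \<noteq> 0" if "\<beta> \<in> A'" for \<beta> using that Suc.prems(3) by (auto simp: A'_def c'_def)
      show "A' \<noteq> {}" using \<alpha> by (auto simp: A'_def)
      show "(\<Sum>i\<in>UNIV. \<beta> i) \<le> n" if "\<beta> \<in> A'" for \<beta>
      proof -
        from that obtain \<gamma> where \<gamma>: "\<gamma> \<in> A" "\<gamma> j > 0" "\<beta> = \<gamma>(j := \<gamma> j - 1)" by (auto simp: A'_def)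
        have "(\<Sum>i\<in>UNIV. \<beta> i) = \<beta> j + (\<Sum>i\<in>UNIV - {j}. \<beta> i)" by (rule sum.remove) auto
        moreover have "(\<Sum>i\<in>UNIV. \<gamma> i) = \<gamma> j + (\<Sum>i\<in>UNIV - {j}. \<gamma> i)" by (rule sum.remove) auto
        moreover have "(\<Sum>i\<in>UNIV - {j}. \<beta> i) = (\<Sum>i\<in>UNIV - {j}. \<gamma> i)" by (rule sum.cong) (auto simp: \<gamma>)
        ultimately show ?thesis using Suc.prems(5)[OF \<gamma>(1)] \<gamma>(2,3) by simp
      qed
    qed
    then obtain \<Q> where \<Q>: "finite \<Q>" "\<forall>Q\<in>\<Q>. C_k 1 Q \<and> (\<forall>x. grad Q x $ l = 0)"
      "\<And>x. formal_poly A' c' x = 0 \<Longrightarrow> \<exists>Q\<in>\<Q>. Q x = 0 \<and> grad Q x \<noteq> 0" by blast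
    show ?thesis
    proof (intro exI[of _ "insert (formal_poly A c) \<Q>"] conjI allI impI ballI)
      show "finite (insert (formal_poly A c) \<Q>)" using \<Q>(1) by simp
      show "C_k 1 Q" if "Q \<in> insert (formal_poly A c) \<Q>" for Q
        using that \<Q>(2) formal_poly_smooth[OF Suc.prems(1)] by blast
      show "grad Q x $ l = 0" if "Q \<in> insert (formal_poly A c) \<Q>" for Q x
        using that \<Q>(2) formal_poly_independent[OF Suc.prems(1), of l c x] Suc.prems(2) by blast
      show "\<exists>Q\<in>insert (formal_poly A c) \<Q>. Q x = 0 \<and> grad Q x \<noteq> 0" if "formal_poly A c x = 0" for x
      proof (cases "grad (formal_poly A c) x = 0")
        case True
        then have "formal_poly A' c' x = 0" using partial[of x] by simp
        then show ?thesis using \<Q>(3) by blast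
      qed (use that in blast)
    qed
  qed
qed

text \<open>The coordinates other than \<open>x\<^sub>l\<close> are \<open>N - 1\<close> polynomials, hence algebraically dependent
  on a set of dimension at most \<open>N - 2\<close>.\<close>

lemma algebraic_dim_relation:
  fixes Z :: "(real^'n) set" and l :: 'n
  assumes dim: "algebraic_dim Z \<le> ereal (real CARD('n) - 2)"
  obtains A :: "('n \<Rightarrow> nat) set" and c where "finite A" "\<And>\<alpha>. \<alpha> \<in> A \<Longrightarrow> \<alpha> l = 0"
    "\<And>\<alpha>. \<alpha> \<in> A \<Longrightarrow> c \<alpha> \<noteq> 0" "A \<noteq> {}" "\<And>x. x \<in> Z \<Longrightarrow> formal_poly A c x = 0"
proof -
  define k where "k = CARD('n) - 1"
  have k: "real k = real CARD('n) - 1" by (simp add: k_def of_nat_diff Suc_leI)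
  have "card (UNIV - {l} :: 'n set) = k" by (simp add: k_def card_Diff_subset)
  then obtain \<sigma> where \<sigma>: "bij_betw \<sigma> {..<k} (UNIV - {l})"
    using ex_bij_betw_nat_finite[of "UNIV - {l} :: 'n set"] by (auto simp: atLeast0LessThan)
  define p where "p j = (\<lambda>x::real^'n. x $ \<sigma> j)" for j
  have poly: "real_polynomial_function (p j)" for j
    unfolding p_def by (rule real_polynomial_function.intros(1)[OF bounded_linear_vec_nth])
  have "\<not> algebraically_independent_on Z k p"
  proof
    assume "algebraically_independent_on Z k p"
    then have "ereal (real k) \<le> algebraic_dim Z"
      unfolding algebraic_dim_def using poly by (intro Sup_upper) blast
    then have "ereal (real k) \<le> ereal (real CARD('n) - 2)" using dim by (rule order_trans)
    then show False by (simp add: k)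
  qed
  then obtain A c where A: "finite A" "\<And>\<alpha> i. \<alpha> \<in> A \<Longrightarrow> i \<ge> k \<Longrightarrow> \<alpha> i = 0"
    and rel: "\<And>x. x \<in> Z \<Longrightarrow> (\<Sum>\<alpha>\<in>A. c \<alpha> * (\<Prod>i<k. p i x ^ \<alpha> i)) = 0" and nz: "\<exists>\<alpha>\<in>A. c \<alpha> \<noteq> 0"
    unfolding algebraically_independent_on_def by blast
  define \<tau> where "\<tau> = inv_into {..<k} \<sigma>"
  define T where "T \<alpha> = (\<lambda>i. if i = l then 0 else \<alpha> (\<tau> i))" for \<alpha> :: "nat \<Rightarrow> nat"
  define S where "S \<beta> = (\<lambda>j. if j < k then \<beta> (\<sigma> j) else 0)" for \<beta> :: "'n \<Rightarrow> nat"
  have \<tau>\<sigma>: "\<tau> (\<sigma> j) = j" "\<sigma> j \<noteq> l" if "j < k" for j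
    using that \<sigma> by (auto simp: \<tau>_def bij_betw_def inv_into_f_f)
  have ST: "S (T \<alpha>) = \<alpha>" if "\<alpha> \<in> A" for \<alpha>
    using A(2)[OF that] by (auto simp: S_def T_def \<tau>\<sigma> fun_eq_iff)
  define A1 where "A1 = {\<alpha> \<in> A. c \<alpha> \<noteq> 0}"
  show thesis
  proof (rule that[of "T ` A1" "\<lambda>\<beta>. c (S \<beta>)"])
    show "finite (T ` A1)" using A(1) by (simp add: A1_def)
    show "\<alpha> l = 0" if "\<alpha> \<in> T ` A1" for \<alpha> using that by (auto simp: T_def)
    show "c (S \<alpha>) \<noteq> 0" if "\<alpha> \<in> T ` A1" for \<alpha> using that ST by (auto simp: A1_def)
    show "T ` A1 \<noteq> {}" using nz by (auto simp: A1_def)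
    fix x assume x: "x \<in> Z"
    have inj: "inj_on T A1" by (rule inj_on_inverseI[of _ S]) (auto simp: A1_def ST)
    have mono: "(\<Prod>i\<in>UNIV. x $ i ^ T \<alpha> i) = (\<Prod>j<k. p j x ^ \<alpha> j)" for \<alpha>
    proof -
      have "(\<Prod>i\<in>UNIV. x $ i ^ T \<alpha> i) = (\<Prod>i\<in>UNIV - {l}. x $ i ^ T \<alpha> i)"
        by (rule prod.mono_neutral_right) (auto simp: T_def)
      also have "\<dots> = (\<Prod>j<k. x $ \<sigma> j ^ T \<alpha> (\<sigma> j))"
        by (rule prod.reindex_bij_betw[OF \<sigma>, symmetric])
      also have "\<dots> = (\<Prod>j<k. p j x ^ \<alpha> j)"
        by (rule prod.cong) (auto simp: T_def \<tau>\<sigma> p_def)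
      finally show ?thesis .
    qed
    have "formal_poly (T ` A1) (\<lambda>\<beta>. c (S \<beta>)) x = (\<Sum>\<alpha>\<in>A1. c \<alpha> * (\<Prod>i<k. p i x ^ \<alpha> i))"
      unfolding formal_poly_def sum.reindex[OF inj] o_def mono
      by (rule sum.cong) (auto simp: ST A1_def)
    also have "\<dots> = (\<Sum>\<alpha>\<in>A. c \<alpha> * (\<Prod>i<k. p i x ^ \<alpha> i))"
      using A(1) by (intro sum.mono_neutral_left) (auto simp: A1_def)
    finally show "formal_poly (T ` A1) (\<lambda>\<beta>. c (S \<beta>)) x = 0" using rel[OF x] by simp
  qed
qed

text \<open>For each variable \<open>x\<^sub>l\<close> a point of \<open>Z\<close> is a zero with nonzero gradient of a polynomial
  that does not involve \<open>x\<^sub>l\<close>. If the gradients for all \<open>l\<close> were parallel, then all their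
  components would vanish; hence two of them are linearly independent, and \<open>Z\<close> lies in a
  finite union of sets of codimension two.\<close>

theorem algebraic_codim_two_null:
  fixes Z :: "(real^'n) set"
  assumes N: "CARD('n) \<ge> 2" and dim: "algebraic_dim Z \<le> ereal (real CARD('n) - 2)"
  shows "codim1_null Z"
proof -
  define good where "good l \<Q> \<longleftrightarrow> finite \<Q> \<and> (\<forall>Q\<in>\<Q>. C_k 1 Q \<and> (\<forall>x. grad Q x $ l = 0)) \<and>
    (\<forall>x\<in>Z. \<exists>Q\<in>\<Q>. Q x = 0 \<and> grad Q x \<noteq> 0)" for l \<Q>
  have "\<exists>\<Q>. good l \<Q>" for l
  proof -
    obtain A :: "('n \<Rightarrow> nat) set" and c where A: "finite A" "\<And>\<alpha>. \<alpha> \<in> A \<Longrightarrow> \<alpha> l = 0"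
      "\<And>\<alpha>. \<alpha> \<in> A \<Longrightarrow> c \<alpha> \<noteq> 0" "A \<noteq> {}" "\<And>x. x \<in> Z \<Longrightarrow> formal_poly A c x = 0"
      using algebraic_dim_relation[OF dim] by blast
    have deg: "(\<Sum>i\<in>UNIV. \<alpha> i) \<le> Max ((\<lambda>\<alpha>. \<Sum>i\<in>UNIV. \<alpha> i) ` A)" if "\<alpha> \<in> A" for \<alpha>
      using A(1) that by (intro Max_ge) auto
    have "\<exists>\<Q>. finite \<Q> \<and> (\<forall>Q\<in>\<Q>. C_k 1 Q \<and> (\<forall>x. grad Q x $ l = 0)) \<and>
      (\<forall>x. formal_poly A c x = 0 \<longrightarrow> (\<exists>Q\<in>\<Q>. Q x = 0 \<and> grad Q x \<noteq> 0))"
      by (rule formal_poly_strata[OF A(1-4) deg])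
    then obtain \<Q> where \<Q>: "finite \<Q>" "\<forall>Q\<in>\<Q>. C_k 1 Q \<and> (\<forall>x. grad Q x $ l = 0)"
      "\<forall>x. formal_poly A c x = 0 \<longrightarrow> (\<exists>Q\<in>\<Q>. Q x = 0 \<and> grad Q x \<noteq> 0)" by (elim exE conjE)
    have "good l \<Q>" unfolding good_def using \<Q> A(5) by simp
    then show ?thesis ..
  qed
  then obtain \<Q> where "\<forall>l. good l (\<Q> l)" by metis
  then have fin: "\<And>l. finite (\<Q> l)" and C1: "\<And>l Q. Q \<in> \<Q> l \<Longrightarrow> C_k 1 Q"
    and indep: "\<And>l Q x. Q \<in> \<Q> l \<Longrightarrow> grad Q x $ l = 0"
    and zero: "\<And>l x. x \<in> Z \<Longrightarrow> \<exists>Q\<in>\<Q> l. Q x = 0 \<and> grad Q x \<noteq> 0"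
    unfolding good_def by blast+
  define M where "M = (\<lambda>(u, v, a, b). {x. u x = 0 \<and> v x = 0 \<and>
    grad u x $ a * grad v x $ b - grad u x $ b * grad v x $ a \<noteq> 0} :: (real^'n) set)"
  define I where "I = (\<Union>l. \<Q> l) \<times> (\<Union>l. \<Q> l) \<times> {(a, b). a \<noteq> (b :: 'n)}"
  have "codim1_null (\<Union>i\<in>I. M i)"
  proof (rule codim1_null_UN[OF N])
    have "finite I" unfolding I_def by (intro finite_cartesian_product finite_UN_I fin) auto
    then show "countable I" by (rule countable_finite)
    fix i assume "i \<in> I"
    then obtain u v a b where i: "i = (u, v, a, b)" "a \<noteq> b" "C_k 1 u" "C_k 1 v"
      using C1 by (auto simp: I_def)
    then show "codim1_null (M i)" using codim1_null_codim_two[OF i(2-4)] by (simp add: M_def)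
  qed
  moreover have "Z \<subseteq> (\<Union>i\<in>I. M i)"
  proof
    fix x assume x: "x \<in> Z"
    obtain u where u: "u \<in> \<Q> undefined" "u x = 0" "grad u x \<noteq> 0" using zero[OF x] by blast
    from u(3) obtain a where a: "grad u x $ a \<noteq> 0" by (auto simp: vec_eq_iff)
    obtain v where v: "v \<in> \<Q> a" "v x = 0" "grad v x \<noteq> 0" using zero[OF x] by blast
    from v(3) obtain b where b: "grad v x $ b \<noteq> 0" by (auto simp: vec_eq_iff)
    have va: "grad v x $ a = 0" using indep[OF v(1)] .
    then have "a \<noteq> b" using b by auto
    then have "(u, v, a, b) \<in> I" "x \<in> M (u, v, a, b)"
      using u v a b va by (auto simp: I_def M_def)
    then show "x \<in> (\<Union>i\<in>I. M i)" by blast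
  qed
  ultimately show ?thesis by (rule codim1_null_subset)
qed

lemma algebraic_set_closed:
  assumes "algebraic_set Z"
  shows "closed Z"
proof -
  obtain P where P: "\<forall>p\<in>P. real_polynomial_function p" "Z = {x. \<forall>p\<in>P. p x = 0}"
    using assms by (auto simp: algebraic_set_def)
  have "Z = (\<Inter>p\<in>P. {x. p x = 0})" using P(2) by blast
  moreover have "closed {x. p x = 0}" if "p \<in> P" for p
    using C_k_0D[OF C_k_real_polynomial] P(1) that
    by (intro closed_Collect_eq continuous_intros) blast
  ultimately show ?thesis by (metis (no_types, lifting) closed_INT)
qed

text \<open>Constants are algebraically independent, as a family of length 0, on every nonempty set.\<close>

lemma algebraic_dim_nonneg:
  assumes "Z \<noteq> {}"
  shows "algebraic_dim Z \<ge> 0"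
proof -
  obtain z where z: "z \<in> Z" using assms by blast
  have "algebraically_independent_on Z 0 p" for p
    unfolding algebraically_independent_on_def
  proof (intro allI impI ballI)
    fix A :: "(nat \<Rightarrow> nat) set" and c \<alpha>
    assume "finite A \<and> (\<forall>\<alpha>\<in>A. \<forall>i\<ge>0. \<alpha> i = 0) \<and> (\<forall>x\<in>Z. (\<Sum>\<alpha>\<in>A. c \<alpha> * (\<Prod>i<0. p i x ^ \<alpha> i)) = (0::real))"
      and \<alpha>: "\<alpha> \<in> A"
    then have A: "\<And>\<beta>. \<beta> \<in> A \<Longrightarrow> \<beta> = (\<lambda>_. 0)" and sum: "(\<Sum>\<alpha>\<in>A. c \<alpha>) = 0" using z by auto
    have "A = {\<alpha>}" using A \<alpha> by blast
    then show "c \<alpha> = 0" using sum by simp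
  qed
  then have "ereal (real 0) \<le> algebraic_dim Z"
    unfolding algebraic_dim_def by (intro Sup_upper) blast
  then show ?thesis by (simp add: zero_ereal_def)
qed

lemma algebraic_dim_imp_card:
  fixes Z :: "(real^'n) set"
  assumes "Z \<noteq> {}" "algebraic_dim Z \<le> ereal (real CARD('n) - 2)"
  shows "CARD('n) \<ge> 2"
proof -
  have "0 \<le> ereal (real CARD('n) - 2)" using algebraic_dim_nonneg[OF assms(1)] assms(2) by (rule order_trans)
  then show ?thesis by simp
qed


section \<open>Integration by parts for compactly supported fields\<close>

definition vanishes_beyond :: "real \<Rightarrow> ('a::real_normed_vector \<Rightarrow> 'b::zero) \<Rightarrow> bool" where
  "vanishes_beyond R f \<longleftrightarrow> (\<forall>x. norm x > R \<longrightarrow> f x = 0)"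

lemma continuous_borel_lebesgue: "continuous_on UNIV f \<Longrightarrow> f \<in> borel_measurable lebesgue"
  by (simp add: borel_measurable_continuous_onI measurable_completion)

lemma integrable_cball_indicator: "integrable lebesgue (\<lambda>x. B * indicator (cball (a::'a::euclidean_space) R) x :: real)"
  by (intro integrable_mult_right lmeasurable_iff_integrable[THEN iffD1] lmeasurable_cball)

lemma integrable_lborel_cball_indicator:
  "integrable lborel (\<lambda>x. B * indicator (cball (a::'a::euclidean_space) R) x :: real)"
  using integrable_cball_indicator[of B a R]
  by (subst integrable_completion[symmetric])
    (simp, intro borel_measurable_times borel_measurable_const borel_measurable_indicator borel_closed closed_cball)

lemma integrable_bounded_support:
  fixes f :: "'a::euclidean_space \<Rightarrow> real"
  assumes "f \<in> borel_measurable lebesgue" "\<And>x. \<bar>f x\<bar> \<le> B" "vanishes_beyond R f"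
  shows "integrable lebesgue f"
proof (rule Bochner_Integration.integrable_bound[OF integrable_cball_indicator])
  show "AE x in lebesgue. norm (f x) \<le> norm (B * indicator (cball 0 R) x :: real)"
  proof (rule AE_I2)
    fix x
    have "B \<ge> 0" using assms(2)[of x] by simp
    then show "norm (f x) \<le> norm (B * indicator (cball 0 R) x :: real)"
      using assms(2)[of x] assms(3) by (auto simp: indicator_def vanishes_beyond_def not_le)
  qed
qed (rule assms(1))

lemma continuous_vanishing_bounded:
  fixes f :: "'a::euclidean_space \<Rightarrow> 'b::real_normed_vector"
  assumes "continuous_on UNIV f" "vanishes_beyond R f"
  obtains B where "B \<ge> 0" "\<And>x. norm (f x) \<le> B"
proof -
  have "compact (f ` cball 0 R)"
    using assms(1) by (intro compact_continuous_image) (auto intro: continuous_on_subset)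
  then obtain B where B: "\<And>x. x \<in> cball 0 R \<Longrightarrow> norm (f x) \<le> B"
    by (meson bounded_iff compact_imp_bounded image_eqI)
  show thesis
  proof (rule that[of "max B 0"])
    fix x show "norm (f x) \<le> max B 0"
      using B[of x] assms(2) by (cases "norm x \<le> R") (auto simp: vanishes_beyond_def)
  qed simp
qed

lemma integrable_continuous_vanishing:
  fixes f :: "'a::euclidean_space \<Rightarrow> real"
  assumes "continuous_on UNIV f" "vanishes_beyond R f"
  shows "integrable lebesgue f"
proof -
  obtain B where "\<And>x. norm (f x) \<le> B" using continuous_vanishing_bounded[OF assms] by blast
  then show ?thesis
    by (intro integrable_bounded_support[OF continuous_borel_lebesgue[OF assms(1)] _ assms(2)]) auto
qed

lemma vanishes_beyond_derivative:
  assumes "vanishes_beyond R f"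
  shows "vanishes_beyond R (\<lambda>x. frechet_derivative f (at x) v)"
  unfolding vanishes_beyond_def
proof (intro allI impI)
  fix x :: 'a assume x: "norm x > R"
  have "open {y::'a. norm y > R}" by (intro open_Collect_less continuous_intros)
  moreover have "((\<lambda>_. 0) has_derivative (\<lambda>h. 0)) (at x)" by simp
  moreover have "0 = f y" if "y \<in> {y. norm y > R}" for y
    using that assms by (simp add: vanishes_beyond_def)
  ultimately have "(f has_derivative (\<lambda>h. 0)) (at x)"
    using x by (intro has_derivative_transform_within_open[of "\<lambda>_. 0" "\<lambda>h. 0" x UNIV "{y. norm y > R}" f]) auto
  then show "frechet_derivative f (at x) v = 0"
    by (simp add: frechet_derivative_at[symmetric])
qed

lemma vanishes_beyond_grad: "vanishes_beyond R f \<Longrightarrow> vanishes_beyond R (grad f)"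
  using vanishes_beyond_derivative[of R f] by (auto simp: vanishes_beyond_def grad_def vec_eq_iff)

lemma vanishes_beyond_divergence: "vanishes_beyond R T \<Longrightarrow> vanishes_beyond R (divergence T)"
  using vanishes_beyond_derivative[of R T] by (auto simp: vanishes_beyond_def divergence_def)

lemma integral_translation_lborel:
  fixes f :: "'a::euclidean_space \<Rightarrow> real"
  assumes "f \<in> borel_measurable borel"
  shows "(\<integral>x. f (x + v) \<partial>lborel) = (\<integral>x. f x \<partial>lborel)"
proof -
  have "(\<integral>x. f x \<partial>lborel) = (\<integral>x. f x \<partial>(distr lborel borel ((+) v)))"
    by (simp add: lborel_distr_plus)
  also have "\<dots> = (\<integral>x. f (v + x) \<partial>lborel)"
    using assms by (subst integral_distr) auto
  finally show ?thesis by (simp add: add.commute)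
qed

text \<open>Translation invariance makes the integrals of all difference quotients vanish; the
  derivative is their dominated limit.\<close>

lemma integral_derivative_zero:
  fixes u :: "'a::euclidean_space \<Rightarrow> real"
  assumes u: "C_k 1 u" and R: "vanishes_beyond R u"
  shows "(\<integral>x. frechet_derivative u (at x) v \<partial>lebesgue) = 0"
proof -
  define D where "D x = frechet_derivative u (at x) v" for x
  have cu: "continuous_on UNIV u" by (rule C_k_0D[OF u])
  have cD: "continuous_on UNIV D" unfolding D_def by (rule C_1_continuous_derivative[OF u])
  have R_D: "vanishes_beyond R D" unfolding D_def by (rule vanishes_beyond_derivative[OF R])
  obtain B where B: "B \<ge> 0" "\<And>x. norm (D x) \<le> B" using continuous_vanishing_bounded[OF cD R_D] by blast
  have line: "((\<lambda>t. u (x + t *\<^sub>R v)) has_real_derivative D (x + t *\<^sub>R v)) (at t)" for x t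
  proof -
    have du: "(u has_derivative frechet_derivative u (at y)) (at y)" for y
      using C_1_differentiable[OF u] by (simp add: frechet_derivative_works)
    interpret bounded_linear "frechet_derivative u (at (x + t *\<^sub>R v))"
      using has_derivative_bounded_linear[OF du] .
    have "((\<lambda>t. x + t *\<^sub>R v) has_derivative (\<lambda>s. s *\<^sub>R v)) (at t)"
      by (auto intro!: derivative_eq_intros)
    from has_derivative_compose[OF this du] show ?thesis
      by (simp add: has_field_derivative_def D_def scaleR mult_commute_abs)
  qed
  define q where "q k x = real (Suc k) * (u (x + (1 / real (Suc k)) *\<^sub>R v) - u x)" for k x
  have [measurable]: "u \<in> borel_measurable borel" "D \<in> borel_measurable borel"
    using cu cD by (auto intro: borel_measurable_continuous_onI)
  have [measurable]: "q k \<in> borel_measurable borel" for k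
    unfolding q_def[abs_def] by measurable
  have int_u: "integrable lborel u"
    using integrable_continuous_vanishing[OF cu R] by (simp add: integrable_completion)
  have int_shift: "integrable lborel (\<lambda>x. u (x + w))" for w
  proof (subst integrable_completion[symmetric])
    show "integrable lebesgue (\<lambda>x. u (x + w))"
    proof (rule integrable_continuous_vanishing)
      show "continuous_on UNIV (\<lambda>x. u (x + w))"
        by (rule continuous_on_compose2[OF cu]) (auto intro: continuous_intros)
      show "vanishes_beyond (R + norm w) (\<lambda>x. u (x + w))"
        unfolding vanishes_beyond_def
      proof (intro allI impI)
        fix x :: 'a assume "norm x > R + norm w"
        then have "norm (x + w) > R" using norm_triangle_ineq4[of "x + w" w] by simp
        then show "u (x + w) = 0" using R by (simp add: vanishes_beyond_def)
      qed
    qed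
  qed measurable
  have q0: "(\<integral>x. q k x \<partial>lborel) = 0" for k
    unfolding q_def using int_u int_shift by (simp add: integral_translation_lborel)
  have "(\<lambda>k. \<integral>x. q k x \<partial>lborel) \<longlonglongrightarrow> (\<integral>x. D x \<partial>lborel)"
  proof (rule integral_dominated_convergence)
    show "integrable lborel (\<lambda>x. B * indicator (cball 0 (R + norm v)) x)"
      by (rule integrable_lborel_cball_indicator)
    show "AE x in lborel. (\<lambda>k. q k x) \<longlonglongrightarrow> D x"
    proof (rule AE_I2)
      fix x
      have "((\<lambda>t. (u (x + t *\<^sub>R v) - u x) / t) \<longlongrightarrow> D x) (at 0)"
        using line[of x 0] by (simp add: has_field_derivative_iff)
      moreover have "filterlim (\<lambda>k. 1 / real (Suc k)) (at 0) sequentially"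
        by (rule filterlim_atI) (use LIMSEQ_inverse_real_of_nat in \<open>auto simp: inverse_eq_divide\<close>)
      ultimately have "(\<lambda>k. (u (x + (1 / real (Suc k)) *\<^sub>R v) - u x) / (1 / real (Suc k))) \<longlonglongrightarrow> D x"
        by (rule filterlim_compose)
      then show "(\<lambda>k. q k x) \<longlonglongrightarrow> D x"
        by (simp add: q_def mult.commute)
    qed
    show "AE x in lborel. norm (q k x) \<le> B * indicator (cball 0 (R + norm v)) x" for k
    proof (rule AE_I2)
      fix x
      define s where "s = 1 / real (Suc k)"
      have s: "s > 0" "s \<le> 1" by (simp_all add: s_def)
      obtain t where "0 < t" "t < s" and mvt: "u (x + s *\<^sub>R v) - u (x + 0 *\<^sub>R v) = (s - 0) * D (x + t *\<^sub>R v)"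
        using MVT2[of 0 s "\<lambda>t. u (x + t *\<^sub>R v)" "\<lambda>t. D (x + t *\<^sub>R v)"] s(1) line by blast
      then have qD: "q k x = D (x + t *\<^sub>R v)" by (simp add: q_def s_def)
      show "norm (q k x) \<le> B * indicator (cball 0 (R + norm v)) x"
      proof (cases "norm x \<le> R + norm v")
        case True
        then show ?thesis using B(2) qD by (simp add: indicator_def)
      next
        case False
        have "norm (t *\<^sub>R v) \<le> norm v" using \<open>0 < t\<close> \<open>t < s\<close> s by (simp add: mult_left_le_one_le)
        then have "norm (x + t *\<^sub>R v) > R"
          using False norm_triangle_ineq4[of "x + t *\<^sub>R v" "t *\<^sub>R v"] by simp
        then show ?thesis using R_D qD B(1) by (simp add: vanishes_beyond_def)
      qed
    qed
  qed simp_all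
  then have "(\<integral>x. D x \<partial>lborel) = 0"
    unfolding q0 using LIMSEQ_unique tendsto_const by blast
  then show ?thesis
    unfolding D_def[symmetric] by (subst integral_completion) auto
qed

lemma integral_divergence_zero:
  fixes T :: "real^'n \<Rightarrow> real^'n"
  assumes T: "C_k 1 T" and R: "vanishes_beyond R T"
  shows "(\<integral>x. divergence T x \<partial>lebesgue) = 0"
proof -
  have Ti: "C_k 1 (\<lambda>x. T x $ i)" for i using T C_k_vec by blast
  have Ri: "vanishes_beyond R (\<lambda>x. T x $ i)" for i using R by (simp add: vanishes_beyond_def)
  have int: "integrable lebesgue (\<lambda>x. frechet_derivative (\<lambda>x. T x $ i) (at x) v)" for i v
    by (rule integrable_continuous_vanishing[OF C_1_continuous_derivative[OF Ti] vanishes_beyond_derivative[OF Ri]])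
  have "divergence T = (\<lambda>x. \<Sum>i\<in>UNIV. frechet_derivative (\<lambda>x. T x $ i) (at x) (axis i 1))"
    using divergence_components[OF C_1_differentiable[OF T]] by (simp add: grad_nth fun_eq_iff)
  then show ?thesis
    using int by (simp add: integral_derivative_zero[OF Ti Ri])
qed

lemma integration_by_parts:
  fixes T :: "real^'n \<Rightarrow> real^'n"
  assumes g: "C_k 1 g" and T: "C_k 1 T" and R: "vanishes_beyond R T"
  shows "(\<integral>x. g x * divergence T x \<partial>lebesgue) = - (\<integral>x. grad g x \<bullet> T x \<partial>lebesgue)"
proof -
  have 1: "integrable lebesgue (\<lambda>x. g x * divergence T x)"
    using vanishes_beyond_divergence[OF R]
    by (intro integrable_continuous_vanishing[where R = R] continuous_intros C_k_0D[OF g] continuous_divergence T)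
      (simp add: vanishes_beyond_def)
  have 2: "integrable lebesgue (\<lambda>x. grad g x \<bullet> T x)"
    using R by (intro integrable_continuous_vanishing[where R = R] continuous_intros C_k_0D[OF T] continuous_grad g)
      (simp add: vanishes_beyond_def)
  have "(\<integral>x. divergence (\<lambda>x. g x *\<^sub>R T x) x \<partial>lebesgue) = 0"
    using R by (intro integral_divergence_zero[where R = R] C_k_scaleR g T) (simp add: vanishes_beyond_def)
  also have "(\<lambda>x. divergence (\<lambda>x. g x *\<^sub>R T x) x) = (\<lambda>x. g x * divergence T x + grad g x \<bullet> T x)"
    by (rule ext) (rule divergence_scaleR[OF C_1_differentiable[OF g] C_1_differentiable[OF T]])
  finally show ?thesis using 1 2 by simp
qed


section \<open>Cutoff functions\<close>

text \<open>The cutoffs of class \<open>C\<^sup>1\<close> below are built from this function and polynomials.\<close>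

definition pos_sq :: "real \<Rightarrow> real" where
  "pos_sq t = (max 0 t)\<^sup>2"


lemma pos_sq_derivative: "(pos_sq has_real_derivative 2 * max 0 t) (at t)"
proof -
  consider "t < 0" | "t = 0" | "t > 0" by linarith
  then show ?thesis
  proof cases
    case 1
    have "((\<lambda>_. 0::real) has_real_derivative 2 * max 0 t) (at t)" using 1 by simp
    then show ?thesis
      by (rule has_field_derivative_transform_within_open[where S = "{..<0}"])
        (use 1 in \<open>auto simp: pos_sq_def\<close>)
  next
    case 2
    have "(\<lambda>s. (pos_sq (0 + s) - pos_sq 0) / s) \<midarrow>0\<rightarrow> 0"
    proof (rule Lim_null_comparison)
      show "\<forall>\<^sub>F s in at 0. norm ((pos_sq (0 + s) - pos_sq 0) / s) \<le> \<bar>s\<bar>"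
        by (rule always_eventually) (auto simp: pos_sq_def max_def power2_eq_square)
      show "((\<lambda>s::real. \<bar>s\<bar>) \<longlongrightarrow> 0) (at 0)" by (intro tendsto_eq_intros) auto
    qed
    then show ?thesis using 2 by (simp add: has_field_derivative_iff)
  next
    case 3
    have "((\<lambda>s::real. s\<^sup>2) has_real_derivative 2 * max 0 t) (at t)"
      using 3 by (auto intro!: derivative_eq_intros)
    then show ?thesis
      by (rule has_field_derivative_transform_within_open[where S = "{0<..}"])
        (use 3 in \<open>auto simp: pos_sq_def\<close>)
  qed
qed

lemma C_1_real:
  fixes g :: "real \<Rightarrow> real"
  assumes "\<And>t. (g has_real_derivative g' t) (at t)" "continuous_on UNIV g'"
  shows "C_k 1 g"
proof (rule C_1I)
  show "(g has_derivative (\<lambda>h. g' t * h)) (at t)" for t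
    using assms(1) by (simp add: has_field_derivative_def)
  show "continuous_on UNIV (\<lambda>x. g' x * v)" for v
    by (intro continuous_intros assms(2))
qed

lemma pos_sq_C1: "C_k 1 pos_sq"
  by (rule C_1_real[OF pos_sq_derivative]) (intro continuous_intros)

text \<open>A \<open>C\<^sup>1\<close> bump that is 1 on the unit ball and 0 outside the ball of radius 2.\<close>

definition bump :: "real^'n \<Rightarrow> real" where
  "bump x = pos_sq (1 - pos_sq (x \<bullet> x - 1))"

lemma bump_C1: "C_k 1 bump"
  unfolding bump_def
  by (intro C_k_compose[OF pos_sq_C1] C_k_diff C_k_const C_k_inner C_k_bounded_linear[OF bounded_linear_ident])

lemma bump_bounds: "0 \<le> bump x" "bump x \<le> 1"
  by (auto simp: bump_def pos_sq_def power_le_one)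

lemma bump_one:
  assumes "norm x \<le> 1"
  shows "bump x = 1"
proof -
  have "x \<bullet> x \<le> 1" using assms by (metis norm_ge_zero power2_norm_eq_inner power_le_one)
  then show ?thesis by (simp add: bump_def pos_sq_def)
qed

lemma bump_zero:
  assumes "norm x \<ge> 2"
  shows "bump x = 0"
proof -
  have "x \<bullet> x \<ge> 2\<^sup>2" using assms by (metis power2_norm_eq_inner power_mono zero_le_numeral)
  then have "(x \<bullet> x - 1)\<^sup>2 \<ge> 1" by (intro one_le_power) simp
  moreover have "max 0 (x \<bullet> x - 1) = x \<bullet> x - 1" using \<open>x \<bullet> x \<ge> 2\<^sup>2\<close> by simp
  ultimately show ?thesis by (simp add: bump_def pos_sq_def max_absorb1)
qed

lemma ball_cutoff:
  obtains M where "M \<ge> 0" "\<And>(a::real^'n) r. r > 0 \<Longrightarrow> \<exists>b. C_k 1 b \<and> (\<forall>x. 0 \<le> b x \<and> b x \<le> 1) \<and>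
    (\<forall>x\<in>ball a r. b x = 1) \<and> (\<forall>x. b x \<le> indicator (cball a (2 * r)) x) \<and>
    (\<forall>x. norm (grad b x) \<le> M / r * indicator (cball a (2 * r)) x)"
proof -
  have 2: "vanishes_beyond 2 (bump :: real^'n \<Rightarrow> real)"
    by (simp add: vanishes_beyond_def bump_zero)
  obtain M where M: "M \<ge> 0" "\<And>x :: real^'n. norm (grad bump x) \<le> M"
    using continuous_vanishing_bounded[OF continuous_grad[OF bump_C1] vanishes_beyond_grad[OF 2]] by blast
  show thesis
  proof (rule that[OF M(1)])
    fix a :: "real^'n" and r :: real assume r: "r > 0"
    define b where "b x = bump ((1 / r) *\<^sub>R (x - a))" for x
    have outside: "norm ((1 / r) *\<^sub>R (x - a)) > 2" if "x \<notin> cball a (2 * r)" for x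
      unfolding norm_scaleR using that r by (simp add: dist_norm norm_minus_commute pos_less_divide_eq mult.commute)
    have grad_b: "grad b x = (1 / r) *\<^sub>R grad bump ((1 / r) *\<^sub>R (x - a))" for x
    proof (rule grad_eqI)
      have "((\<lambda>x. (1 / r) *\<^sub>R (x - a)) has_derivative (\<lambda>h. (1 / r) *\<^sub>R h)) (at x)"
        by (auto intro!: derivative_eq_intros)
      from has_derivative_compose[OF this grad_has_derivative[OF C_1_differentiable[OF bump_C1]]]
      show "(b has_derivative (\<lambda>h. ((1 / r) *\<^sub>R grad bump ((1 / r) *\<^sub>R (x - a))) \<bullet> h)) (at x)"
        by (simp add: b_def[abs_def])
    qed
    show "\<exists>b. C_k 1 b \<and> (\<forall>x. 0 \<le> b x \<and> b x \<le> 1) \<and>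
      (\<forall>x\<in>ball a r. b x = 1) \<and> (\<forall>x. b x \<le> indicator (cball a (2 * r)) x) \<and>
      (\<forall>x. norm (grad b x) \<le> M / r * indicator (cball a (2 * r)) x)"
    proof (intro exI[of _ b] conjI allI ballI)
      show "C_k 1 b" unfolding b_def
        by (intro C_k_compose[OF bump_C1] C_k_scaleR C_k_diff C_k_const C_k_bounded_linear[OF bounded_linear_ident])
      fix x
      show "0 \<le> b x" "b x \<le> 1" by (simp_all add: b_def bump_bounds)
      show "b x \<le> indicator (cball a (2 * r)) x"
        using bump_bounds(2) outside[of x] bump_zero[of "(1 / r) *\<^sub>R (x - a)"]
        by (cases "x \<in> cball a (2 * r)") (simp_all add: b_def)
      show "norm (grad b x) \<le> M / r * indicator (cball a (2 * r)) x"
      proof (cases "x \<in> cball a (2 * r)")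
        case True
        then show ?thesis using M(2)[of "(1 / r) *\<^sub>R (x - a)"] r by (simp add: grad_b divide_right_mono)
      next
        case False
        then show ?thesis
          using vanishes_beyond_grad[OF 2] outside[of x] by (simp add: grad_b vanishes_beyond_def)
      qed
    next
      fix x assume "x \<in> ball a r"
      then have "norm ((1 / r) *\<^sub>R (x - a)) \<le> 1"
        unfolding norm_scaleR using r by (simp add: dist_norm norm_minus_commute)
      then show "b x = 1" by (simp add: b_def bump_one)
    qed
  qed
qed

text \<open>The constant \<open>M\<close> bounds the gradient of the bump for the unit ball; for a ball of radius \<open>r\<close>
  scaling gives \<open>M / r\<close>.\<close>

definition cuts_out_balls ::
    "real \<Rightarrow> 'i set \<Rightarrow> ('i \<Rightarrow> real^'n) \<Rightarrow> ('i \<Rightarrow> real) \<Rightarrow> (real^'n \<Rightarrow> real) \<Rightarrow> bool" where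
  "cuts_out_balls M I a r \<psi> \<longleftrightarrow> C_k 1 \<psi> \<and> (\<forall>x. 0 \<le> \<psi> x \<and> \<psi> x \<le> 1) \<and>
     (\<forall>i\<in>I. \<forall>x\<in>ball (a i) (r i). \<psi> x = 0) \<and>
     (\<forall>x. 1 - \<psi> x \<le> (\<Sum>i\<in>I. indicator (cball (a i) (2 * r i)) x)) \<and>
     (\<forall>x. norm (grad \<psi> x) \<le> (\<Sum>i\<in>I. M / r i * indicator (cball (a i) (2 * r i)) x))"

text \<open>The product of the cutoffs of the single balls, for which both bounds are subadditive.\<close>

lemma finite_balls_cutoff:
  "\<exists>M\<ge>0. \<forall>(I :: 'i set) (a :: 'i \<Rightarrow> real^'n) r. finite I \<longrightarrow> (\<forall>i\<in>I. r i > 0) \<longrightarrow> (\<exists>\<psi>. cuts_out_balls M I a r \<psi>)"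
proof -
  obtain M where M: "M \<ge> 0" "\<And>(a::real^'n) r. r > 0 \<Longrightarrow> \<exists>b. C_k 1 b \<and> (\<forall>x. 0 \<le> b x \<and> b x \<le> 1) \<and>
    (\<forall>x\<in>ball a r. b x = 1) \<and> (\<forall>x. b x \<le> indicator (cball a (2 * r)) x) \<and>
    (\<forall>x. norm (grad b x) \<le> M / r * indicator (cball a (2 * r)) x)"
    using ball_cutoff by blast
  show ?thesis
  proof (intro exI[of _ M] conjI allI impI)
    show "M \<ge> 0" by (rule M(1))
    fix I :: "'i set" and a :: "'i \<Rightarrow> real^'n" and r :: "'i \<Rightarrow> real"
    assume "finite I" "\<forall>i\<in>I. r i > 0"
    then show "\<exists>\<psi>. cuts_out_balls M I a r \<psi>"
      unfolding cuts_out_balls_def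
    proof (induction I)
      case empty
      have "grad (\<lambda>_. 1) x = 0" for x :: "real^'n" by (rule grad_eqI) simp
      then show ?case by (intro exI[of _ "\<lambda>_. 1"]) (auto intro: C_k_const)
    next
      case (insert j I)
      then obtain \<psi> where \<psi>: "C_k 1 \<psi>" "\<And>x. 0 \<le> \<psi> x" "\<And>x. \<psi> x \<le> 1" "\<And>i x. i \<in> I \<Longrightarrow> x \<in> ball (a i) (r i) \<Longrightarrow> \<psi> x = 0"
        "\<And>x. 1 - \<psi> x \<le> (\<Sum>i\<in>I. indicator (cball (a i) (2 * r i)) x)"
        "\<And>x. norm (grad \<psi> x) \<le> (\<Sum>i\<in>I. M / r i * indicator (cball (a i) (2 * r i)) x)" by auto
      obtain b where b: "C_k 1 b" "\<And>x. 0 \<le> b x" "\<And>x. b x \<le> 1" "\<And>x. x \<in> ball (a j) (r j) \<Longrightarrow> b x = 1"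
        "\<And>x. b x \<le> indicator (cball (a j) (2 * r j)) x"
        "\<And>x. norm (grad b x) \<le> M / r j * indicator (cball (a j) (2 * r j)) x"
        using M(2)[of "r j" "a j"] insert.prems by blast
      have b': "C_k 1 (\<lambda>x. 1 - b x)" by (intro C_k_diff C_k_const b)
      have grad_b': "grad (\<lambda>x. 1 - b x) x = - grad b x" for x
        by (rule grad_eqI) (use grad_has_derivative[OF C_1_differentiable[OF b(1)]] in
          \<open>auto intro!: derivative_eq_intros\<close>)
      show ?case
      proof (intro exI[of _ "\<lambda>x. \<psi> x * (1 - b x)"] conjI allI ballI)
        show "C_k 1 (\<lambda>x. \<psi> x * (1 - b x))" by (intro C_k_mult \<psi> b')
        fix x
        show "0 \<le> \<psi> x * (1 - b x)" "\<psi> x * (1 - b x) \<le> 1"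
          using \<psi>(2,3)[of x] b(2,3)[of x] by (auto intro: mult_le_one)
        have "1 - \<psi> x * (1 - b x) = (1 - \<psi> x) + \<psi> x * b x" by (simp add: algebra_simps)
        also have "\<psi> x * b x \<le> b x" using \<psi>(3)[of x] b(2)[of x] \<psi>(2)[of x] by (simp add: mult_left_le_one_le)
        finally show "1 - \<psi> x * (1 - b x) \<le> (\<Sum>i\<in>insert j I. indicator (cball (a i) (2 * r i)) x)"
          using \<psi>(5)[of x] b(5)[of x] insert.hyps by simp
        have "norm (grad (\<lambda>x. \<psi> x * (1 - b x)) x) = norm (\<psi> x *\<^sub>R (- grad b x) + (1 - b x) *\<^sub>R grad \<psi> x)"
          unfolding grad_mult[OF C_1_differentiable[OF \<psi>(1)] C_1_differentiable[OF b']] grad_b' ..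
        also have "\<dots> \<le> \<psi> x * norm (grad b x) + (1 - b x) * norm (grad \<psi> x)"
          using \<psi>(2)[of x] b(3)[of x] by (intro norm_triangle_le) simp
        also have "\<dots> \<le> norm (grad b x) + norm (grad \<psi> x)"
          using \<psi>(2,3)[of x] b(2,3)[of x] by (intro add_mono mult_left_le_one_le) auto
        finally show "norm (grad (\<lambda>x. \<psi> x * (1 - b x)) x)
          \<le> (\<Sum>i\<in>insert j I. M / r i * indicator (cball (a i) (2 * r i)) x)"
          using \<psi>(6)[of x] b(6)[of x] insert.hyps by simp
      next
        fix i x assume "i \<in> insert j I" "x \<in> ball (a i) (r i)"
        then show "\<psi> x * (1 - b x) = 0" using \<psi>(4) b(4) by auto
      qed
    qed
  qed
qed


lemma compact_cutoff:
  fixes C :: "(real^'n) set"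
  assumes C: "compact C" and U: "open U" "C \<subseteq> U"
  obtains \<zeta> :: "real^'n \<Rightarrow> real" and V where "C_k 1 \<zeta>" "\<And>x. 0 \<le> \<zeta> x" "\<And>x. \<zeta> x \<le> 1" "open V" "C \<subseteq> V" "\<And>x. x \<in> V \<Longrightarrow> \<zeta> x = 1"
    "compact (closure {x. \<zeta> x \<noteq> 0})" "closure {x. \<zeta> x \<noteq> 0} \<subseteq> U"
proof -
  have "\<exists>r>0. cball x (2 * r) \<subseteq> U" if x: "x \<in> C" for x
  proof -
    obtain e where "e > 0" "cball x e \<subseteq> U" 
      using U(1)[unfolded open_contains_cball] subsetD[OF U(2) x] by blast
    then show ?thesis by (intro exI[of _ "e / 2"]) simp
  qed
  then have "\<forall>x\<in>C. \<exists>r>0. cball x (2 * r) \<subseteq> U" by blast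
  from bchoice[OF this] obtain r where "\<forall>x\<in>C. r x > 0 \<and> cball x (2 * r x) \<subseteq> U" ..
  then have r: "\<And>x. x \<in> C \<Longrightarrow> r x > 0" "\<And>x. x \<in> C \<Longrightarrow> cball x (2 * r x) \<subseteq> U" by simp_all
  obtain I where I: "I \<subseteq> C" "finite I" "C \<subseteq> (\<Union>x\<in>I. ball x (r x))"
    by (rule compactE_image[OF C, of C "\<lambda>x. ball x (r x)"]) (use r in auto)
  obtain M where M: "\<And>(I :: (real^'n) set) (a :: real^'n \<Rightarrow> real^'n) r. finite I \<Longrightarrow> \<forall>i\<in>I. r i > 0 \<Longrightarrow>
    \<exists>\<psi>. cuts_out_balls M I a r \<psi>"
    using finite_balls_cutoff[where 'i = "real^'n" and 'n = 'n] by blast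
  have rI: "\<forall>i\<in>I. r i > 0" using r(1) I(1) by blast
  obtain \<psi> :: "real^'n \<Rightarrow> real" where "C_k 1 \<psi>" "\<forall>x. 0 \<le> \<psi> x \<and> \<psi> x \<le> 1" "\<forall>i\<in>I. \<forall>x\<in>ball i (r i). \<psi> x = 0"
    "\<forall>x. 1 - \<psi> x \<le> (\<Sum>i\<in>I. indicator (cball i (2 * r i)) x)"
    using M[OF I(2) rI, of "\<lambda>x. x"] unfolding cuts_out_balls_def by (elim exE conjE)
  then have \<psi>: "C_k 1 \<psi>" "\<And>x. 0 \<le> \<psi> x" "\<And>x. \<psi> x \<le> 1"
    "\<And>i x. i \<in> I \<Longrightarrow> x \<in> ball i (r i) \<Longrightarrow> \<psi> x = 0"
    "\<And>x. 1 - \<psi> x \<le> (\<Sum>i\<in>I. indicator (cball i (2 * r i)) x)" by simp_all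
  let ?K = "\<Union>x\<in>I. cball x (2 * r x)"
  have K: "compact ?K" using I(2) by (intro compact_UN) auto
  have sub: "{x. 1 - \<psi> x \<noteq> 0} \<subseteq> ?K"
  proof (rule subsetI, rule ccontr)
    fix x assume x: "x \<in> {x. 1 - \<psi> x \<noteq> 0}" "x \<notin> ?K"
    then have "(\<Sum>i\<in>I. indicator (cball i (2 * r i)) x :: real) = 0" by (intro sum.neutral) auto
    then show False using \<psi>(3,5)[of x] x(1) by simp
  qed
  then have supp: "closure {x. 1 - \<psi> x \<noteq> 0} \<subseteq> ?K"
    using K by (intro closure_minimal compact_imp_closed)
  show thesis
  proof (rule that[of "\<lambda>x. 1 - \<psi> x" "\<Union>x\<in>I. ball x (r x)"])
    show "C_k 1 (\<lambda>x. 1 - \<psi> x)" by (intro C_k_diff C_k_const \<psi>)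
    show "compact (closure {x. 1 - \<psi> x \<noteq> 0})"
      unfolding compact_closure by (rule bounded_subset[OF compact_imp_bounded[OF K] sub])
    show "closure {x. 1 - \<psi> x \<noteq> 0} \<subseteq> U" using supp r(2) I(1) by blast
    show "1 - \<psi> x = 1" if "x \<in> (\<Union>x\<in>I. ball x (r x))" for x using that \<psi>(4) by auto
  qed (use \<psi>(2,3) I(3) in auto)
qed

text \<open>A set of vanishing codimension-one measure has zero capacity for the total variation: a
  ball of radius \<open>r\<close> is removed at cost \<open>O(r\<^sup>N\<^sup>-\<^sup>1)\<close> in \<open>\<integral>\<bar>\<nabla>\<psi>\<bar>\<close>. Fields may therefore be cut off near
  the singular set with an arbitrarily small error in their divergence.\<close>

lemma codim1_null_cutoff:
  fixes Z :: "(real^'n) set"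
  assumes N: "CARD('n) \<ge> 2" and Z: "codim1_null Z" "closed Z" and e: "e > 0"
  obtains \<psi> V where "C_k 1 \<psi>" "\<And>x. 0 \<le> \<psi> x" "\<And>x. \<psi> x \<le> 1" "open V" "Z \<inter> cball 0 R \<subseteq> V"
    "\<And>x. x \<in> V \<Longrightarrow> \<psi> x = 0"
    "integrable lebesgue (\<lambda>x. norm (grad \<psi> x))" "(\<integral>x. norm (grad \<psi> x) \<partial>lebesgue) \<le> e"
    "integrable lebesgue (\<lambda>x. 1 - \<psi> x)" "(\<integral>x. 1 - \<psi> x \<partial>lebesgue) \<le> e"
proof -
  define n where "n = CARD('n)"
  obtain M where M: "M \<ge> 0" "\<And>(I :: nat set) (a :: nat \<Rightarrow> real^'n) r. finite I \<Longrightarrow> \<forall>i\<in>I. r i > 0 \<Longrightarrow>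
    \<exists>\<psi>. cuts_out_balls M I a r \<psi>"
    using finite_balls_cutoff[where 'i = nat and 'n = 'n] by blast
  define c where "c = unit_ball_vol (real n) * 2 ^ n"
  have c: "c \<ge> 0" by (simp add: c_def)
  have vol: "measure lborel (cball a (2 * s)) = c * s ^ n" if "s \<ge> 0" for a :: "real^'n" and s
    using content_cball[of "2 * s" a] that by (simp add: c_def n_def power_mult_distrib)
  \<comment> \<open>Radii are at most 1 when the sum is, so that the \<open>N\<close>-th powers of the radii are controlled as well.\<close>
  define \<epsilon> where "\<epsilon> = min 1 (e / ((M + 1) * (c + 1)))"
  have den: "(M + 1) * (c + 1) > 0" using M(1) c by (simp add: add_nonneg_pos)
  have \<epsilon>: "\<epsilon> > 0" "\<epsilon> \<le> 1" using e den by (simp_all add: \<epsilon>_def)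
  have "\<epsilon> \<le> e / ((M + 1) * (c + 1))" by (simp add: \<epsilon>_def)
  then have \<epsilon>e: "((M + 1) * (c + 1)) * \<epsilon> \<le> e" using den by (simp add: field_simps)
  have "M * c * \<epsilon> \<le> ((M + 1) * (c + 1)) * \<epsilon>" "c * \<epsilon> \<le> ((M + 1) * (c + 1)) * \<epsilon>"
    using M(1) c \<epsilon>(1) by (auto intro!: mult_right_mono simp: algebra_simps)
  then have small: "M * c * \<epsilon> \<le> e" "c * \<epsilon> \<le> e" using \<epsilon>e by linarith+
  obtain a :: "nat \<Rightarrow> real^'n" and r where r: "\<And>k. r k \<ge> 0" and cover: "Z \<subseteq> (\<Union>k. ball (a k) (r k))"
    and sum: "(\<Sum>k. ennreal (r k ^ (n - 1))) \<le> ennreal \<epsilon>"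
    using Z(1)[unfolded codim1_null_def, rule_format, OF \<epsilon>(1)] unfolding n_def by (elim exE conjE) blast
  have "compact (Z \<inter> cball 0 R)" using Z(2) by (intro closed_Int_compact) auto
  then obtain I where I: "I \<subseteq> {k. r k > 0}" "finite I" "Z \<inter> cball 0 R \<subseteq> (\<Union>k\<in>I. ball (a k) (r k))"
  proof (rule compactE_image[of _ "{k. r k > 0}" "\<lambda>k. ball (a k) (r k)"])
    show "Z \<inter> cball 0 R \<subseteq> (\<Union>k\<in>{k. r k > 0}. ball (a k) (r k))"
    proof
      fix x assume "x \<in> Z \<inter> cball 0 R"
      then obtain k where "x \<in> ball (a k) (r k)" using cover by blast
      moreover from this have "r k > 0" by (metis ball_eq_empty empty_iff not_le)
      ultimately show "x \<in> (\<Union>k\<in>{k. r k > 0}. ball (a k) (r k))" by blast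
    qed
  qed auto
  have rI: "r k > 0" if "k \<in> I" for k using that I(1) by auto
  have "ennreal (\<Sum>k\<in>I. r k ^ (n - 1)) = (\<Sum>k\<in>I. ennreal (r k ^ (n - 1)))"
    using r by (simp add: sum_ennreal)
  also have "\<dots> \<le> (\<Sum>k. ennreal (r k ^ (n - 1)))"
    by (rule sum_le_suminf) (auto simp: I(2))
  finally have s1: "(\<Sum>k\<in>I. r k ^ (n - 1)) \<le> \<epsilon>"
    using sum \<epsilon>(1) by (meson ennreal_le_iff less_imp_le order_trans)
  have rn: "r k ^ n \<le> r k ^ (n - 1)" if "k \<in> I" for k
  proof -
    have "r k ^ (n - 1) \<le> (\<Sum>k\<in>I. r k ^ (n - 1))"
      using that r by (intro member_le_sum) (auto simp: I(2))
    then have "r k ^ (n - 1) \<le> 1" using s1 \<epsilon>(2) by linarith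
    then have "r k \<le> 1" using N r[of k] by (metis n_def diff_is_0_eq not_less_eq_eq numeral_2_eq_2 one_less_power not_le zero_less_diff One_nat_def)
    then show ?thesis using r[of k] by (intro power_decreasing) auto
  qed
  have s2: "(\<Sum>k\<in>I. r k ^ n) \<le> \<epsilon>" using sum_mono[of I "\<lambda>k. r k ^ n" "\<lambda>k. r k ^ (n - 1)", OF rn] s1 by linarith
  obtain \<psi> :: "real^'n \<Rightarrow> real" where "C_k 1 \<psi>" "\<forall>x. 0 \<le> \<psi> x \<and> \<psi> x \<le> 1" "\<forall>i\<in>I. \<forall>x\<in>ball (a i) (r i). \<psi> x = 0"
    "\<forall>x. 1 - \<psi> x \<le> (\<Sum>i\<in>I. indicator (cball (a i) (2 * r i)) x)"
    "\<forall>x. norm (grad \<psi> x) \<le> (\<Sum>i\<in>I. M / r i * indicator (cball (a i) (2 * r i)) x)"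
    using M(2)[OF I(2), of r a] rI unfolding cuts_out_balls_def by auto
  then have \<psi>: "C_k 1 \<psi>" "\<And>x. 0 \<le> \<psi> x" "\<And>x. \<psi> x \<le> 1"
    "\<And>i x. i \<in> I \<Longrightarrow> x \<in> ball (a i) (r i) \<Longrightarrow> \<psi> x = 0"
    "\<And>x. 1 - \<psi> x \<le> (\<Sum>i\<in>I. indicator (cball (a i) (2 * r i)) x)"
    "\<And>x. norm (grad \<psi> x) \<le> (\<Sum>i\<in>I. M / r i * indicator (cball (a i) (2 * r i)) x)" by simp_all
  have ind: "integrable lebesgue (\<lambda>x. B * indicator (cball (a i) (2 * r i)) x :: real)" for B i
    by (rule integrable_cball_indicator)
  have int1: "integrable lebesgue (\<lambda>x. \<Sum>i\<in>I. indicator (cball (a i) (2 * r i)) x :: real)"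
    using ind[of 1] by (intro Bochner_Integration.integrable_sum) simp
  have int2: "integrable lebesgue (\<lambda>x. \<Sum>i\<in>I. M / r i * indicator (cball (a i) (2 * r i)) x)"
    by (intro Bochner_Integration.integrable_sum ind)
  have m1: "(\<lambda>x. 1 - \<psi> x) \<in> borel_measurable lebesgue"
    by (intro continuous_borel_lebesgue continuous_intros C_k_0D[OF \<psi>(1)])
  have m2: "(\<lambda>x. norm (grad \<psi> x)) \<in> borel_measurable lebesgue"
    by (intro continuous_borel_lebesgue continuous_intros continuous_grad \<psi>(1))
  have i1: "integrable lebesgue (\<lambda>x. 1 - \<psi> x)"
    by (rule Bochner_Integration.integrable_bound[OF int1 m1]) (rule AE_I2, use \<psi>(3) order_trans[OF \<psi>(5) abs_ge_self] in simp)
  have i2: "integrable lebesgue (\<lambda>x. norm (grad \<psi> x))"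
    by (rule Bochner_Integration.integrable_bound[OF int2 m2]) (rule AE_I2, use order_trans[OF \<psi>(6) abs_ge_self] in simp)
  have "(\<integral>x. 1 - \<psi> x \<partial>lebesgue) \<le> (\<integral>x. (\<Sum>i\<in>I. indicator (cball (a i) (2 * r i)) x) \<partial>lebesgue)"
    by (rule integral_mono[OF i1 int1 \<psi>(5)])
  also have "\<dots> = (\<Sum>i\<in>I. c * r i ^ n)"
    using ind[of 1] r by (subst Bochner_Integration.integral_sum) (auto simp: vol)
  also have "\<dots> \<le> c * \<epsilon>" using c s2 by (simp add: mult_left_mono flip: sum_distrib_left)
  finally have "(\<integral>x. 1 - \<psi> x \<partial>lebesgue) \<le> e" using small(2) by linarith
  have "(\<integral>x. norm (grad \<psi> x) \<partial>lebesgue) \<le> (\<integral>x. (\<Sum>i\<in>I. M / r i * indicator (cball (a i) (2 * r i)) x) \<partial>lebesgue)"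
    by (rule integral_mono[OF i2 int2 \<psi>(6)])
  also have "\<dots> = (\<Sum>i\<in>I. M / r i * (c * r i ^ n))"
    using r by (subst Bochner_Integration.integral_sum[OF ind]) (auto simp: vol)
  also have "\<dots> = (\<Sum>i\<in>I. M * c * r i ^ (n - 1))"
  proof (rule sum.cong[OF refl])
    fix i assume "i \<in> I"
    have "n = Suc (n - 1)" using N by (simp add: n_def)
    then have "r i ^ n = r i * r i ^ (n - 1)" by (metis power_Suc)
    then show "M / r i * (c * r i ^ n) = M * c * r i ^ (n - 1)" using rI[OF \<open>i \<in> I\<close>] by simp
  qed
  also have "\<dots> \<le> M * c * \<epsilon>" using M(1) c s1 by (simp add: mult_left_mono flip: sum_distrib_left)
  finally have "(\<integral>x. norm (grad \<psi> x) \<partial>lebesgue) \<le> e" using small(1) by linarith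
  show thesis
  proof (rule that[of \<psi> "\<Union>k\<in>I. ball (a k) (r k)"])
    show "\<psi> x = 0" if "x \<in> (\<Union>k\<in>I. ball (a k) (r k))" for x using that \<psi>(4) by blast
    show "open (\<Union>k\<in>I. ball (a k) (r k))" by blast
  qed fact+
qed


section \<open>Calibration by the normalized gradient\<close>

text \<open>A positive \<open>C\<^sup>1\<close> function above the identity that agrees with it beyond \<open>c\<close>. Dividing \<open>v\<close> by the square
  root of its value at \<open>\<bar>v\<bar>\<^sup>2\<close> normalizes \<open>v\<close> if \<open>\<bar>v\<bar>\<^sup>2 \<ge> c\<close>, and gives length at most 1 in any case.\<close>

definition regularize :: "real \<Rightarrow> real \<Rightarrow> real" where
  "regularize c s = s + pos_sq (c - s) / c"

lemma regularize_ge: "c > 0 \<Longrightarrow> s \<le> regularize c s"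
  by (simp add: regularize_def pos_sq_def)

lemma regularize_pos:
  assumes "c > 0"
  shows "regularize c s > 0"
proof (cases "s \<ge> c")
  case True
  then show ?thesis using assms regularize_ge[OF assms, of s] by linarith
next
  case False
  have "c * regularize c s = c * s + (c - s)\<^sup>2"
    using False assms by (simp add: regularize_def pos_sq_def field_simps)
  also have "\<dots> = (s - c / 2)\<^sup>2 + 3 / 4 * c\<^sup>2" by (simp add: power2_eq_square algebra_simps)
  also have "\<dots> > 0" using assms by (intro add_nonneg_pos) auto
  finally show ?thesis using assms zero_less_mult_pos by blast
qed

lemma regularize_eq: "c \<le> s \<Longrightarrow> regularize c s = s"
  by (simp add: regularize_def pos_sq_def)

definition inv_sqrt :: "real \<Rightarrow> real \<Rightarrow> real" where
  "inv_sqrt c s = 1 / sqrt (regularize c s)"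

lemma regularize_derivative:
  assumes "c > 0"
  shows "(regularize c has_real_derivative 1 - 2 * max 0 (c - s) / c) (at s)"
proof -
  have "((\<lambda>s. pos_sq (c - s)) has_real_derivative 2 * max 0 (c - s) * (-1)) (at s)"
    by (rule DERIV_chain2[OF pos_sq_derivative]) (auto intro!: derivative_eq_intros)
  then show ?thesis
    unfolding regularize_def[abs_def] using assms
    by (auto intro!: derivative_eq_intros simp: field_simps)
qed

lemma inv_sqrt_derivative:
  assumes "c > 0"
  shows "(inv_sqrt c has_real_derivative
    - (1 - 2 * max 0 (c - s) / c) / (2 * regularize c s * sqrt (regularize c s))) (at s)"
proof -
  have pos: "regularize c s > 0" by (rule regularize_pos[OF assms])
  have "((\<lambda>s. sqrt (regularize c s)) has_real_derivative
      (1 - 2 * max 0 (c - s) / c) * (inverse (sqrt (regularize c s)) / 2)) (at s)"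
    using DERIV_chain2[OF DERIV_real_sqrt[OF pos] regularize_derivative[OF assms]] by (simp add: mult.commute)
  note D = DERIV_inverse'[OF this]
  define q where "q = sqrt (regularize c s)"
  have q: "q > 0" "regularize c s = q * q" using pos by (simp_all add: q_def)
  show ?thesis
    unfolding inv_sqrt_def[abs_def] inverse_eq_divide[symmetric]
    by (rule DERIV_cong[OF D]) (use q in \<open>simp_all add: q_def[symmetric] field_simps\<close>)
qed

lemma inv_sqrt_C1:
  assumes "c > 0"
  shows "C_k 1 (inv_sqrt c)"
proof (rule C_1_real[OF inv_sqrt_derivative[OF assms]])
  have "continuous_on UNIV (regularize c)"
    using regularize_derivative[OF assms] by (meson DERIV_continuous_on DERIV_subset subset_UNIV)
  then show "continuous_on UNIV (\<lambda>s. - (1 - 2 * max 0 (c - s) / c) / (2 * regularize c s * sqrt (regularize c s)))"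
    using regularize_pos[OF assms] assms by (intro continuous_intros) (auto simp: less_imp_neq[symmetric])
qed

text \<open>A \<open>C\<^sup>1\<close> transition from 0 on the negative axis to 1 beyond 1.\<close>

definition smooth_step :: "real \<Rightarrow> real" where
  "smooth_step t = 1 - pos_sq (1 - pos_sq t)"

lemma smooth_step_derivative:
  "(smooth_step has_real_derivative 4 * max 0 (1 - pos_sq t) * max 0 t) (at t)"
proof -
  have "((\<lambda>t. 1 - pos_sq t) has_real_derivative - (2 * max 0 t)) (at t)"
    using pos_sq_derivative by (auto intro!: derivative_eq_intros)
  from DERIV_chain2[OF pos_sq_derivative this]
  have "((\<lambda>t. pos_sq (1 - pos_sq t)) has_real_derivative 2 * max 0 (1 - pos_sq t) * - (2 * max 0 t)) (at t)" .
  then show ?thesis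
    unfolding smooth_step_def[abs_def] by (auto intro!: derivative_eq_intros)
qed

lemma smooth_step_C1: "C_k 1 smooth_step"
  by (rule C_1_real[OF smooth_step_derivative]) (intro continuous_intros C_k_0D[OF pos_sq_C1])

lemma smooth_step_values:
  "t \<le> 0 \<Longrightarrow> smooth_step t = 0" "t \<ge> 1 \<Longrightarrow> smooth_step t = 1" "0 \<le> smooth_step t" "smooth_step t \<le> 1"
proof -
  have "pos_sq (1 - pos_sq t) \<le> 1"
    by (auto simp: pos_sq_def power_le_one)
  then show "0 \<le> smooth_step t" by (simp add: smooth_step_def)
  show "smooth_step t = 1" if "t \<ge> 1"
  proof -
    have "t\<^sup>2 \<ge> 1" using that by (rule one_le_power)
    then have "max 0 (1 - t\<^sup>2) = 0" by simp
    then show ?thesis using that by (simp add: smooth_step_def pos_sq_def)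
  qed
qed (auto simp: smooth_step_def pos_sq_def)

text \<open>A field that points to the side where \<open>G\<close> increases has nonnegative flux out of \<open>{G < 0}\<close>.
  Replacing the indicator function by \<open>C\<^sup>1\<close> functions of \<open>G\<close> avoids the surface measure of the
  possibly singular boundary.\<close>

lemma flux_nonneg:
  fixes G :: "real^'n \<Rightarrow> real"
  assumes G: "C_k 1 G" and Y: "C_k 1 Y" "vanishes_beyond R Y"
    and sign: "\<And>x. grad G x \<bullet> Y x \<ge> 0"
  shows "(LINT x:{x. G x < 0}|lebesgue. divergence Y x) \<ge> 0"
proof -
  define h where "h k x = smooth_step (- real k * G x)" for k x
  have lin: "C_k 1 (\<lambda>x. - real k * G x)" for k
    by (intro C_k_mult C_k_const G)
  have h_C1: "C_k 1 (h k)" for k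
    unfolding h_def by (rule C_k_compose[OF smooth_step_C1 lin])
  have grad_h: "grad (h k) x \<bullet> Y x \<le> 0" for k x
  proof -
    have "grad (\<lambda>x. - real k * G x) x = - real k *\<^sub>R grad G x"
      by (rule grad_eqI) (use has_derivative_mult_right[OF grad_has_derivative[OF C_1_differentiable[OF G]], of "- real k"] in simp)
    then have "grad (h k) x = (4 * max 0 (1 - pos_sq (- real k * G x)) * max 0 (- real k * G x)) *\<^sub>R (- real k *\<^sub>R grad G x)"
      using grad_compose_real[OF smooth_step_derivative C_1_differentiable[OF lin], of k x]
      unfolding h_def by simp
    then show ?thesis using sign[of x] by (simp add: mult_nonneg_nonneg)
  qed
  have cont: "continuous_on UNIV (divergence Y)" by (rule continuous_divergence[OF Y(1)])
  have int: "integrable lebesgue (divergence Y)"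
    by (rule integrable_continuous_vanishing[OF cont vanishes_beyond_divergence[OF Y(2)]])
  have "(\<integral>x. h k x * divergence Y x \<partial>lebesgue) \<ge> 0" for k
  proof -
    have "(\<integral>x. h k x * divergence Y x \<partial>lebesgue) = - (\<integral>x. grad (h k) x \<bullet> Y x \<partial>lebesgue)"
      by (rule integration_by_parts[OF h_C1 Y])
    moreover have "(\<integral>x. - (grad (h k) x \<bullet> Y x) \<partial>lebesgue) \<ge> 0"
      using grad_h by (intro integral_nonneg_AE AE_I2) simp
    ultimately show ?thesis by simp
  qed
  moreover have "(\<lambda>k. \<integral>x. h k x * divergence Y x \<partial>lebesgue)
      \<longlonglongrightarrow> (\<integral>x. indicator {x. G x < 0} x *\<^sub>R divergence Y x \<partial>lebesgue)"
  proof (rule integral_dominated_convergence)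
    show "integrable lebesgue (\<lambda>x. \<bar>divergence Y x\<bar>)" using int by simp
    show "(\<lambda>x. h k x * divergence Y x) \<in> borel_measurable lebesgue" for k
      by (intro continuous_borel_lebesgue continuous_intros C_k_0D[OF h_C1] cont)
    have "open {x. G x < 0}" by (intro open_Collect_less continuous_intros C_k_0D[OF G])
    then have "{x. G x < 0} \<in> sets lebesgue" by auto
    then show "(\<lambda>x. indicator {x. G x < 0} x *\<^sub>R divergence Y x) \<in> borel_measurable lebesgue"
      using borel_measurable_integrable[OF int] by measurable
    show "AE x in lebesgue. norm (h k x * divergence Y x) \<le> \<bar>divergence Y x\<bar>" for k
      using smooth_step_values(3,4) by (intro AE_I2) (simp add: h_def abs_mult mult_left_le_one_le)
    show "AE x in lebesgue. (\<lambda>k. h k x * divergence Y x) \<longlonglongrightarrow> indicator {x. G x < 0} x *\<^sub>R divergence Y x"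
    proof (rule AE_I2)
      fix x
      have "(\<lambda>k. h k x) \<longlonglongrightarrow> indicator {x. G x < 0} x"
      proof (cases "G x < 0")
        case True
        obtain k0 :: nat where k0: "1 / (- G x) < real k0" using reals_Archimedean2 by blast
        have "h k x = 1" if "k \<ge> k0" for k
        proof -
          have "1 / (- G x) < real k" using k0 that by linarith
          then have "1 \<le> - real k * G x" using True by (simp add: field_simps)
          then show ?thesis by (simp add: h_def smooth_step_values)
        qed
        then have "\<forall>\<^sub>F k in sequentially. h k x = 1" by (auto simp: eventually_sequentially)
        then show ?thesis using True by (simp add: tendsto_eventually)
      next
        case False
        then have "h k x = 0" for k by (simp add: h_def smooth_step_values)
        then show ?thesis using False by simp
      qed
      then show "(\<lambda>k. h k x * divergence Y x) \<longlonglongrightarrow> indicator {x. G x < 0} x *\<^sub>R divergence Y x"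
        unfolding real_scaleR_def by (intro tendsto_intros)
    qed
  qed
  ultimately show ?thesis
    unfolding set_lebesgue_integral_def by (intro LIMSEQ_le_const) auto
qed

lemma test_fieldsD:
  assumes "T \<in> test_fields U"
  shows "C_k 1 T" "compact (closure {x. T x \<noteq> 0})" "closure {x. T x \<noteq> 0} \<subseteq> U"
  using assms by (auto simp: test_fields_def)

lemma compact_support_vanishes_beyond:
  fixes T :: "real^'n \<Rightarrow> 'b::zero"
  assumes "compact (closure {x. T x \<noteq> 0})"
  obtains R where "vanishes_beyond R T"
proof -
  have "bounded {x. T x \<noteq> 0}" using assms by (simp add: compact_closure)
  then obtain R where "\<forall>x\<in>{x. T x \<noteq> 0}. norm x \<le> R" by (auto simp: bounded_iff)
  then have "vanishes_beyond R T" by (force simp: vanishes_beyond_def)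
  then show thesis by (rule that)
qed

locale subcalibrated =
  fixes G :: "real^'n \<Rightarrow> real" and Z :: "(real^'n) set"
  assumes dim: "CARD('n) \<ge> 2" and smooth: "C_infinity G"
    and Z: "closed Z" "codim1_null Z"
    and regular: "x \<notin> Z \<Longrightarrow> grad G x \<noteq> 0"
    and sign: "x \<notin> Z \<Longrightarrow> G x * level_op G x \<ge> 0"
begin

abbreviation "E \<equiv> {x. G x < 0}"

lemma G_smooth: "C_k k G"
  using smooth by (rule C_infinityD)

lemma grad_smooth: "C_k k (grad G)"
  by (rule C_k_grad[OF G_smooth])

lemma grad_sq_smooth: "C_k k (\<lambda>x. (norm (grad G x))\<^sup>2)"
  unfolding power2_norm_eq_inner by (intro C_k_inner grad_smooth)

lemma E_lebesgue: "E \<in> sets lebesgue"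
proof -
  have "open E" by (intro open_Collect_less continuous_intros C_k_0D[OF G_smooth])
  then show ?thesis by auto
qed

lemma level_op_continuous: "continuous_on UNIV (level_op G)"
  unfolding level_op_def[abs_def] laplacian_def
  by (intro continuous_intros continuous_divergence continuous_grad grad_smooth grad_sq_smooth G_smooth)

text \<open>On the zero set the sign is obtained in the limit, because \<open>G\<close> is positive at points that
  are reached in the direction of its gradient.\<close>

lemma level_op_nonneg:
  assumes x: "x \<notin> Z" and "G x \<ge> 0"
  shows "level_op G x \<ge> 0"
proof (cases "G x = 0")
  case False
  then show ?thesis using sign[OF x] assms(2) by (simp add: zero_le_mult_iff)
next
  case True
  define \<gamma> where "\<gamma> t = x + t *\<^sub>R grad G x" for t :: real
  have d\<gamma>: "(\<gamma> has_derivative (\<lambda>s. s *\<^sub>R grad G x)) (at 0)"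
    unfolding \<gamma>_def by (auto intro!: derivative_eq_intros)
  have "(G has_derivative (\<lambda>h. grad G x \<bullet> h)) (at (\<gamma> 0))"
    using grad_has_derivative[OF C_1_differentiable[OF G_smooth]] by (simp add: \<gamma>_def)
  from has_derivative_compose[OF d\<gamma> this]
  have "((\<lambda>t. G (\<gamma> t)) has_real_derivative grad G x \<bullet> grad G x) (at 0)"
    by (simp add: has_field_derivative_def mult_commute_abs)
  moreover have "grad G x \<bullet> grad G x > 0" using regular[OF x] by simp
  ultimately obtain \<delta> where \<delta>: "\<delta> > 0" "\<And>t. 0 < t \<Longrightarrow> t < \<delta> \<Longrightarrow> G (\<gamma> 0) < G (\<gamma> (0 + t))"
    using DERIV_pos_inc_right by blast
  have \<gamma>0: "((\<lambda>t. \<gamma> t) \<longlongrightarrow> x) (at_right 0)"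
    unfolding \<gamma>_def by (auto intro!: tendsto_eq_intros)
  have "isCont (level_op G) x" using level_op_continuous by (simp add: continuous_on_eq_continuous_at)
  then have lim: "((\<lambda>t. level_op G (\<gamma> t)) \<longlongrightarrow> level_op G x) (at_right 0)"
    using \<gamma>0 by (rule isCont_tendsto_compose)
  have "\<forall>\<^sub>F t in at_right 0. \<gamma> t \<in> - Z"
    using topological_tendstoD[OF \<gamma>0, of "- Z"] x Z(1) by auto
  moreover have "\<forall>\<^sub>F t in at_right 0. t < \<delta>"
    using \<delta>(1) by (auto simp: eventually_at_right_field)
  moreover have "\<forall>\<^sub>F t in at_right 0. (t :: real) > 0"
    by (simp add: eventually_at_right_less)
  ultimately have "\<forall>\<^sub>F t in at_right 0. level_op G (\<gamma> t) \<ge> 0"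
  proof eventually_elim
    case (elim t)
    then have "G (\<gamma> t) > 0" using \<delta>(2)[of t] True by (simp add: \<gamma>_def)
    then show ?case using sign[of "\<gamma> t"] elim by (simp add: zero_le_mult_iff)
  qed
  then show ?thesis
    by (intro tendsto_lowerbound[OF lim]) auto
qed

lemma level_op_nonpos: "x \<notin> Z \<Longrightarrow> G x < 0 \<Longrightarrow> level_op G x \<le> 0"
  using sign[of x] by (simp add: zero_le_mult_iff)

lemma flux_density_sign:
  assumes "p \<ge> 0" "p \<noteq> 0 \<Longrightarrow> x \<notin> Z"
  shows "G x \<ge> 0 \<Longrightarrow> p * (level_op G x / norm (grad G x) ^ 3) \<ge> 0"
    and "G x < 0 \<Longrightarrow> p * (level_op G x / norm (grad G x) ^ 3) \<le> 0"
proof -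
  show "p * (level_op G x / norm (grad G x) ^ 3) \<ge> 0" if "G x \<ge> 0"
    using level_op_nonneg[OF assms(2) that] assms(1) by (cases "p = 0") (simp_all add: divide_nonneg_nonneg)
  show "p * (level_op G x / norm (grad G x) ^ 3) \<le> 0" if "G x < 0"
  proof (cases "p = 0")
    case False
    then have "level_op G x / norm (grad G x) ^ 3 \<le> 0"
      using level_op_nonpos[OF assms(2) that] by (simp add: divide_nonpos_nonneg)
    then show ?thesis using assms(1) by (rule mult_nonneg_nonpos[rotated])
  qed simp
qed

text \<open>The unit normal \<open>\<nabla>G / \<bar>\<nabla>G\<bar>\<close>, modified where \<open>\<bar>\<nabla>G\<bar>\<^sup>2 < c\<close> so as to be \<open>C\<^sup>1\<close> on the whole space.\<close>

definition normal :: "real \<Rightarrow> real^'n \<Rightarrow> real^'n" where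
  "normal c x = inv_sqrt c ((norm (grad G x))\<^sup>2) *\<^sub>R grad G x"

lemma normal_C1: "c > 0 \<Longrightarrow> C_k 1 (normal c)"
  unfolding normal_def by (intro C_k_scaleR C_k_compose[OF inv_sqrt_C1] grad_sq_smooth grad_smooth)

lemma norm_normal_le: "c > 0 \<Longrightarrow> norm (normal c x) \<le> 1"
proof -
  assume c: "c > 0"
  have "norm (grad G x) \<le> sqrt (regularize c ((norm (grad G x))\<^sup>2))"
    using regularize_ge[OF c, of "(norm (grad G x))\<^sup>2"] by (rule real_le_rsqrt)
  then show ?thesis
    using regularize_pos[OF c, of "(norm (grad G x))\<^sup>2"] by (simp add: normal_def inv_sqrt_def)
qed

lemma normal_inner_grad:
  assumes "c > 0"
  shows "grad G x \<bullet> normal c x \<ge> 0"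
    and "c \<le> (norm (grad G x))\<^sup>2 \<Longrightarrow> grad G x \<bullet> normal c x = norm (grad G x)"
proof -
  show "grad G x \<bullet> normal c x \<ge> 0"
    using regularize_pos[OF assms, of "(norm (grad G x))\<^sup>2"] by (simp add: normal_def inv_sqrt_def)
  assume "c \<le> (norm (grad G x))\<^sup>2"
  then show "grad G x \<bullet> normal c x = norm (grad G x)"
    by (simp add: normal_def inv_sqrt_def regularize_eq flip: power2_norm_eq_inner)
      (simp add: power2_eq_square)
qed

lemma divergence_normal:
  assumes c: "c > 0" and x: "c \<le> (norm (grad G x))\<^sup>2"
  shows "divergence (normal c) x = level_op G x / norm (grad G x) ^ 3"
proof -
  define n where "n = norm (grad G x)"
  have n: "n > 0" using c x by (metis n_def norm_eq_zero norm_ge_zero not_le order_le_less power_zero_numeral)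
  have reg: "regularize c (n\<^sup>2) = n\<^sup>2" using x by (simp add: n_def regularize_eq)
  have "grad (\<lambda>y. inv_sqrt c ((norm (grad G y))\<^sup>2)) x
      = (- (1 - 2 * max 0 (c - n\<^sup>2) / c) / (2 * regularize c (n\<^sup>2) * sqrt (regularize c (n\<^sup>2)))) *\<^sub>R
        grad (\<lambda>y. (norm (grad G y))\<^sup>2) x"
    unfolding n_def by (rule grad_compose_real[OF inv_sqrt_derivative[OF c] C_1_differentiable[OF grad_sq_smooth]])
  also have "\<dots> = (- 1 / (2 * n ^ 3)) *\<^sub>R grad (\<lambda>y. (norm (grad G y))\<^sup>2) x"
    using x n by (simp add: reg n_def[symmetric] power3_eq_cube power2_eq_square[of n, symmetric] mult.assoc)
  finally have 1: "grad (\<lambda>y. inv_sqrt c ((norm (grad G y))\<^sup>2)) x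
    = (- 1 / (2 * n ^ 3)) *\<^sub>R grad (\<lambda>y. (norm (grad G y))\<^sup>2) x" .
  have "divergence (normal c) x = inv_sqrt c (n\<^sup>2) * divergence (grad G) x
    + grad (\<lambda>y. inv_sqrt c ((norm (grad G y))\<^sup>2)) x \<bullet> grad G x"
    unfolding normal_def[abs_def] n_def
    by (rule divergence_scaleR[OF C_1_differentiable[OF C_k_compose[OF inv_sqrt_C1[OF c] grad_sq_smooth]]
          C_1_differentiable[OF grad_smooth]])
  also have "inv_sqrt c (n\<^sup>2) = 1 / n" using n by (simp add: inv_sqrt_def reg)
  finally have "divergence (normal c) x = 1 / n * laplacian G x
      - 1 / (2 * n ^ 3) * (grad (\<lambda>y. (norm (grad G y))\<^sup>2) x \<bullet> grad G x)"
    unfolding 1 laplacian_def by simp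
  also have "\<dots> = level_op G x / n ^ 3"
    using n by (simp add: level_op_def n_def[symmetric] field_simps power2_eq_square power3_eq_cube)
  finally show ?thesis by (simp add: n_def)
qed

definition cut_normal :: "(real^'n \<Rightarrow> real) \<Rightarrow> (real^'n \<Rightarrow> real) \<Rightarrow> real \<Rightarrow> real^'n \<Rightarrow> real^'n" where
  "cut_normal \<psi> \<zeta> c x = \<psi> x *\<^sub>R (\<zeta> x *\<^sub>R normal c x)"

text \<open>Where \<open>\<psi> \<zeta>\<close> is nonzero, the modified normal is the true one; the bound \<open>e\<close> is the price of cutting
  it off near \<open>Z\<close>.\<close>

definition good_cutoff :: "real \<Rightarrow> (real^'n \<Rightarrow> real) \<Rightarrow> (real^'n \<Rightarrow> real) \<Rightarrow> real \<Rightarrow> bool" where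
  "good_cutoff e \<psi> \<zeta> c \<longleftrightarrow> c > 0 \<and> C_k 1 \<psi> \<and> (\<forall>x. 0 \<le> \<psi> x \<and> \<psi> x \<le> 1) \<and>
     integrable lebesgue (\<lambda>x. norm (grad \<psi> x)) \<and> (\<integral>x. norm (grad \<psi> x) \<partial>lebesgue) \<le> e \<and>
     (\<forall>x. \<psi> x * \<zeta> x \<noteq> 0 \<longrightarrow> x \<notin> Z \<and> c \<le> (norm (grad G x))\<^sup>2)"

lemma cut_normal_C1:
  assumes "C_k 1 \<zeta>" "good_cutoff e \<psi> \<zeta> c"
  shows "C_k 1 (cut_normal \<psi> \<zeta> c)"
  unfolding cut_normal_def using assms
  by (intro C_k_scaleR normal_C1) (auto simp: good_cutoff_def)

lemma norm_cut_normal_le: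
  assumes "good_cutoff e \<psi> \<zeta> c" "\<And>x. 0 \<le> \<zeta> x" "\<And>x. \<zeta> x \<le> 1"
  shows "norm (cut_normal \<psi> \<zeta> c x) \<le> 1"
proof -
  have "norm (normal c x) \<le> 1" "0 \<le> \<psi> x" "\<psi> x \<le> 1"
    using norm_normal_le assms(1) by (auto simp: good_cutoff_def)
  then show ?thesis
    using assms(2,3)[of x] by (simp add: cut_normal_def mult_le_one)
qed

lemma divergence_cut_normal:
  assumes "C_k 1 \<zeta>" "good_cutoff e \<psi> \<zeta> c"
  shows "divergence (cut_normal \<psi> \<zeta> c) x = \<psi> x * \<zeta> x * (level_op G x / norm (grad G x) ^ 3)
    + \<psi> x * (grad \<zeta> x \<bullet> normal c x) + \<zeta> x * (grad \<psi> x \<bullet> normal c x)"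
proof -
  have c: "c > 0" and \<psi>: "C_k 1 \<psi>" and g: "\<psi> x * \<zeta> x \<noteq> 0 \<Longrightarrow> c \<le> (norm (grad G x))\<^sup>2"
    using assms(2) by (auto simp: good_cutoff_def)
  have "divergence (cut_normal \<psi> \<zeta> c) x = \<psi> x * (\<zeta> x * divergence (normal c) x + grad \<zeta> x \<bullet> normal c x)
    + grad \<psi> x \<bullet> (\<zeta> x *\<^sub>R normal c x)"
    unfolding cut_normal_def[abs_def]
      divergence_scaleR[OF C_1_differentiable[OF \<psi>] C_1_differentiable[OF C_k_scaleR[OF assms(1) normal_C1[OF c]]]]
      divergence_scaleR[OF C_1_differentiable[OF assms(1)] C_1_differentiable[OF normal_C1[OF c]]] ..
  moreover have "\<psi> x * \<zeta> x * divergence (normal c) x = \<psi> x * \<zeta> x * (level_op G x / norm (grad G x) ^ 3)"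
    using g divergence_normal[OF c] by (cases "\<psi> x * \<zeta> x = 0") auto
  ultimately show ?thesis by (simp add: algebra_simps)
qed

lemma integrable_E: "integrable lebesgue f \<Longrightarrow> integrable lebesgue (\<lambda>x. indicator E x *\<^sub>R (f x :: real))"
  by (rule integrable_mult_indicator[OF E_lebesgue])

text \<open>The difference \<open>\<psi> (\<zeta> \<nu> - T)\<close> has a nonnegative component along \<open>\<nabla>G\<close>, so the flux of \<open>\<psi> T\<close> is at most
  that of \<open>\<psi> \<zeta> \<nu>\<close>. The fluxes of \<open>T\<close> and \<open>\<psi> T\<close> differ by the error of the cutoff.\<close>

lemma cut_normal_maximal_flux:
  assumes T: "C_k 1 T" "\<And>x. norm (T x) \<le> 1"
    and \<zeta>: "C_k 1 \<zeta>" "\<And>x. 0 \<le> \<zeta> x" "\<And>x. \<zeta> x \<le> 1" "vanishes_beyond R \<zeta>"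
    and T\<zeta>: "\<And>x. T x \<noteq> 0 \<Longrightarrow> \<zeta> x = 1" and e: "e > 0"
  obtains \<psi> c where "good_cutoff e \<psi> \<zeta> c"
    "(LINT x:E|lebesgue. divergence T x) \<le> (LINT x:E|lebesgue. divergence (cut_normal \<psi> \<zeta> c) x) + e"
proof -
  have R: "vanishes_beyond R T" using T\<zeta> \<zeta>(4) unfolding vanishes_beyond_def by (metis zero_neq_one)
  have contT: "continuous_on UNIV (divergence T)" by (rule continuous_divergence[OF T(1)])
  obtain B where B: "B \<ge> 0" "\<And>x. norm (divergence T x) \<le> B"
    using continuous_vanishing_bounded[OF contT vanishes_beyond_divergence[OF R]] by blast
  define e' where "e' = e / (B + 1)"
  have e': "e' > 0" "e' \<le> e" "B * e' + e' = e"
  proof -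
    show "e' > 0" using e B(1) by (simp add: e'_def)
    show "e' \<le> e" using e B(1) by (simp add: e'_def field_simps)
    have "(B + 1) * e' = e" using B(1) by (simp add: e'_def)
    then show "B * e' + e' = e" by (simp add: algebra_simps)
  qed
  obtain \<psi> V where \<psi>: "C_k 1 \<psi>" "\<And>x. 0 \<le> \<psi> x" "\<And>x. \<psi> x \<le> 1" "open V" "Z \<inter> cball 0 R \<subseteq> V"
    "\<And>x. x \<in> V \<Longrightarrow> \<psi> x = 0"
    "integrable lebesgue (\<lambda>x. norm (grad \<psi> x))" "(\<integral>x. norm (grad \<psi> x) \<partial>lebesgue) \<le> e'"
    "integrable lebesgue (\<lambda>x. 1 - \<psi> x)" "(\<integral>x. 1 - \<psi> x \<partial>lebesgue) \<le> e'"
    by (rule codim1_null_cutoff[OF dim Z(2) Z(1) e'(1), of R]) (rule that)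
  \<comment> \<open>Away from the cut-out neighbourhood of \<open>Z\<close> the gradient is bounded below by compactness.\<close>
  define K where "K = cball 0 R - V"
  have "compact K" unfolding K_def by (intro compact_diff compact_cball \<psi>(4))
  have K_pos: "(norm (grad G x))\<^sup>2 > 0" "x \<notin> Z" if "x \<in> K" for x
  proof -
    show "x \<notin> Z" using that \<psi>(5) by (auto simp: K_def)
    then show "(norm (grad G x))\<^sup>2 > 0" using regular by simp
  qed
  have "\<exists>c>0. \<forall>x\<in>K. c \<le> (norm (grad G x))\<^sup>2"
  proof (cases "K = {}")
    case False
    obtain y where "y \<in> K" "\<forall>x\<in>K. (norm (grad G y))\<^sup>2 \<le> (norm (grad G x))\<^sup>2"
      using continuous_attains_inf[OF \<open>compact K\<close> False continuous_on_subset[OF C_k_0D[OF grad_sq_smooth] subset_UNIV]]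
      by blast
    then show ?thesis using K_pos(1) by blast
  qed (auto intro: zero_less_one)
  then obtain c where c: "c > 0" "\<And>x. x \<in> K \<Longrightarrow> c \<le> (norm (grad G x))\<^sup>2" by blast
  have inK: "x \<in> K" if "\<psi> x * \<zeta> x \<noteq> 0" for x
    using that \<psi>(6)[of x] \<zeta>(4) by (auto simp: K_def vanishes_beyond_def not_le[symmetric])
  have good: "good_cutoff e' \<psi> \<zeta> c"
    unfolding good_cutoff_def using \<psi>(1-3,7,8) c inK K_pos(2) by blast
  define X where "X = cut_normal \<psi> \<zeta> c"
  have X_C1: "C_k 1 X" unfolding X_def by (rule cut_normal_C1[OF \<zeta>(1) good])
  have X_R: "vanishes_beyond R X" using \<zeta>(4) by (auto simp: X_def cut_normal_def vanishes_beyond_def)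
  have \<psi>T_C1: "C_k 1 (\<lambda>x. \<psi> x *\<^sub>R T x)" by (intro C_k_scaleR \<psi> T)
  have \<psi>T_R: "vanishes_beyond R (\<lambda>x. \<psi> x *\<^sub>R T x)" using R by (simp add: vanishes_beyond_def)
  have int: "integrable lebesgue (divergence Y)" if "C_k 1 Y" "vanishes_beyond R Y" for Y :: "real^'n \<Rightarrow> real^'n"
    by (rule integrable_continuous_vanishing[OF continuous_divergence[OF that(1)] vanishes_beyond_divergence[OF that(2)]])
  have "(LINT x:E|lebesgue. divergence (\<lambda>x. X x - \<psi> x *\<^sub>R T x) x) \<ge> 0"
  proof (rule flux_nonneg[OF G_smooth])
    show "C_k 1 (\<lambda>x. X x - \<psi> x *\<^sub>R T x)" by (intro C_k_diff X_C1 \<psi>T_C1)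
    show "vanishes_beyond R (\<lambda>x. X x - \<psi> x *\<^sub>R T x)" using X_R R by (simp add: vanishes_beyond_def)
    fix x
    have "\<psi> x * (grad G x \<bullet> T x) \<le> \<psi> x * (\<zeta> x * (grad G x \<bullet> normal c x))"
    proof (cases "T x = 0 \<or> \<psi> x = 0")
      case True
      then show ?thesis using \<psi>(2) \<zeta>(2) normal_inner_grad(1)[OF c(1)] by (auto intro!: mult_nonneg_nonneg)
    next
      case False
      then have 1: "\<zeta> x = 1" using T\<zeta> by blast
      then have "c \<le> (norm (grad G x))\<^sup>2" using False inK c(2) by simp
      then have "grad G x \<bullet> normal c x = norm (grad G x)" by (rule normal_inner_grad(2)[OF c(1)])
      moreover have "grad G x \<bullet> T x \<le> norm (grad G x) * norm (T x)" by (rule norm_cauchy_schwarz)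
      moreover have "norm (grad G x) * norm (T x) \<le> norm (grad G x)"
        using T(2)[of x] by (simp add: mult_left_le)
      ultimately show ?thesis using 1 \<psi>(2)[of x] by (simp add: mult_left_mono)
    qed
    then show "grad G x \<bullet> (X x - \<psi> x *\<^sub>R T x) \<ge> 0"
      by (simp add: X_def cut_normal_def inner_diff_right)
  qed
  also have "divergence (\<lambda>x. X x - \<psi> x *\<^sub>R T x) = (\<lambda>x. divergence X x - divergence (\<lambda>x. \<psi> x *\<^sub>R T x) x)"
    by (rule ext) (rule divergence_diff[OF C_1_differentiable[OF X_C1] C_1_differentiable[OF \<psi>T_C1]])
  finally have 1: "(LINT x:E|lebesgue. divergence (\<lambda>x. \<psi> x *\<^sub>R T x) x) \<le> (LINT x:E|lebesgue. divergence X x)"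
    unfolding set_lebesgue_integral_def
    using integrable_E[OF int[OF X_C1 X_R]] integrable_E[OF int[OF \<psi>T_C1 \<psi>T_R]]
    by (simp add: right_diff_distrib)
  have "(LINT x:E|lebesgue. divergence T x) - (LINT x:E|lebesgue. divergence (\<lambda>x. \<psi> x *\<^sub>R T x) x)
    = (\<integral>x. indicator E x *\<^sub>R divergence T x - indicator E x *\<^sub>R divergence (\<lambda>x. \<psi> x *\<^sub>R T x) x \<partial>lebesgue)"
    unfolding set_lebesgue_integral_def
    using integrable_E[OF int[OF T(1) R]] integrable_E[OF int[OF \<psi>T_C1 \<psi>T_R]] by simp
  also have "\<dots> \<le> (\<integral>x. B * (1 - \<psi> x) + norm (grad \<psi> x) \<partial>lebesgue)"
  proof (rule integral_mono)
    show "integrable lebesgue (\<lambda>x. indicator E x *\<^sub>R divergence T x - indicator E x *\<^sub>R divergence (\<lambda>x. \<psi> x *\<^sub>R T x) x)"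
      using integrable_E[OF int[OF T(1) R]] integrable_E[OF int[OF \<psi>T_C1 \<psi>T_R]] by simp
    show "integrable lebesgue (\<lambda>x. B * (1 - \<psi> x) + norm (grad \<psi> x))" using \<psi>(7,9) by simp
    fix x
    have "divergence T x - divergence (\<lambda>x. \<psi> x *\<^sub>R T x) x = (1 - \<psi> x) * divergence T x - grad \<psi> x \<bullet> T x"
      by (simp add: divergence_scaleR[OF C_1_differentiable[OF \<psi>(1)] C_1_differentiable[OF T(1)]] algebra_simps)
    moreover have "(1 - \<psi> x) * divergence T x \<le> B * (1 - \<psi> x)"
    proof -
      have "divergence T x \<le> B" using B(2)[of x] by simp
      then have "(1 - \<psi> x) * divergence T x \<le> (1 - \<psi> x) * B"
        using \<psi>(3)[of x] by (intro mult_left_mono) auto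
      then show ?thesis by (simp add: mult.commute)
    qed
    moreover have "\<bar>grad \<psi> x \<bullet> T x\<bar> \<le> norm (grad \<psi> x)"
      using Cauchy_Schwarz_ineq2[of "grad \<psi> x" "T x"] T(2)[of x]
      by (meson mult_left_le norm_ge_zero order_trans)
    moreover have "B * (1 - \<psi> x) \<ge> 0" using B(1) \<psi>(3)[of x] by simp
    ultimately show "indicator E x *\<^sub>R divergence T x - indicator E x *\<^sub>R divergence (\<lambda>x. \<psi> x *\<^sub>R T x) x
      \<le> B * (1 - \<psi> x) + norm (grad \<psi> x)"
      by (auto simp: indicator_def)
  qed
  also have "\<dots> = B * (\<integral>x. 1 - \<psi> x \<partial>lebesgue) + (\<integral>x. norm (grad \<psi> x) \<partial>lebesgue)"
    using \<psi>(7,9) by simp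
  also have "\<dots> \<le> B * e' + e'" by (intro add_mono mult_left_mono \<psi>(8,10) B(1))
  finally have "(LINT x:E|lebesgue. divergence T x) \<le> (LINT x:E|lebesgue. divergence X x) + e"
    using 1 e'(3) by linarith
  moreover have "good_cutoff e \<psi> \<zeta> c"
    using good e'(2) by (auto simp: good_cutoff_def)
  ultimately show thesis using that unfolding X_def by blast
qed

text \<open>Since \<open>div \<nu> = \<L>(G) / \<bar>\<nabla>G\<bar>\<^sup>3\<close> has the sign of \<open>G\<close>, neither adding points of \<open>{G \<ge> 0}\<close> to \<open>{G < 0}\<close>
  nor removing points from it decreases the flux of the normal.\<close>

lemma competitor_flux:
  assumes \<zeta>: "C_k 1 \<zeta>" "\<And>x. 0 \<le> \<zeta> x" "\<And>x. \<zeta> x \<le> 1" "vanishes_beyond R \<zeta>"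
    and V: "open V" "\<And>x. x \<in> V \<Longrightarrow> \<zeta> x = 1"
    and good: "good_cutoff e \<psi> \<zeta> c"
    and K: "K \<in> sets lebesgue" "(K - E) \<union> (E - K) \<subseteq> V"
  shows "(LINT x:E|lebesgue. divergence (cut_normal \<psi> \<zeta> c) x)
    \<le> (LINT x:K|lebesgue. divergence (cut_normal \<psi> \<zeta> c) x) + e"
proof -
  define X where "X = cut_normal \<psi> \<zeta> c"
  have c: "c > 0" and \<psi>: "\<And>x. 0 \<le> \<psi> x" "\<And>x. \<psi> x \<le> 1" "integrable lebesgue (\<lambda>x. norm (grad \<psi> x))"
    "(\<integral>x. norm (grad \<psi> x) \<partial>lebesgue) \<le> e" "\<And>x. \<psi> x * \<zeta> x \<noteq> 0 \<Longrightarrow> x \<notin> Z"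
    using good by (auto simp: good_cutoff_def)
  have X_C1: "C_k 1 X" unfolding X_def by (rule cut_normal_C1[OF \<zeta>(1) good])
  have X_R: "vanishes_beyond R X" using \<zeta>(4) by (auto simp: X_def cut_normal_def vanishes_beyond_def)
  have int: "integrable lebesgue (divergence X)"
    by (rule integrable_continuous_vanishing[OF continuous_divergence[OF X_C1] vanishes_beyond_divergence[OF X_R]])
  have intK: "integrable lebesgue (\<lambda>x. indicator K x *\<^sub>R divergence X x)"
    by (rule integrable_mult_indicator[OF K(1) int])
  have div: "divergence X x = \<psi> x * \<zeta> x * (level_op G x / norm (grad G x) ^ 3) + grad \<psi> x \<bullet> normal c x"
    if "x \<in> V" for x
  proof -
    have "((\<lambda>y. 1) has_derivative (\<lambda>h. 0 \<bullet> h)) (at x)" by simp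
    then have "(\<zeta> has_derivative (\<lambda>h. 0 \<bullet> h)) (at x)"
      by (rule has_derivative_transform_within_open[OF _ V(1) that]) (simp add: V(2))
    then have "grad \<zeta> x = 0" by (rule grad_eqI)
    then show ?thesis
      using divergence_cut_normal[OF \<zeta>(1) good, of x] V(2)[OF that] by (simp add: X_def)
  qed
  have bound: "\<bar>grad \<psi> x \<bullet> normal c x\<bar> \<le> norm (grad \<psi> x)" for x
    using Cauchy_Schwarz_ineq2[of "grad \<psi> x" "normal c x"] norm_normal_le[OF c, of x]
    by (meson mult_left_le norm_ge_zero order_trans)
  have "- (\<integral>x. norm (grad \<psi> x) \<partial>lebesgue) = (\<integral>x. - norm (grad \<psi> x) \<partial>lebesgue)" by simp
  also have "\<dots> \<le> (\<integral>x. indicator K x *\<^sub>R divergence X x - indicator E x *\<^sub>R divergence X x \<partial>lebesgue)"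
  proof (rule integral_mono)
    show "integrable lebesgue (\<lambda>x. - norm (grad \<psi> x))" using \<psi>(3) by simp
    show "integrable lebesgue (\<lambda>x. indicator K x *\<^sub>R divergence X x - indicator E x *\<^sub>R divergence X x)"
      using intK integrable_E[OF int] by simp
    fix x
    consider "x \<in> K" "x \<notin> E" | "x \<in> E" "x \<notin> K" | "x \<in> K \<longleftrightarrow> x \<in> E" by blast
    then show "- norm (grad \<psi> x) \<le> indicator K x *\<^sub>R divergence X x - indicator E x *\<^sub>R divergence X x"
    proof cases
      case 1
      have "0 \<le> \<psi> x * \<zeta> x * (level_op G x / norm (grad G x) ^ 3)"
        using \<psi>(1,5) \<zeta>(2) 1 by (intro flux_density_sign(1)) auto
      then show ?thesis using div[of x] 1 K(2) bound[of x] by auto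
    next
      case 2
      have "\<psi> x * \<zeta> x * (level_op G x / norm (grad G x) ^ 3) \<le> 0"
        using \<psi>(1,5) \<zeta>(2) 2 by (intro flux_density_sign(2)) auto
      then show ?thesis using div[of x] 2 K(2) bound[of x] by auto
    next
      case 3
      then show ?thesis by (simp add: indicator_def)
    qed
  qed
  also have "\<dots> = (LINT x:K|lebesgue. divergence X x) - (LINT x:E|lebesgue. divergence X x)"
    unfolding set_lebesgue_integral_def using intK integrable_E[OF int] by simp
  finally show ?thesis using \<psi>(4) unfolding X_def by linarith
qed

text \<open>With a cutoff that equals 1 near \<open>C\<close> and near the support of \<open>T\<close>, both comparisons apply to the
  same field: \<open>T\<close> has at most its flux out of \<open>{G < 0}\<close>, which is at most its flux out of \<open>K\<close>.\<close>

lemma calibration: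
  assumes U: "open U" and T: "T \<in> test_fields U" "\<And>x. norm (T x) \<le> 1"
    and C: "compact C" "C \<subseteq> U" and K: "K \<in> sets lebesgue" "(K - E) \<union> (E - K) \<subseteq> C" and e: "e > 0"
  obtains X where "X \<in> test_fields U" "\<And>x. norm (X x) \<le> 1"
    "(LINT x:E|lebesgue. divergence T x) \<le> (LINT x:K|lebesgue. divergence X x) + e"
proof -
  have "compact (C \<union> closure {x. T x \<noteq> 0})" "C \<union> closure {x. T x \<noteq> 0} \<subseteq> U"
    using C test_fieldsD[OF T(1)] by auto
  from compact_cutoff[OF this(1) U this(2)]
  obtain \<zeta> :: "real^'n \<Rightarrow> real" and V where \<zeta>: "C_k 1 \<zeta>" "\<And>x. 0 \<le> \<zeta> x" "\<And>x. \<zeta> x \<le> 1" and V: "open V"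
    "C \<union> closure {x. T x \<noteq> 0} \<subseteq> V" "\<And>x. x \<in> V \<Longrightarrow> \<zeta> x = 1"
    and supp: "compact (closure {x. \<zeta> x \<noteq> 0})" "closure {x. \<zeta> x \<noteq> 0} \<subseteq> U" by metis
  obtain R where R: "vanishes_beyond R \<zeta>" using compact_support_vanishes_beyond[OF supp(1)] by blast
  have T\<zeta>: "\<zeta> x = 1" if "T x \<noteq> 0" for x
    using that V(2,3) closure_subset[of "{x. T x \<noteq> 0}"] by blast
  have "e / 2 > 0" using e by simp
  obtain \<psi> c where good: "good_cutoff (e / 2) \<psi> \<zeta> c"
    and le: "(LINT x:E|lebesgue. divergence T x) \<le> (LINT x:E|lebesgue. divergence (cut_normal \<psi> \<zeta> c) x) + e / 2"
    using cut_normal_maximal_flux[OF test_fieldsD(1)[OF T(1)] T(2) \<zeta> R T\<zeta> \<open>e / 2 > 0\<close>] by metis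
  show thesis
  proof (rule that)
    have sub: "{x. cut_normal \<psi> \<zeta> c x \<noteq> 0} \<subseteq> {x. \<zeta> x \<noteq> 0}" by (auto simp: cut_normal_def)
    have "bounded {x. cut_normal \<psi> \<zeta> c x \<noteq> 0}"
      using supp(1) bounded_subset[OF _ sub] by (simp add: compact_closure)
    then show "cut_normal \<psi> \<zeta> c \<in> test_fields U"
      using cut_normal_C1[OF \<zeta>(1) good] closure_mono[OF sub] supp(2)
      by (auto simp: test_fields_def compact_closure)
    show "norm (cut_normal \<psi> \<zeta> c x) \<le> 1" for x
      by (rule norm_cut_normal_le[OF good \<zeta>(2,3)])
    have "(LINT x:E|lebesgue. divergence (cut_normal \<psi> \<zeta> c) x)
      \<le> (LINT x:K|lebesgue. divergence (cut_normal \<psi> \<zeta> c) x) + e / 2"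
      by (rule competitor_flux[OF \<zeta> R V(1,3) good K(1) order_trans[OF K(2)]]) (use V(2) in simp_all)
    then show "(LINT x:E|lebesgue. divergence T x)
      \<le> (LINT x:K|lebesgue. divergence (cut_normal \<psi> \<zeta> c) x) + e"
      using le by linarith
  qed
qed

text \<open>The flux of the truncated normal is bounded on \<open>{G < 0}\<close> because its divergence is there at most
  the contribution of the cutoffs.\<close>

lemma finite_perimeter: "locally_finite_perimeter E"
  unfolding locally_finite_perimeter_def
proof (intro conjI E_lebesgue allI impI)
  fix U :: "(real^'n) set" assume U: "open U \<and> bounded U"
  have cU: "compact (closure U)" using U by (simp add: compact_closure)
  obtain \<zeta> :: "real^'n \<Rightarrow> real" and V where \<zeta>: "C_k 1 \<zeta>" "\<And>x. 0 \<le> \<zeta> x" "\<And>x. \<zeta> x \<le> 1" and V: "open V"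
    "closure U \<subseteq> V" "\<And>x. x \<in> V \<Longrightarrow> \<zeta> x = 1" and supp: "compact (closure {x. \<zeta> x \<noteq> 0})"
    using compact_cutoff[OF cU open_UNIV] by (metis top_greatest)
  obtain R where R: "vanishes_beyond R \<zeta>" using compact_support_vanishes_beyond[OF supp] by blast
  have int_\<zeta>: "integrable lebesgue (\<lambda>x. norm (grad \<zeta> x))"
    using vanishes_beyond_grad[OF R]
    by (intro integrable_continuous_vanishing[where R = R] continuous_intros continuous_grad \<zeta>)
      (simp add: vanishes_beyond_def)
  define B where "B = 2 + (\<integral>x. norm (grad \<zeta> x) \<partial>lebesgue)"
  have "(LINT x:E|lebesgue. divergence T x) \<le> B" if T: "T \<in> test_fields U" "\<And>x. norm (T x) \<le> 1" for T
  proof -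
    have T\<zeta>: "\<zeta> x = 1" if "T x \<noteq> 0" for x
      using that V(2,3) test_fieldsD(3)[OF T(1)] closure_subset[of "{x. T x \<noteq> 0}"] closure_subset[of U] by blast
    obtain \<psi> c where good: "good_cutoff 1 \<psi> \<zeta> c"
      and le: "(LINT x:E|lebesgue. divergence T x) \<le> (LINT x:E|lebesgue. divergence (cut_normal \<psi> \<zeta> c) x) + 1"
      using cut_normal_maximal_flux[OF test_fieldsD(1)[OF T(1)] T(2) \<zeta> R T\<zeta> zero_less_one] by metis
    have c: "c > 0" and \<psi>: "\<And>x. 0 \<le> \<psi> x" "\<And>x. \<psi> x \<le> 1" "integrable lebesgue (\<lambda>x. norm (grad \<psi> x))"
      "(\<integral>x. norm (grad \<psi> x) \<partial>lebesgue) \<le> 1" "\<And>x. \<psi> x * \<zeta> x \<noteq> 0 \<Longrightarrow> x \<notin> Z"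
      using good by (auto simp: good_cutoff_def)
    have X_C1: "C_k 1 (cut_normal \<psi> \<zeta> c)" by (rule cut_normal_C1[OF \<zeta>(1) good])
    have X_R: "vanishes_beyond R (cut_normal \<psi> \<zeta> c)" using R by (auto simp: cut_normal_def vanishes_beyond_def)
    have bound: "\<bar>v \<bullet> normal c x\<bar> \<le> norm v" for v x
      using Cauchy_Schwarz_ineq2[of v "normal c x"] norm_normal_le[OF c, of x]
      by (meson mult_left_le norm_ge_zero order_trans)
    have shrink: "a * y \<le> n" if "\<bar>y\<bar> \<le> n" "0 \<le> a" "a \<le> 1" for a y n :: real
    proof -
      have "a * y \<le> a * n" using that by (intro mult_left_mono) auto
      also have "\<dots> \<le> n" using that by (intro mult_left_le_one_le) auto
      finally show ?thesis .
    qed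
    have "(LINT x:E|lebesgue. divergence (cut_normal \<psi> \<zeta> c) x)
      \<le> (\<integral>x. norm (grad \<zeta> x) + norm (grad \<psi> x) \<partial>lebesgue)"
      unfolding set_lebesgue_integral_def
    proof (rule integral_mono)
      show "integrable lebesgue (\<lambda>x. indicator E x *\<^sub>R divergence (cut_normal \<psi> \<zeta> c) x)"
        by (intro integrable_E integrable_continuous_vanishing[OF continuous_divergence[OF X_C1]
              vanishes_beyond_divergence[OF X_R]])
      show "integrable lebesgue (\<lambda>x. norm (grad \<zeta> x) + norm (grad \<psi> x))" using int_\<zeta> \<psi>(3) by simp
      fix x
      have "x \<in> E \<Longrightarrow> \<psi> x * \<zeta> x * (level_op G x / norm (grad G x) ^ 3) \<le> 0"
        using \<psi>(1,5) \<zeta>(2) by (intro flux_density_sign(2)) auto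
      moreover have "\<psi> x * (grad \<zeta> x \<bullet> normal c x) \<le> 1 * norm (grad \<zeta> x)"
        using shrink[OF bound \<psi>(1,2)] by simp
      moreover have "\<zeta> x * (grad \<psi> x \<bullet> normal c x) \<le> 1 * norm (grad \<psi> x)"
        using shrink[OF bound \<zeta>(2,3)] by simp
      ultimately show "indicator E x *\<^sub>R divergence (cut_normal \<psi> \<zeta> c) x \<le> norm (grad \<zeta> x) + norm (grad \<psi> x)"
        using divergence_cut_normal[OF \<zeta>(1) good, of x] by (auto simp: indicator_def)
    qed
    also have "\<dots> = (\<integral>x. norm (grad \<zeta> x) \<partial>lebesgue) + (\<integral>x. norm (grad \<psi> x) \<partial>lebesgue)"
      using int_\<zeta> \<psi>(3) by simp
    finally show ?thesis using le \<psi>(4) unfolding B_def by linarith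
  qed
  then have "perimeter E U \<le> ereal B"
    unfolding perimeter_def by (intro SUP_least) auto
  then show "perimeter E U < \<infinity>" by (rule order_le_less_trans) simp
qed

theorem perimeter_minimizing: "locally_perimeter_minimizing E"
  unfolding locally_perimeter_minimizing_def
proof (intro conjI finite_perimeter allI impI)
  fix U K :: "(real^'n) set"
  let ?D = "(K - E) \<union> (E - K)"
  assume "open U \<and> bounded U \<and> locally_finite_perimeter K \<and> compact (closure ?D) \<and> closure ?D \<subseteq> U"
  then have U: "open U" and K: "K \<in> sets lebesgue" and D: "compact (closure ?D)" "closure ?D \<subseteq> U"
    by (auto simp: locally_finite_perimeter_def)
  show "perimeter E U \<le> perimeter K U"
    unfolding perimeter_def[of E]
  proof (rule SUP_least)
    fix T assume "T \<in> {T \<in> test_fields U. \<forall>x. norm (T x) \<le> 1}"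
    then have T: "T \<in> test_fields U" "\<And>x. norm (T x) \<le> 1" by auto
    show "ereal (LINT x:E|lebesgue. divergence T x) \<le> perimeter K U"
    proof (rule ereal_le_epsilon2)
      fix e :: real assume e: "e > 0"
      obtain X where X: "X \<in> test_fields U" "\<And>x. norm (X x) \<le> 1"
        and le: "(LINT x:E|lebesgue. divergence T x) \<le> (LINT x:K|lebesgue. divergence X x) + e"
        by (rule calibration[OF U T D K closure_subset e]) (rule that)
      have "ereal (LINT x:K|lebesgue. divergence X x) \<le> perimeter K U"
        unfolding perimeter_def using X by (intro SUP_upper) auto
      then have "ereal (LINT x:K|lebesgue. divergence X x) + ereal e \<le> perimeter K U + ereal e"
        by (rule add_right_mono)
      then show "ereal (LINT x:E|lebesgue. divergence T x) \<le> perimeter K U + ereal e"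
        using le by (metis ereal_less_eq(3) order_trans plus_ereal.simps(1))
    qed
  qed
qed

end


section \<open>Mollification\<close>

text \<open>The functions \<open>t\<^sup>-\<^sup>n exp (-1/t)\<close> on the positive axis, extended by 0. The family is closed under
  differentiation up to linear combinations, which proves smoothness at 0.\<close>

definition flat :: "nat \<Rightarrow> real \<Rightarrow> real" where
  "flat n t = (if t \<le> 0 then 0 else inverse t ^ n * exp (- inverse t))"

lemma flat_tendsto: "(flat n \<longlongrightarrow> 0) (at_right 0)"
proof -
  have "((\<lambda>t. inverse t ^ n / exp (inverse t)) \<longlongrightarrow> (0::real)) (at_right 0)"
    by (rule filterlim_compose[OF tendsto_power_div_exp_0 filterlim_inverse_at_top_right])
  moreover have "\<forall>\<^sub>F t in at_right 0. flat n t = inverse t ^ n / exp (inverse t)"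
    using eventually_at_right_less[of "0::real"]
    by eventually_elim (simp add: flat_def exp_minus divide_inverse)
  ultimately show ?thesis by (simp add: tendsto_cong)
qed

lemma flat_derivative: "(flat n has_real_derivative flat (n + 2) t - real n * flat (n + 1) t) (at t)"
proof -
  consider "t < 0" | "t = 0" | "t > 0" by linarith
  then show ?thesis
  proof cases
    case 1
    have "((\<lambda>_. 0::real) has_real_derivative flat (n + 2) t - real n * flat (n + 1) t) (at t)"
      using 1 by (simp add: flat_def)
    then show ?thesis
      by (rule has_field_derivative_transform_within_open[where S = "{..<0}"])
        (use 1 in \<open>auto simp: flat_def\<close>)
  next
    case 2
    have "((\<lambda>s. (flat n (0 + s) - flat n 0) / s) \<longlongrightarrow> 0) (at_left 0)"
    proof (rule tendsto_eventually)
      show "\<forall>\<^sub>F s in at_left 0. (flat n (0 + s) - flat n 0) / s = 0"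
        using eventually_at_left_real[of "-1" 0] by (simp add: flat_def eventually_at_filter)
    qed
    moreover have "((\<lambda>s. (flat n (0 + s) - flat n 0) / s) \<longlongrightarrow> 0) (at_right 0)"
    proof -
      have "\<forall>\<^sub>F s in at_right 0. (flat n (0 + s) - flat n 0) / s = flat (Suc n) s"
        using eventually_at_right_less[of "0::real"]
        by eventually_elim (simp add: flat_def divide_inverse)
      then show ?thesis using flat_tendsto[of "Suc n"] by (simp add: tendsto_cong)
    qed
    ultimately have "((\<lambda>s. (flat n (0 + s) - flat n 0) / s) \<longlongrightarrow> 0) (at 0)"
      by (rule filterlim_split_at)
    then show ?thesis using 2 by (simp add: has_field_derivative_iff flat_def)
  next
    case 3
    have inv: "(inverse has_real_derivative - (inverse t * inverse t)) (at t)"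
      using 3 by (auto intro!: derivative_eq_intros)
    have "((\<lambda>t. inverse t ^ n) has_real_derivative - (real n * inverse t ^ (n + 1))) (at t)"
      by (rule DERIV_cong[OF DERIV_power[OF inv]]) (cases n; simp)
    moreover have "((\<lambda>t. exp (- inverse t)) has_real_derivative exp (- inverse t) * (inverse t * inverse t)) (at t)"
      by (rule DERIV_cong[OF DERIV_chain2[OF DERIV_exp DERIV_minus[OF inv]]]) simp
    ultimately have "((\<lambda>t. inverse t ^ n * exp (- inverse t)) has_real_derivative
        flat (n + 2) t - real n * flat (n + 1) t) (at t)"
      by (rule DERIV_cong[OF DERIV_mult]) (use 3 in \<open>simp add: flat_def algebra_simps\<close>)
    then show ?thesis
      by (rule has_field_derivative_transform_within_open[where S = "{0<..}"])
        (use 3 in \<open>auto simp: flat_def\<close>)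
  qed
qed

lemma flat_C_k: "C_k k (flat n)"
proof (induction k arbitrary: n)
  case 0
  show ?case
    using flat_derivative by (auto intro!: continuous_at_imp_continuous_on DERIV_isCont)
next
  case (Suc k)
  show ?case
  proof (rule C_k_SucI)
    show "(flat n has_derivative (\<lambda>h. (flat (n + 2) t - real n * flat (n + 1) t) * h)) (at t)" for t
      using flat_derivative by (simp add: has_field_derivative_def)
    show "C_k k (\<lambda>t. (flat (n + 2) t - real n * flat (n + 1) t) * v)" for v
      by (intro C_k_mult C_k_diff C_k_const Suc)
  qed
qed

text \<open>Evenness makes convolution with \<open>\<rho>\<close> a symmetric operator.\<close>

definition mollifier :: "real \<Rightarrow> (real^'n \<Rightarrow> real) \<Rightarrow> bool" where
  "mollifier e \<rho> \<longleftrightarrow> C_infinity \<rho> \<and> (\<forall>x. 0 \<le> \<rho> x) \<and> vanishes_beyond e \<rho> \<and> (\<forall>x. \<rho> (- x) = \<rho> x) \<and>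
     (\<integral>x. \<rho> x \<partial>lborel) = 1"

lemma integrable_lborel_continuous_vanishing:
  fixes f :: "'a::euclidean_space \<Rightarrow> real"
  assumes "continuous_on UNIV f" "vanishes_beyond R f"
  shows "integrable lborel f"
  using integrable_continuous_vanishing[OF assms] borel_measurable_continuous_onI[OF assms(1)]
  by (simp add: integrable_completion)

lemma mollifier_exists:
  assumes e: "e > 0"
  obtains \<rho> :: "real^'n \<Rightarrow> real" where "mollifier e \<rho>"
proof -
  define b where "b x = flat 0 (e\<^sup>2 - x \<bullet> x)" for x :: "real^'n"
  have b_C: "C_k k b" for k
    unfolding b_def
    by (intro C_k_compose[OF flat_C_k] C_k_diff C_k_const C_k_inner C_k_bounded_linear[OF bounded_linear_ident])
  have b0: "b x \<ge> 0" for x by (simp add: b_def flat_def)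
  have b_e: "vanishes_beyond e b"
    unfolding vanishes_beyond_def
  proof (intro allI impI)
    fix x :: "real^'n" assume "norm x > e"
    then have "e\<^sup>2 \<le> (norm x)\<^sup>2" using e by (intro power_mono) auto
    then show "b x = 0" by (simp add: b_def flat_def power2_norm_eq_inner)
  qed
  have int: "integrable lborel b" by (rule integrable_lborel_continuous_vanishing[OF C_k_0D[OF b_C] b_e])
  define m where "m = exp (- inverse (3 / 4 * e\<^sup>2))"
  have lower: "m * indicator (cball 0 (e / 2)) x \<le> b x" for x :: "real^'n"
  proof (cases "norm x \<le> e / 2")
    case True
    then have "(norm x)\<^sup>2 \<le> (e / 2)\<^sup>2" by (intro power_mono) auto
    then have *: "3 / 4 * e\<^sup>2 \<le> e\<^sup>2 - x \<bullet> x" by (simp add: power2_norm_eq_inner power_divide)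
    then have "inverse (e\<^sup>2 - x \<bullet> x) \<le> inverse (3 / 4 * e\<^sup>2)" using e by (intro le_imp_inverse_le) auto
    moreover have "e\<^sup>2 - x \<bullet> x > 0" 
    proof -
      have "3 / 4 * e\<^sup>2 > 0" using e by simp
      then show ?thesis using * by linarith
    qed
    ultimately show ?thesis using True by (simp add: b_def flat_def m_def)
  qed (simp add: b0)
  have "0 < m * measure lborel (cball (0::real^'n) (e / 2))" using e by (simp add: m_def)
  also have "\<dots> = (\<integral>x. m * indicator (cball (0::real^'n) (e / 2)) x \<partial>lborel)" by simp
  also have "\<dots> \<le> (\<integral>x. b x \<partial>lborel)"
  proof (rule integral_mono[OF _ int lower])
    show "integrable lborel (\<lambda>x. m * indicator (cball (0::real^'n) (e / 2)) x)"
      by (rule integrable_lborel_cball_indicator)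
  qed
  finally have I: "(\<integral>x. b x \<partial>lborel) > 0" .
  have "mollifier e (\<lambda>x. (1 / (\<integral>x. b x \<partial>lborel)) * b x)"
    unfolding mollifier_def C_infinity_def
  proof (intro conjI allI)
    show "C_k k (\<lambda>x. (1 / (\<integral>x. b x \<partial>lborel)) * b x)" for k by (intro C_k_mult C_k_const b_C)
    show "0 \<le> (1 / (\<integral>x. b x \<partial>lborel)) * b x" for x using I b0[of x] by simp
    show "vanishes_beyond e (\<lambda>x. (1 / (\<integral>x. b x \<partial>lborel)) * b x)" using b_e by (simp add: vanishes_beyond_def)
    show "(1 / (\<integral>x. b x \<partial>lborel)) * b (- x) = (1 / (\<integral>x. b x \<partial>lborel)) * b x" for x by (simp add: b_def)
    show "(\<integral>x. (1 / (\<integral>x. b x \<partial>lborel)) * b x \<partial>lborel) = 1" using I by simp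
  qed
  then show thesis by (rule that)
qed

definition conv :: "(real^'n \<Rightarrow> real) \<Rightarrow> (real^'n \<Rightarrow> real) \<Rightarrow> real^'n \<Rightarrow> real" where
  "conv \<rho> f x = (\<integral>y. f y * \<rho> (x - y) \<partial>lborel)"

lemma integrable_mult_bounded_continuous:
  fixes f g :: "'a::euclidean_space \<Rightarrow> real"
  assumes f: "integrable lborel f" and g: "continuous_on UNIV g" "\<And>x. \<bar>g x\<bar> \<le> B"
  shows "integrable lborel (\<lambda>x. f x * g x)"
proof (rule Bochner_Integration.integrable_bound)
  show "integrable lborel (\<lambda>x. B * f x)" using f by simp
  have "g \<in> borel_measurable borel" by (rule borel_measurable_continuous_onI[OF g(1)])
  then show "(\<lambda>x. f x * g x) \<in> borel_measurable lborel"
    using borel_measurable_integrable[OF f] by simp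
  show "AE x in lborel. norm (f x * g x) \<le> norm (B * f x)"
  proof (rule AE_I2)
    fix x
    have "\<bar>f x\<bar> * \<bar>g x\<bar> \<le> \<bar>f x\<bar> * \<bar>B\<bar>" using g(2)[of x] by (intro mult_left_mono) auto
    then show "norm (f x * g x) \<le> norm (B * f x)" by (simp add: abs_mult mult.commute)
  qed
qed

lemma integrable_conv_kernel:
  fixes f \<rho> :: "'a::euclidean_space \<Rightarrow> real"
  assumes f: "integrable lborel f" and \<rho>: "continuous_on UNIV \<rho>" "vanishes_beyond R \<rho>"
  shows "integrable lborel (\<lambda>y. f y * \<rho> (x - y))"
proof -
  obtain B where B: "\<And>z. norm (\<rho> z) \<le> B" using continuous_vanishing_bounded[OF \<rho>] by blast
  show ?thesis
  proof (rule integrable_mult_bounded_continuous[OF f, of "\<lambda>y. \<rho> (x - y)" B])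
    show "continuous_on UNIV (\<lambda>y. \<rho> (x - y))"
      by (rule continuous_on_compose2[OF \<rho>(1)]) (auto intro: continuous_intros)
    show "\<bar>\<rho> (x - y)\<bar> \<le> B" for y using B[of "x - y"] by simp
  qed
qed

lemma continuous_vanishing_uniformly:
  fixes f :: "real^'n \<Rightarrow> 'b::real_normed_vector"
  assumes f: "continuous_on UNIV f" "vanishes_beyond R f" and e: "e > 0"
  obtains \<delta> where "\<delta> > 0" "\<And>x y. dist x y < \<delta> \<Longrightarrow> dist (f x) (f y) < e"
proof -
  have "uniformly_continuous_on (cball 0 (R + 1)) f"
    by (rule compact_uniformly_continuous) (auto intro: continuous_on_subset[OF f(1)])
  then obtain d where d: "d > 0"
    "\<And>x y. x \<in> cball 0 (R + 1) \<Longrightarrow> y \<in> cball 0 (R + 1) \<Longrightarrow> dist y x < d \<Longrightarrow> dist (f y) (f x) < e"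
    using e unfolding uniformly_continuous_on_def by metis
  show thesis
  proof (rule that[of "min d 1"])
    fix x y :: "real^'n" assume xy: "dist x y < min d 1"
    show "dist (f x) (f y) < e"
    proof (cases "norm x \<le> R \<or> norm y \<le> R")
      case True
      have "norm x \<le> norm y + dist x y" "norm y \<le> norm x + dist x y"
        using norm_triangle_ineq2[of x y] norm_triangle_ineq2[of y x] by (simp_all add: dist_norm norm_minus_commute)
      then have "x \<in> cball 0 (R + 1)" "y \<in> cball 0 (R + 1)" using True xy by auto
      then show ?thesis using d(2)[of y x] xy by simp
    next
      case False
      then show ?thesis using f(2) e by (simp add: vanishes_beyond_def)
    qed
  qed (use d in simp)
qed

lemma integral_mult_bound:
  fixes f g :: "'a::euclidean_space \<Rightarrow> real"
  assumes f: "integrable lborel f" and g: "continuous_on UNIV g" "\<And>y. \<bar>g y\<bar> \<le> e"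
  shows "\<bar>\<integral>y. f y * g y \<partial>lborel\<bar> \<le> (\<integral>y. \<bar>f y\<bar> \<partial>lborel) * e"
proof -
  have "\<bar>\<integral>y. f y * g y \<partial>lborel\<bar> \<le> (\<integral>y. \<bar>f y * g y\<bar> \<partial>lborel)" 
    using integral_norm_bound[of lborel "\<lambda>y. f y * g y"] by simp
  also have "\<dots> \<le> (\<integral>y. \<bar>f y\<bar> * e \<partial>lborel)"
  proof (rule integral_mono)
    show "integrable lborel (\<lambda>y. \<bar>f y * g y\<bar>)"
      using integrable_mult_bounded_continuous[OF f g] by simp
    show "\<bar>f y * g y\<bar> \<le> \<bar>f y\<bar> * e" for y
      using g(2)[of y] by (simp add: abs_mult mult_left_mono)
  qed (use f in simp)
  finally show ?thesis using f by simp
qed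

lemma conv_continuous:
  assumes f: "integrable lborel f" and \<rho>: "continuous_on UNIV \<rho>" "vanishes_beyond R \<rho>"
  shows "continuous_on UNIV (conv \<rho> f)"
  unfolding continuous_on_iff
proof (intro ballI allI impI)
  fix x and e :: real assume e: "e > 0"
  define A where "A = (\<integral>y. \<bar>f y\<bar> \<partial>lborel)"
  have A: "A \<ge> 0" by (simp add: A_def)
  have "e / (A + 1) > 0" using e A by simp
  then obtain \<delta> where \<delta>: "\<delta> > 0" "\<And>x y. dist x y < \<delta> \<Longrightarrow> dist (\<rho> x) (\<rho> y) < e / (A + 1)"
    using continuous_vanishing_uniformly[OF \<rho>] by blast
  have cont: "continuous_on UNIV (\<lambda>y. \<rho> (z - y))" for z
    by (rule continuous_on_compose2[OF \<rho>(1)]) (auto intro: continuous_intros)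
  have "dist (conv \<rho> f x') (conv \<rho> f x) < e" if "dist x' x < \<delta>" for x'
  proof -
    have "conv \<rho> f x' - conv \<rho> f x = (\<integral>y. f y * (\<rho> (x' - y) - \<rho> (x - y)) \<partial>lborel)"
      unfolding conv_def right_diff_distrib
      using integrable_conv_kernel[OF f \<rho>] by simp
    also have "\<bar>\<dots>\<bar> \<le> A * (e / (A + 1))"
      unfolding A_def
    proof (rule integral_mult_bound[OF f])
      show "continuous_on UNIV (\<lambda>y. \<rho> (x' - y) - \<rho> (x - y))" by (intro continuous_intros cont)
      show "\<bar>\<rho> (x' - y) - \<rho> (x - y)\<bar> \<le> e / ((\<integral>y. \<bar>f y\<bar> \<partial>lborel) + 1)" for y
        using \<delta>(2)[of "x' - y" "x - y"] that by (simp add: dist_norm A_def)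
    qed
    also have "\<dots> < e" using e A by (simp add: field_simps)
    finally show ?thesis by (simp add: dist_norm)
  qed
  then show "\<exists>d>0. \<forall>x'\<in>UNIV. dist x' x < d \<longrightarrow> dist (conv \<rho> f x') (conv \<rho> f x) < e"
    using \<delta>(1) by blast
qed

text \<open>The linearisation error of the kernel is uniform, because its gradient is uniformly continuous.\<close>

lemma conv_has_derivative:
  assumes f: "integrable lborel f" and \<rho>: "C_k 1 \<rho>" "vanishes_beyond R \<rho>"
  shows "(conv \<rho> f has_derivative (\<lambda>h. conv (\<lambda>z. frechet_derivative \<rho> (at z) h) f x)) (at x)"
proof -
  have fr: "frechet_derivative \<rho> (at z) h = grad \<rho> z \<bullet> h" for z h
    by (rule frechet_derivative_grad[OF C_1_differentiable[OF \<rho>(1)]])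
  have gc: "continuous_on UNIV (grad \<rho>)" by (rule continuous_grad[OF \<rho>(1)])
  have gv: "vanishes_beyond R (grad \<rho>)" by (rule vanishes_beyond_grad[OF \<rho>(2)])
  have hc: "continuous_on UNIV (\<lambda>z. grad \<rho> z \<bullet> h)" for h by (intro continuous_intros gc)
  have hv: "vanishes_beyond R (\<lambda>z. grad \<rho> z \<bullet> h)" for h using gv by (simp add: vanishes_beyond_def)
  have cont: "continuous_on UNIV (\<lambda>y. g (z - y))" if "continuous_on UNIV g" for g :: "real^'n \<Rightarrow> real" and z
    by (rule continuous_on_compose2[OF that]) (auto intro: continuous_intros)
  note int = integrable_conv_kernel[OF f]
  obtain B where B: "\<And>z. norm (grad \<rho> z) \<le> B" using continuous_vanishing_bounded[OF gc gv] by blast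
  define A where "A = (\<integral>y. \<bar>f y\<bar> \<partial>lborel)"
  have A: "A \<ge> 0" by (simp add: A_def)
  define D where "D h = conv (\<lambda>z. grad \<rho> z \<bullet> h) f x" for h
  have "bounded_linear D"
  proof (rule bounded_linear_intro)
    show "D (h + k) = D h + D k" for h k
      unfolding D_def conv_def inner_add_right distrib_left using int[OF hc hv] by simp
    show "D (r *\<^sub>R h) = r *\<^sub>R D h" for r h
      unfolding D_def conv_def inner_scaleR_right by (simp add: mult.left_commute)
    show "norm (D h) \<le> norm h * (A * B)" for h
    proof -
      have "\<bar>D h\<bar> \<le> A * (B * norm h)"
        unfolding D_def conv_def A_def
      proof (rule integral_mult_bound[OF f cont[OF hc]])
        show "\<bar>grad \<rho> (x - y) \<bullet> h\<bar> \<le> B * norm h" for y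
          using Cauchy_Schwarz_ineq2[of "grad \<rho> (x - y)" h] B[of "x - y"]
          by (meson mult_right_mono norm_ge_zero order_trans)
      qed
      then show ?thesis by (simp add: algebra_simps)
    qed
  qed
  moreover have "\<exists>d>0. \<forall>x'. norm (x' - x) < d \<longrightarrow>
      norm (conv \<rho> f x' - conv \<rho> f x - D (x' - x)) \<le> e * norm (x' - x)" if e: "e > 0" for e
  proof -
    define e' where "e' = e / (A + 1)"
    have e': "e' > 0" "A * e' \<le> e" using e A by (simp_all add: e'_def field_simps)
    obtain \<delta> where \<delta>: "\<delta> > 0" "\<And>x y. dist x y < \<delta> \<Longrightarrow> dist (grad \<rho> x) (grad \<rho> y) < e'"
      using continuous_vanishing_uniformly[OF gc gv e'(1)] by blast
    have "norm (conv \<rho> f x' - conv \<rho> f x - D (x' - x)) \<le> e * norm (x' - x)" if x': "norm (x' - x) < \<delta>" for x'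
    proof -
      have "conv \<rho> f x' - conv \<rho> f x - D (x' - x)
        = (\<integral>y. f y * (\<rho> (x' - y) - \<rho> (x - y) - grad \<rho> (x - y) \<bullet> (x' - x)) \<partial>lborel)"
        unfolding conv_def D_def right_diff_distrib
        using int[OF C_k_0D[OF \<rho>(1)] \<rho>(2)] int[OF hc hv] by simp
      also have "\<bar>\<dots>\<bar> \<le> A * (e' * norm (x' - x))"
        unfolding A_def
      proof (rule integral_mult_bound[OF f])
        show "continuous_on UNIV (\<lambda>y. \<rho> (x' - y) - \<rho> (x - y) - grad \<rho> (x - y) \<bullet> (x' - x))"
          by (intro continuous_intros cont[OF hc] cont[OF C_k_0D[OF \<rho>(1)]])
        fix y
        have "\<bar>\<rho> (x' - y) - \<rho> (x - y) - grad \<rho> (x - y) \<bullet> ((x' - y) - (x - y))\<bar> \<le> e' * norm ((x' - y) - (x - y))"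
        proof (rule C1_linearization_bound[OF \<rho>(1)])
          show "norm (grad \<rho> z - grad \<rho> (x - y)) \<le> e'" if "z \<in> ball (x - y) \<delta>" for z
            using \<delta>(2)[of z "x - y"] that by (simp add: dist_commute) (simp add: dist_norm norm_minus_commute)
          show "x' - y \<in> ball (x - y) \<delta>" using x' by (simp add: dist_norm norm_minus_commute)
          show "x - y \<in> ball (x - y) \<delta>" using \<delta>(1) by simp
        qed
        then show "\<bar>\<rho> (x' - y) - \<rho> (x - y) - grad \<rho> (x - y) \<bullet> (x' - x)\<bar> \<le> e' * norm (x' - x)" by simp
      qed
      also have "\<dots> \<le> e * norm (x' - x)" using e'(2) by (simp add: mult_right_mono flip: mult.assoc)
      finally show ?thesis by simp
    qed
    then show ?thesis using \<delta>(1) by blast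
  qed
  ultimately show ?thesis
    unfolding fr D_def[symmetric] has_derivative_at_alt by blast
qed

lemma conv_C_k:
  assumes f: "integrable lborel f"
  shows "C_k k \<rho> \<Longrightarrow> vanishes_beyond R \<rho> \<Longrightarrow> C_k k (conv \<rho> f)"
proof (induction k arbitrary: \<rho>)
  case 0
  then show ?case using conv_continuous[OF f] by simp
next
  case (Suc k)
  have "C_k 1 \<rho>" using Suc.prems(1) C_k_0D by auto
  show ?case
  proof (rule C_k_SucI[OF conv_has_derivative[OF f \<open>C_k 1 \<rho>\<close> Suc.prems(2)]])
    show "C_k k (conv (\<lambda>z. frechet_derivative \<rho> (at z) v) f)" for v
      by (rule Suc.IH[OF _ vanishes_beyond_derivative[OF Suc.prems(2)]]) (use Suc.prems(1) in simp)
  qed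
qed

lemma integral_reflect_lborel:
  fixes g :: "'a::euclidean_space \<Rightarrow> real"
  assumes "g \<in> borel_measurable borel"
  shows "(\<integral>y. g (x - y) \<partial>lborel) = (\<integral>y. g y \<partial>lborel)"
proof -
  have "lborel = density (distr lborel borel (\<lambda>y. x + (-1) *\<^sub>R y)) (\<lambda>_. ennreal (\<bar>-1 :: real\<bar> ^ DIM('a)))"
    by (rule lborel_affine) simp
  then have "(\<integral>y. g y \<partial>lborel) = (\<integral>y. g y \<partial>(density (distr lborel borel (\<lambda>y. x + (-1) *\<^sub>R y)) (\<lambda>_. ennreal (\<bar>-1 :: real\<bar> ^ DIM('a)))))"
    by (rule arg_cong)
  also have "\<dots> = (\<integral>y. g y \<partial>(distr lborel borel (\<lambda>y. x + (-1) *\<^sub>R y)))"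
    by (simp add: density_1)
  also have "\<dots> = (\<integral>y. g (x + (-1) *\<^sub>R y) \<partial>lborel)"
    using assms by (subst integral_distr) auto
  finally show ?thesis by simp
qed

lemma conv_commute:
  assumes "\<rho> \<in> borel_measurable borel" "f \<in> borel_measurable borel"
  shows "conv \<rho> f = conv f \<rho>"
proof
  fix x
  have "(\<lambda>y. f y * \<rho> (x - y)) \<in> borel_measurable borel" using assms by measurable
  from integral_reflect_lborel[OF this, of x] show "conv \<rho> f x = conv f \<rho> x"
    by (simp add: conv_def mult.commute)
qed

lemma vanishes_beyond_conv:
  fixes f \<rho> :: "real^'n \<Rightarrow> real"
  assumes "vanishes_beyond r \<rho>" "vanishes_beyond R f"
  shows "vanishes_beyond (R + r) (conv \<rho> f)"
  unfolding vanishes_beyond_def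
proof (intro allI impI)
  fix x :: "real^'n" assume x: "norm x > R + r"
  have "f y * \<rho> (x - y) = 0" for y :: "real^'n"
  proof (cases "norm y > R")
    case False
    then have "norm (x - y) > r" using x norm_triangle_ineq2[of x y] by simp
    then show ?thesis using assms(1) by (simp add: vanishes_beyond_def)
  qed (use assms(2) in \<open>simp add: vanishes_beyond_def\<close>)
  then have "(\<lambda>y. f y * \<rho> (x - y)) = (\<lambda>_. 0)" by blast
  then show "conv \<rho> f x = 0" by (simp add: conv_def)
qed


lemma mollifierD:
  assumes "mollifier e \<rho>"
  shows "C_k k \<rho>" "0 \<le> \<rho> x" "vanishes_beyond e \<rho>" "\<rho> (- x) = \<rho> x" "(\<integral>x. \<rho> x \<partial>lborel) = 1"
  using assms by (auto simp: mollifier_def C_infinity_def)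

lemma mollifier_integral:
  assumes "mollifier e \<rho>"
  shows "(\<integral>y. \<rho> (x - y) \<partial>lborel) = 1"
  using integral_reflect_lborel[of \<rho> x] mollifierD[OF assms] C_k_0D[OF mollifierD(1)[OF assms]]
  by (simp add: borel_measurable_continuous_onI)

lemma mollifier_integrable:
  assumes "mollifier e \<rho>"
  shows "integrable lborel (\<lambda>y. \<rho> (x - y))"
proof (rule integrable_lborel_continuous_vanishing)
  show "continuous_on UNIV (\<lambda>y. \<rho> (x - y))"
    by (rule continuous_on_compose2[OF C_k_0D[OF mollifierD(1)[OF assms]]]) (auto intro: continuous_intros)
  show "vanishes_beyond (norm x + e) (\<lambda>y. \<rho> (x - y))"
    unfolding vanishes_beyond_def
  proof (intro allI impI)
    fix y :: "real^'a" assume "norm y > norm x + e"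
    then have "norm (x - y) > e" using norm_triangle_ineq2[of y x] by (simp add: norm_minus_commute)
    then show "\<rho> (x - y) = 0" using mollifierD(3)[OF assms] by (simp add: vanishes_beyond_def)
  qed
qed

lemma conv_kernel_integrable_pair:
  fixes f w \<rho> :: "real^'n \<Rightarrow> real"
  assumes f: "integrable lborel f" and w: "integrable lborel w"
    and \<rho>: "continuous_on UNIV \<rho>" "vanishes_beyond R \<rho>"
  shows "integrable (lborel \<Otimes>\<^sub>M lborel) (\<lambda>(x, y). f y * \<rho> (x - y) * w x)"
proof -
  obtain B where B: "B \<ge> 0" "\<And>z. norm (\<rho> z) \<le> B" using continuous_vanishing_bounded[OF \<rho>] by blast
  have [measurable]: "f \<in> borel_measurable borel" "w \<in> borel_measurable borel" "\<rho> \<in> borel_measurable borel"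
    using borel_measurable_integrable[OF f] borel_measurable_integrable[OF w]
      borel_measurable_continuous_onI[OF \<rho>(1)] by simp_all
  have prod: "integrable (lborel \<Otimes>\<^sub>M lborel) (\<lambda>(x, y). f y * w x)"
  proof (rule lborel_pair.Fubini_integrable)
    show "(\<lambda>(x, y). f y * w x) \<in> borel_measurable (lborel \<Otimes>\<^sub>M lborel)" by measurable
    have "(\<lambda>x. \<integral>y. norm (case (x, y) of (x, y) \<Rightarrow> f y * w x) \<partial>lborel) = (\<lambda>x. (\<integral>y. \<bar>f y\<bar> \<partial>lborel) * \<bar>w x\<bar>)"
      by (simp add: abs_mult)
    then show "integrable lborel (\<lambda>x. \<integral>y. norm (case (x, y) of (x, y) \<Rightarrow> f y * w x) \<partial>lborel)"
      using w by simp
    show "AE x in lborel. integrable lborel (\<lambda>y. case (x, y) of (x, y) \<Rightarrow> f y * w x)" using f by simp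
  qed
  show ?thesis
  proof (rule Bochner_Integration.integrable_bound)
    show "integrable (lborel \<Otimes>\<^sub>M lborel) (\<lambda>p. B * (case p of (x, y) \<Rightarrow> f y * w x))"
      by (rule integrable_mult_right[OF prod])
    show "(\<lambda>(x, y). f y * \<rho> (x - y) * w x) \<in> borel_measurable (lborel \<Otimes>\<^sub>M lborel)" by measurable
    show "AE p in lborel \<Otimes>\<^sub>M lborel. norm (case p of (x, y) \<Rightarrow> f y * \<rho> (x - y) * w x)
      \<le> norm (B * (case p of (x, y) \<Rightarrow> f y * w x))"
    proof (rule AE_I2, clarify)
      fix x y
      have "\<bar>\<rho> (x - y)\<bar> * (\<bar>f y\<bar> * \<bar>w x\<bar>) \<le> B * (\<bar>f y\<bar> * \<bar>w x\<bar>)"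
        using B(2)[of "x - y"] by (intro mult_right_mono) auto
      then show "norm (f y * \<rho> (x - y) * w x) \<le> norm (B * (f y * w x))"
        using B(1) by (simp add: abs_mult mult_ac)
    qed
  qed
qed

lemma conv_adjoint:
  fixes f w :: "real^'n \<Rightarrow> real"
  assumes f: "integrable lborel f" and w: "integrable lborel w" and \<rho>: "mollifier e \<rho>"
  shows "(\<integral>x. conv \<rho> f x * w x \<partial>lborel) = (\<integral>y. f y * conv \<rho> w y \<partial>lborel)"
proof -
  have "(\<integral>x. conv \<rho> f x * w x \<partial>lborel) = (\<integral>x. \<integral>y. f y * \<rho> (x - y) * w x \<partial>lborel \<partial>lborel)"
    by (simp add: conv_def)
  also have "\<dots> = (\<integral>y. \<integral>x. f y * \<rho> (x - y) * w x \<partial>lborel \<partial>lborel)"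
    using lborel_pair.Fubini_integral[OF conv_kernel_integrable_pair[OF f w C_k_0D[OF mollifierD(1)[OF \<rho>]] mollifierD(3)[OF \<rho>]]]
    by simp
  also have "\<dots> = (\<integral>y. f y * conv \<rho> w y \<partial>lborel)"
  proof -
    have sym: "\<rho> (x - y) = \<rho> (y - x)" for x y using mollifierD(4)[OF \<rho>, of "x - y"] by simp
    have "(\<integral>x. f y * \<rho> (x - y) * w x \<partial>lborel) = f y * conv \<rho> w y" for y
      unfolding conv_def sym[of _ y] by (simp add: mult_ac flip: integral_mult_right_zero)
    then show ?thesis by simp
  qed
  finally show ?thesis .
qed

lemma conv_integrable_and_bound:
  fixes f :: "real^'n \<Rightarrow> real"
  assumes f: "integrable lborel f" and \<rho>: "mollifier e \<rho>"
  shows "integrable lborel (conv \<rho> f)" "(\<integral>x. \<bar>conv \<rho> f x\<bar> \<partial>lborel) \<le> (\<integral>x. \<bar>f x\<bar> \<partial>lborel)"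
proof -
  have \<rho>c: "continuous_on UNIV \<rho>" by (rule C_k_0D[OF mollifierD(1)[OF \<rho>]])
  have [measurable]: "f \<in> borel_measurable borel" "\<rho> \<in> borel_measurable borel"
    using borel_measurable_integrable[OF f] borel_measurable_continuous_onI[OF \<rho>c] by simp_all
  have sym: "\<rho> (x - y) = \<rho> (y - x)" for x y using mollifierD(4)[OF \<rho>, of "x - y"] by simp
  have one: "(\<integral>x. \<rho> (x - y) \<partial>lborel) = 1" for y
    using mollifier_integral[OF \<rho>, of y] by (simp only: sym[of _ y])
  have pair: "integrable (lborel \<Otimes>\<^sub>M lborel) (\<lambda>(y, x). \<bar>f y\<bar> * \<rho> (x - y))"
  proof (rule lborel_pair.Fubini_integrable)
    show "(\<lambda>(y, x). \<bar>f y\<bar> * \<rho> (x - y)) \<in> borel_measurable (lborel \<Otimes>\<^sub>M lborel)" by measurable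
    show "integrable lborel (\<lambda>y. \<integral>x. norm (case (y, x) of (y, x) \<Rightarrow> \<bar>f y\<bar> * \<rho> (x - y)) \<partial>lborel)"
      using f mollifierD(2)[OF \<rho>] by (simp add: abs_mult one)
    show "AE y in lborel. integrable lborel (\<lambda>x. case (y, x) of (y, x) \<Rightarrow> \<bar>f y\<bar> * \<rho> (x - y))"
      using mollifier_integrable[OF \<rho>] by (simp add: sym)
  qed
  have int: "integrable lborel (\<lambda>x. \<integral>y. \<bar>f y\<bar> * \<rho> (x - y) \<partial>lborel)"
    using lborel_pair.integrable_snd[OF pair] by simp
  have le: "\<bar>conv \<rho> f x\<bar> \<le> (\<integral>y. \<bar>f y\<bar> * \<rho> (x - y) \<partial>lborel)" for x
    unfolding conv_def using integral_norm_bound[of lborel "\<lambda>y. f y * \<rho> (x - y)"] mollifierD(2)[OF \<rho>]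
    by (simp add: abs_mult)
  have meas: "conv \<rho> f \<in> borel_measurable lborel"
    using borel_measurable_continuous_onI[OF conv_continuous[OF f \<rho>c mollifierD(3)[OF \<rho>]]] by simp
  show int_conv: "integrable lborel (conv \<rho> f)"
    by (rule Bochner_Integration.integrable_bound[OF int meas])
      (rule AE_I2, use order_trans[OF le abs_ge_self] in simp)
  have "(\<integral>x. \<bar>conv \<rho> f x\<bar> \<partial>lborel) \<le> (\<integral>x. \<integral>y. \<bar>f y\<bar> * \<rho> (x - y) \<partial>lborel \<partial>lborel)"
    using int_conv int le by (intro integral_mono) auto
  also have "\<dots> = (\<integral>y. \<integral>x. \<bar>f y\<bar> * \<rho> (x - y) \<partial>lborel \<partial>lborel)"
    using lborel_pair.Fubini_integral[of "\<lambda>y x. \<bar>f y\<bar> * \<rho> (x - y)"] pair by simp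
  finally show "(\<integral>x. \<bar>conv \<rho> f x\<bar> \<partial>lborel) \<le> (\<integral>x. \<bar>f x\<bar> \<partial>lborel)" by (simp add: one)
qed

text \<open>After clipping, \<open>f\<close> is bounded. A measurable function is almost everywhere a limit of continuous
  functions, and clipping these and multiplying them by a cutoff makes the convergence dominated.\<close>

lemma L1_dense_continuous:
  fixes f :: "real^'n \<Rightarrow> real"
  assumes f: "integrable lborel f" and R: "vanishes_beyond R f" and e: "e > 0"
  obtains g R' where "continuous_on UNIV g" "vanishes_beyond R' g" "(\<integral>x. \<bar>f x - g x\<bar> \<partial>lborel) \<le> e"
proof -
  have [measurable]: "f \<in> borel_measurable borel" using borel_measurable_integrable[OF f] by simp
  define clip where "clip k t = max (- real k) (min (real k) t)" for k :: nat and t :: real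
  have clip_cont: "continuous_on UNIV (clip k)" for k unfolding clip_def by (intro continuous_intros)
  have [measurable]: "clip k \<in> borel_measurable borel" for k
    by (rule borel_measurable_continuous_onI[OF clip_cont])
  have clip_bound: "\<bar>clip k t\<bar> \<le> real k" for k t by (auto simp: clip_def)
  have "(\<lambda>k. \<integral>x. \<bar>f x - clip k (f x)\<bar> \<partial>lborel) \<longlonglongrightarrow> (\<integral>x. 0 \<partial>(lborel :: (real^'n) measure))"
  proof (rule integral_dominated_convergence)
    show "integrable lborel (\<lambda>x. \<bar>f x\<bar>)" using f by simp
    show "AE x in lborel. (\<lambda>k. \<bar>f x - clip k (f x)\<bar>) \<longlonglongrightarrow> 0"
    proof (rule AE_I2, rule tendsto_eventually)
      fix x
      obtain k0 :: nat where "\<bar>f x\<bar> \<le> real k0" using real_arch_simple by blast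
      then have "\<bar>f x - clip k (f x)\<bar> = 0" if "k \<ge> k0" for k
        using that by (auto simp: clip_def)
      then show "\<forall>\<^sub>F k in sequentially. \<bar>f x - clip k (f x)\<bar> = 0" by (auto simp: eventually_sequentially)
    qed
    show "AE x in lborel. norm \<bar>f x - clip k (f x)\<bar> \<le> \<bar>f x\<bar>" for k
      by (rule AE_I2) (auto simp: clip_def)
  qed measurable
  then have "\<forall>\<^sub>F k in sequentially. (\<integral>x. \<bar>f x - clip k (f x)\<bar> \<partial>lborel) < e / 2"
    using e by (intro order_tendstoD(2)) auto
  then obtain k where k: "(\<integral>x. \<bar>f x - clip k (f x)\<bar> \<partial>lborel) < e / 2"
    by (auto simp: eventually_sequentially)
  define h where "h x = clip k (f x)" for x
  have h0: "vanishes_beyond R h" using R by (simp add: h_def clip_def vanishes_beyond_def)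
  have [measurable]: "h \<in> borel_measurable borel" unfolding h_def by measurable
  have "h \<in> borel_measurable lebesgue" by (rule measurable_completion) simp
  then have "h measurable_on UNIV" by (rule lebesgue_measurable_imp_measurable_on_real) simp
  then obtain N g where N: "negligible N" and g: "\<And>n. continuous_on UNIV (g n)"
    and lim: "\<And>x. x \<notin> N \<Longrightarrow> (\<lambda>n. g n x) \<longlonglongrightarrow> h x"
    unfolding measurable_on_def by auto
  obtain \<zeta> :: "real^'n \<Rightarrow> real" and V where \<zeta>: "C_k 1 \<zeta>" "\<And>x. 0 \<le> \<zeta> x" "\<And>x. \<zeta> x \<le> 1"
    "cball 0 R \<subseteq> V" "\<And>x. x \<in> V \<Longrightarrow> \<zeta> x = 1" "compact (closure {x. \<zeta> x \<noteq> 0})"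
    by (rule compact_cutoff[OF compact_cball open_UNIV subset_UNIV, of 0 R]) (rule that)
  obtain R' where R': "vanishes_beyond R' \<zeta>" using compact_support_vanishes_beyond[OF \<zeta>(6)] by blast
  define G where "G n x = \<zeta> x * clip k (g n x)" for n x
  have G_cont: "continuous_on UNIV (G n)" for n
    unfolding G_def by (intro continuous_intros C_k_0D[OF \<zeta>(1)] continuous_on_compose2[OF clip_cont g]) auto
  have G_R': "vanishes_beyond R' (G n)" for n using R' by (simp add: G_def vanishes_beyond_def)
  have [measurable]: "G n \<in> borel_measurable borel" for n by (rule borel_measurable_continuous_onI[OF G_cont])
  have h_eq: "h x = \<zeta> x * clip k (h x)" for x
  proof (cases "norm x \<le> R")
    case True
    then have "\<zeta> x = 1" using \<zeta>(4,5) by auto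
    then show ?thesis by (auto simp: h_def clip_def)
  qed (use h0 in \<open>simp add: vanishes_beyond_def clip_def\<close>)
  have "(\<lambda>n. \<integral>x. \<bar>h x - G n x\<bar> \<partial>lborel) \<longlonglongrightarrow> (\<integral>x. 0 \<partial>(lborel :: (real^'n) measure))"
  proof (rule integral_dominated_convergence)
    show "integrable lborel (\<lambda>x::real^'n. (2 * real k) * indicator (cball 0 R') x)"
      by (rule integrable_lborel_cball_indicator)
    have "AE x in lborel. x \<notin> N"
    proof -
      have "AE x in lebesgue. x \<notin> N"
        using N by (intro AE_not_in) (simp add: negligible_iff_null_sets)
      then show ?thesis by (simp add: AE_completion_iff)
    qed
    then show "AE x in lborel. (\<lambda>n. \<bar>h x - G n x\<bar>) \<longlonglongrightarrow> 0"
    proof eventually_elim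
      case (elim x)
      have "isCont (clip k) (h x)" using clip_cont by (simp add: continuous_on_eq_continuous_at)
      then have "(\<lambda>n. clip k (g n x)) \<longlonglongrightarrow> clip k (h x)"
        using lim[OF elim] by (rule isCont_tendsto_compose)
      then have "(\<lambda>n. \<bar>h x - \<zeta> x * clip k (g n x)\<bar>) \<longlonglongrightarrow> \<bar>h x - \<zeta> x * clip k (h x)\<bar>"
        by (intro tendsto_intros)
      then show ?case using h_eq[of x] by (simp add: G_def)
    qed
    show "AE x in lborel. norm \<bar>h x - G n x\<bar> \<le> (2 * real k) * indicator (cball 0 R') x" for n
    proof (rule AE_I2)
      fix x
      have "h x - G n x = \<zeta> x * (clip k (h x) - clip k (g n x))"
        using h_eq[of x] by (simp add: G_def algebra_simps)
      moreover have "\<bar>clip k (h x) - clip k (g n x)\<bar> \<le> 2 * real k"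
        using clip_bound[of k "h x"] clip_bound[of k "g n x"] by linarith
      ultimately have "\<bar>h x - G n x\<bar> \<le> \<zeta> x * (2 * real k)"
        using \<zeta>(2)[of x] by (simp add: abs_mult mult_left_mono)
      also have "\<dots> \<le> (2 * real k) * indicator (cball 0 R') x"
        using \<zeta>(2,3)[of x] R' by (auto simp: indicator_def vanishes_beyond_def not_le mult_left_le_one_le)
      finally show "norm \<bar>h x - G n x\<bar> \<le> (2 * real k) * indicator (cball 0 R') x" by simp
    qed
  qed measurable
  then have "\<forall>\<^sub>F n in sequentially. (\<integral>x. \<bar>h x - G n x\<bar> \<partial>lborel) < e / 2"
    using e by (intro order_tendstoD(2)) auto
  then obtain n where n: "(\<integral>x. \<bar>h x - G n x\<bar> \<partial>lborel) < e / 2"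
    by (auto simp: eventually_sequentially)
  have int_h: "integrable lborel h"
    by (rule Bochner_Integration.integrable_bound[OF f]) (auto simp: h_def clip_def)
  have int_G: "integrable lborel (G n)" by (rule integrable_lborel_continuous_vanishing[OF G_cont G_R'])
  have "(\<integral>x. \<bar>f x - G n x\<bar> \<partial>lborel) \<le> (\<integral>x. \<bar>f x - h x\<bar> + \<bar>h x - G n x\<bar> \<partial>lborel)"
    using f int_h int_G by (intro integral_mono) auto
  also have "\<dots> = (\<integral>x. \<bar>f x - h x\<bar> \<partial>lborel) + (\<integral>x. \<bar>h x - G n x\<bar> \<partial>lborel)"
    using f int_h int_G by simp
  also have "\<dots> \<le> e" using k n by (simp add: h_def)
  finally show thesis by (rule that[OF G_cont G_R'])
qed

text \<open>For a continuous \<open>g\<close> of compact support the convergence is uniform; since convolution is a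
  contraction in \<open>L\<^sup>1\<close>, it carries over to \<open>f\<close> by density.\<close>

lemma mollification_L1:
  fixes f :: "real^'n \<Rightarrow> real"
  assumes f: "integrable lborel f" and R: "vanishes_beyond R f" and e: "e > 0"
  obtains \<delta> where "\<delta> > 0" "\<And>\<epsilon> \<rho>. \<epsilon> < \<delta> \<Longrightarrow> mollifier \<epsilon> \<rho> \<Longrightarrow> (\<integral>x. \<bar>conv \<rho> f x - f x\<bar> \<partial>lborel) \<le> e"
proof -
  have "e / 3 > 0" using e by simp
  then obtain g R' where g: "continuous_on UNIV g" "vanishes_beyond R' g" and fg: "(\<integral>x. \<bar>f x - g x\<bar> \<partial>lborel) \<le> e / 3"
    using L1_dense_continuous[OF f R] by blast
  have int_g: "integrable lborel g" by (rule integrable_lborel_continuous_vanishing[OF g])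
  define v where "v = measure lborel (cball (0::real^'n) (R' + 1))"
  define s where "s = e / (3 * (v + 1))"
  have v: "v \<ge> 0" by (simp add: v_def)
  have s: "s > 0" "s * v \<le> e / 3" using e v by (simp_all add: s_def field_simps)
  obtain \<delta> where \<delta>: "\<delta> > 0" "\<And>x y. dist x y < \<delta> \<Longrightarrow> dist (g x) (g y) < s"
    using continuous_vanishing_uniformly[OF g s(1)] by blast
  show thesis
  proof (rule that[of "min \<delta> 1"])
    show "min \<delta> 1 > 0" using \<delta>(1) by simp
    fix \<epsilon> \<rho> assume \<epsilon>: "\<epsilon> < min \<delta> 1" and \<rho>: "mollifier \<epsilon> (\<rho> :: real^'n \<Rightarrow> real)"
    have \<rho>c: "continuous_on UNIV \<rho>" by (rule C_k_0D[OF mollifierD(1)[OF \<rho>]])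
    note ker = integrable_conv_kernel[OF _ \<rho>c mollifierD(3)[OF \<rho>]]
    have near: "\<bar>conv \<rho> g x - g x\<bar> \<le> s" for x
    proof -
      have "conv \<rho> g x - g x = (\<integral>y. (g y - g x) * \<rho> (x - y) \<partial>lborel)"
        unfolding conv_def left_diff_distrib
        using ker[OF int_g] mollifier_integrable[OF \<rho>] mollifier_integral[OF \<rho>, of x] by simp
      also have "\<bar>\<dots>\<bar> \<le> (\<integral>y. \<bar>(g y - g x) * \<rho> (x - y)\<bar> \<partial>lborel)"
        using integral_norm_bound[of lborel "\<lambda>y. (g y - g x) * \<rho> (x - y)"] by simp
      also have "\<dots> \<le> (\<integral>y. s * \<rho> (x - y) \<partial>lborel)"
      proof (rule integral_mono)
        show "integrable lborel (\<lambda>y. \<bar>(g y - g x) * \<rho> (x - y)\<bar>)"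
          unfolding left_diff_distrib using ker[OF int_g] mollifier_integrable[OF \<rho>] by simp
        show "integrable lborel (\<lambda>y. s * \<rho> (x - y))" using mollifier_integrable[OF \<rho>] by simp
        fix y
        show "\<bar>(g y - g x) * \<rho> (x - y)\<bar> \<le> s * \<rho> (x - y)"
        proof (cases "\<rho> (x - y) = 0")
          case False
          then have "norm (x - y) \<le> \<epsilon>" using mollifierD(3)[OF \<rho>] by (force simp: vanishes_beyond_def)
          then have "dist (g y) (g x) < s" using \<epsilon> by (intro \<delta>(2)) (simp add: dist_norm norm_minus_commute)
          then show ?thesis using mollifierD(2)[OF \<rho>, of "x - y"]
            by (simp add: abs_mult dist_real_def mult_right_mono)
        qed simp
      qed
      also have "\<dots> = s" using mollifier_integral[OF \<rho>, of x] by simp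
      finally show ?thesis .
    qed
    have int_cg: "integrable lborel (conv \<rho> g)" by (rule conv_integrable_and_bound(1)[OF int_g \<rho>])
    have cg: "(\<integral>x. \<bar>conv \<rho> g x - g x\<bar> \<partial>lborel) \<le> e / 3"
    proof -
      have "(\<integral>x. \<bar>conv \<rho> g x - g x\<bar> \<partial>lborel) \<le> (\<integral>x. s * indicator (cball (0::real^'n) (R' + 1)) x \<partial>lborel)"
      proof (rule integral_mono)
        show "integrable lborel (\<lambda>x. \<bar>conv \<rho> g x - g x\<bar>)" using int_cg int_g by simp
        show "integrable lborel (\<lambda>x::real^'n. s * indicator (cball 0 (R' + 1)) x)"
      by (rule integrable_lborel_cball_indicator)
        fix x
        show "\<bar>conv \<rho> g x - g x\<bar> \<le> s * indicator (cball 0 (R' + 1)) x"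
        proof (cases "norm x \<le> R' + 1")
          case True
          then show ?thesis using near by simp
        next
          case False
          then show ?thesis
            using vanishes_beyond_conv[OF mollifierD(3)[OF \<rho>] g(2)] g(2) \<epsilon> by (simp add: vanishes_beyond_def)
        qed
      qed
      also have "\<dots> = s * v" by (simp add: v_def)
      finally show ?thesis using s(2) by linarith
    qed
    have int_fg: "integrable lborel (\<lambda>x. f x - g x)" using f int_g by simp
    have diff: "conv \<rho> f x - conv \<rho> g x = conv \<rho> (\<lambda>x. f x - g x) x" for x
      unfolding conv_def left_diff_distrib using ker[OF f] ker[OF int_g] by simp
    have "(\<integral>x. \<bar>conv \<rho> f x - f x\<bar> \<partial>lborel)
      \<le> (\<integral>x. \<bar>conv \<rho> (\<lambda>x. f x - g x) x\<bar> + \<bar>conv \<rho> g x - g x\<bar> + \<bar>f x - g x\<bar> \<partial>lborel)"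
    proof (rule integral_mono)
      show "integrable lborel (\<lambda>x. \<bar>conv \<rho> f x - f x\<bar>)"
        using conv_integrable_and_bound(1)[OF f \<rho>] f by simp
      show "integrable lborel (\<lambda>x. \<bar>conv \<rho> (\<lambda>x. f x - g x) x\<bar> + \<bar>conv \<rho> g x - g x\<bar> + \<bar>f x - g x\<bar>)"
        using conv_integrable_and_bound(1)[OF int_fg \<rho>] int_cg int_g int_fg by simp
      fix x
      show "\<bar>conv \<rho> f x - f x\<bar> \<le> \<bar>conv \<rho> (\<lambda>x. f x - g x) x\<bar> + \<bar>conv \<rho> g x - g x\<bar> + \<bar>f x - g x\<bar>"
        using diff[of x] by linarith
    qed
    also have "\<dots> = (\<integral>x. \<bar>conv \<rho> (\<lambda>x. f x - g x) x\<bar> \<partial>lborel) + (\<integral>x. \<bar>conv \<rho> g x - g x\<bar> \<partial>lborel)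
      + (\<integral>x. \<bar>f x - g x\<bar> \<partial>lborel)"
      using conv_integrable_and_bound(1)[OF int_fg \<rho>] int_cg int_g int_fg by simp
    also have "\<dots> \<le> e"
      using conv_integrable_and_bound(2)[OF int_fg \<rho>] cg fg by linarith
    finally show "(\<integral>x. \<bar>conv \<rho> f x - f x\<bar> \<partial>lborel) \<le> e" .
  qed
qed


definition conv_field :: "(real^'n \<Rightarrow> real) \<Rightarrow> (real^'n \<Rightarrow> real^'m) \<Rightarrow> real^'n \<Rightarrow> real^'m" where
  "conv_field \<rho> Y x = (\<chi> i. conv \<rho> (\<lambda>x. Y x $ i) x)"

context
  fixes \<epsilon> R :: real and \<rho> :: "real^'n \<Rightarrow> real" and Y :: "real^'n \<Rightarrow> real^'n"
  assumes \<rho>: "mollifier \<epsilon> \<rho>" and Y: "C_k 1 Y" "vanishes_beyond R Y"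
begin

lemma component_C1: "C_k 1 (\<lambda>x. Y x $ i)"
  using Y(1) C_k_vec by blast

lemma component_vanishes: "vanishes_beyond R (\<lambda>x. Y x $ i)"
  using Y(2) by (simp add: vanishes_beyond_def)

lemma component_integrable: "integrable lborel (\<lambda>x. Y x $ i)"
  by (rule integrable_lborel_continuous_vanishing[OF C_k_0D[OF component_C1] component_vanishes])

lemma conv_field_smooth: "C_infinity (conv_field \<rho> Y)"
  unfolding C_infinity_def C_k_vec
  by (auto simp: conv_field_def intro!: conv_C_k[OF component_integrable mollifierD(1)[OF \<rho>] mollifierD(3)[OF \<rho>]])

text \<open>By commutativity of the convolution the derivative may be moved from the kernel to the field.\<close>

lemma divergence_conv_field: "divergence (conv_field \<rho> Y) x = conv \<rho> (divergence Y) x"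
proof -
  have \<rho>b: "\<rho> \<in> borel_measurable borel"
    by (rule borel_measurable_continuous_onI[OF C_k_0D[OF mollifierD(1)[OF \<rho>]]])
  have \<rho>i: "integrable lborel \<rho>"
    by (rule integrable_lborel_continuous_vanishing[OF C_k_0D[OF mollifierD(1)[OF \<rho>]] mollifierD(3)[OF \<rho>]])
  have dc: "continuous_on UNIV (\<lambda>z. frechet_derivative (\<lambda>x. Y x $ i) (at z) v)" for i v
    by (rule C_1_continuous_derivative[OF component_C1])
  have dv: "vanishes_beyond R (\<lambda>z. frechet_derivative (\<lambda>x. Y x $ i) (at z) v)" for i v
    by (rule vanishes_beyond_derivative[OF component_vanishes])
  have grad: "grad (\<lambda>y. conv_field \<rho> Y y $ i) x $ i = conv \<rho> (\<lambda>z. frechet_derivative (\<lambda>x. Y x $ i) (at z) (axis i 1)) x" for i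
  proof -
    have comm: "conv \<rho> (\<lambda>x. Y x $ i) = conv (\<lambda>x. Y x $ i) \<rho>"
      by (rule conv_commute[OF \<rho>b borel_measurable_continuous_onI[OF C_k_0D[OF component_C1]]])
    have "(conv (\<lambda>x. Y x $ i) \<rho> has_derivative
        (\<lambda>h. conv (\<lambda>z. frechet_derivative (\<lambda>x. Y x $ i) (at z) h) \<rho> x)) (at x)"
      by (rule conv_has_derivative[OF \<rho>i component_C1 component_vanishes])
    then have "grad (conv \<rho> (\<lambda>x. Y x $ i)) x $ i = conv (\<lambda>z. frechet_derivative (\<lambda>x. Y x $ i) (at z) (axis i 1)) \<rho> x"
      unfolding comm grad_nth by (simp add: frechet_derivative_at[symmetric])
    also have "\<dots> = conv \<rho> (\<lambda>z. frechet_derivative (\<lambda>x. Y x $ i) (at z) (axis i 1)) x"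
      using conv_commute[OF \<rho>b borel_measurable_continuous_onI[OF dc]] by metis
    finally show ?thesis by (simp add: conv_field_def)
  qed
  have "divergence (conv_field \<rho> Y) x = (\<Sum>i\<in>UNIV. grad (\<lambda>y. conv_field \<rho> Y y $ i) x $ i)"
    by (rule divergence_components[OF C_1_differentiable[OF C_infinityD[OF conv_field_smooth]]])
  also have "\<dots> = (\<Sum>i\<in>UNIV. conv \<rho> (\<lambda>z. frechet_derivative (\<lambda>x. Y x $ i) (at z) (axis i 1)) x)"
    using grad by simp
  also have "\<dots> = conv \<rho> (\<lambda>z. \<Sum>i\<in>UNIV. frechet_derivative (\<lambda>x. Y x $ i) (at z) (axis i 1)) x"
    unfolding conv_def sum_distrib_right
    using integrable_conv_kernel[OF integrable_lborel_continuous_vanishing[OF dc dv]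
        C_k_0D[OF mollifierD(1)[OF \<rho>]] mollifierD(3)[OF \<rho>]] by simp
  also have "(\<lambda>z. \<Sum>i\<in>UNIV. frechet_derivative (\<lambda>x. Y x $ i) (at z) (axis i 1)) = divergence Y"
    using divergence_components[OF C_1_differentiable[OF Y(1)]] by (simp add: grad_nth fun_eq_iff)
  finally show ?thesis .
qed

lemma norm_conv_field_le:
  assumes "\<And>x. norm (Y x) \<le> 1"
  shows "norm (conv_field \<rho> Y x) \<le> 1"
proof (cases "conv_field \<rho> Y x = 0")
  case False
  define v where "v = (1 / norm (conv_field \<rho> Y x)) *\<^sub>R conv_field \<rho> Y x"
  have v: "norm v = 1" using False by (simp add: v_def)
  note int = integrable_conv_kernel[OF component_integrable C_k_0D[OF mollifierD(1)[OF \<rho>]] mollifierD(3)[OF \<rho>]]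
  have "norm (conv_field \<rho> Y x) = v \<bullet> conv_field \<rho> Y x"
    using False by (simp add: v_def power2_norm_eq_inner[symmetric] power2_eq_square)
  also have "\<dots> = (\<integral>y. (v \<bullet> Y y) * \<rho> (x - y) \<partial>lborel)"
    using int by (simp add: inner_vec_def conv_field_def conv_def sum_distrib_right mult.assoc)
  also have "\<dots> \<le> (\<integral>y. \<rho> (x - y) \<partial>lborel)"
  proof (rule integral_mono)
    show "integrable lborel (\<lambda>y. (v \<bullet> Y y) * \<rho> (x - y))"
      using int by (simp add: inner_vec_def sum_distrib_right mult.assoc)
    show "integrable lborel (\<lambda>y. \<rho> (x - y))" by (rule mollifier_integrable[OF \<rho>])
    fix y
    have "v \<bullet> Y y \<le> 1" using norm_cauchy_schwarz[of v "Y y"] v assms[of y] by simp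
    then show "(v \<bullet> Y y) * \<rho> (x - y) \<le> \<rho> (x - y)"
      using mollifierD(2)[OF \<rho>, of "x - y"] mult_right_mono[of "v \<bullet> Y y" 1] by simp
  qed
  also have "\<dots> = 1" by (rule mollifier_integral[OF \<rho>])
  finally show ?thesis .
qed simp

lemma conv_field_support:
  assumes "conv_field \<rho> Y x \<noteq> 0"
  shows "\<exists>y. Y y \<noteq> 0 \<and> norm (x - y) \<le> \<epsilon>"
proof (rule ccontr)
  assume "\<not> ?thesis"
  then have "Y y = 0 \<or> \<rho> (x - y) = 0" for y
    using mollifierD(3)[OF \<rho>] by (metis not_le vanishes_beyond_def)
  then have "(\<lambda>y. Y y $ i * \<rho> (x - y)) = (\<lambda>_. 0)" for i by (metis mult_eq_0_iff zero_index)
  then have "conv_field \<rho> Y x = 0" by (simp add: conv_field_def conv_def vec_eq_iff)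
  then show False using assms by simp
qed

end

lemma conv_field_test_field:
  fixes Y :: "real^'n \<Rightarrow> real^'n"
  assumes \<rho>: "mollifier \<epsilon> \<rho>" and Y: "C_k 1 Y" "compact K" "\<And>x. Y x \<noteq> 0 \<Longrightarrow> x \<in> K"
    and U: "(\<Union>x\<in>K. cball x \<epsilon>) \<subseteq> U"
  shows "conv_field \<rho> Y \<in> test_fields U"
proof -
  obtain R where R: "\<forall>x\<in>K. norm x \<le> R" using compact_imp_bounded[OF Y(2)] by (auto simp: bounded_iff)
  have YR: "vanishes_beyond R Y" using R Y(3) by (force simp: vanishes_beyond_def)
  let ?S = "\<Union>x\<in>K. \<Union>y\<in>cball 0 \<epsilon>. {x + y}"
  have S: "compact ?S" by (rule compact_sums'[OF Y(2) compact_cball])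
  have sub: "{x. conv_field \<rho> Y x \<noteq> 0} \<subseteq> ?S"
  proof
    fix x assume "x \<in> {x. conv_field \<rho> Y x \<noteq> 0}"
    then obtain y where "Y y \<noteq> 0" "norm (x - y) \<le> \<epsilon>" using conv_field_support[OF \<rho> Y(1) YR] by auto
    then have "y \<in> K" "x - y \<in> cball 0 \<epsilon>" "x = y + (x - y)" using Y(3) by auto
    then show "x \<in> ?S" by blast
  qed
  have "closure {x. conv_field \<rho> Y x \<noteq> 0} \<subseteq> ?S"
    by (rule closure_minimal[OF sub compact_imp_closed[OF S]])
  moreover have "?S \<subseteq> U"
  proof
    fix z assume "z \<in> ?S"
    then obtain x y where "x \<in> K" "norm y \<le> \<epsilon>" "z = x + y" by auto
    then have "z \<in> cball x \<epsilon>" by (simp add: dist_norm)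
    then show "z \<in> U" using U \<open>x \<in> K\<close> by blast
  qed
  moreover have "bounded {x. conv_field \<rho> Y x \<noteq> 0}"
    by (rule bounded_subset[OF compact_imp_bounded[OF S] sub])
  ultimately show ?thesis
    unfolding test_fields_def compact_closure
    using C_infinityD[OF conv_field_smooth[OF \<rho> Y(1) YR]] by blast
qed


section \<open>Truncation does not increase the variation\<close>

text \<open>Truncation to \<open>[0, 1]\<close> is \<open>(1 + \<bar>t\<bar> - \<bar>t - 1\<bar>) / 2\<close>. Replacing \<open>\<bar>t\<bar>\<close> by \<open>sqrt (t\<^sup>2 + d\<^sup>2)\<close> makes it smooth,
  and its derivative stays between 0 and 1 because that of the square root increases from -1 to 1.\<close>

definition soft_abs :: "real \<Rightarrow> real \<Rightarrow> real" where
  "soft_abs d t = sqrt (t\<^sup>2 + d\<^sup>2)"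

definition soft_sgn :: "real \<Rightarrow> real \<Rightarrow> real" where
  "soft_sgn d t = t / soft_abs d t"

definition soft_clamp :: "real \<Rightarrow> real \<Rightarrow> real" where
  "soft_clamp d t = (1 + soft_abs d t - soft_abs d (t - 1)) / 2"

definition soft_clamp' :: "real \<Rightarrow> real \<Rightarrow> real" where
  "soft_clamp' d t = (soft_sgn d t - soft_sgn d (t - 1)) / 2"

context
  fixes d :: real
  assumes d: "d > 0"
begin

lemma soft_abs_pos: "soft_abs d t > 0"
  using d by (simp add: soft_abs_def add_nonneg_pos)

lemma soft_abs_sq: "soft_abs d t * soft_abs d t = t\<^sup>2 + d\<^sup>2"
  by (simp add: soft_abs_def)

lemma soft_abs_bounds: "\<bar>t\<bar> \<le> soft_abs d t" "soft_abs d t \<le> \<bar>t\<bar> + d"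
proof -
  show "\<bar>t\<bar> \<le> soft_abs d t" unfolding soft_abs_def by (rule real_le_rsqrt) simp
  have "t\<^sup>2 + d\<^sup>2 \<le> (\<bar>t\<bar> + d)\<^sup>2" using d by (simp add: power2_sum)
  then show "soft_abs d t \<le> \<bar>t\<bar> + d" unfolding soft_abs_def using d by (intro real_le_lsqrt) auto
qed

lemma soft_abs_derivative: "(soft_abs d has_real_derivative soft_sgn d t) (at t)"
proof -
  have "t\<^sup>2 + d\<^sup>2 > 0" using d by (simp add: add_nonneg_pos)
  then have "((\<lambda>t. sqrt (t\<^sup>2 + d\<^sup>2)) has_real_derivative soft_sgn d t) (at t)"
    by (auto intro!: derivative_eq_intros simp: soft_sgn_def soft_abs_def field_simps)
  then show ?thesis by (simp add: soft_abs_def[abs_def])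
qed

lemma soft_sgn_derivative: "(soft_sgn d has_real_derivative d\<^sup>2 / soft_abs d t ^ 3) (at t)"
proof -
  have "((\<lambda>t. t / soft_abs d t) has_real_derivative
      (1 * soft_abs d t - t * soft_sgn d t) / (soft_abs d t * soft_abs d t)) (at t)"
    using soft_abs_pos[of t] by (intro DERIV_divide DERIV_ident soft_abs_derivative) simp
  moreover have "(1 * soft_abs d t - t * soft_sgn d t) / (soft_abs d t * soft_abs d t) = d\<^sup>2 / soft_abs d t ^ 3"
  proof -
    have "soft_abs d t - t * soft_sgn d t = d\<^sup>2 / soft_abs d t"
      using soft_abs_pos[of t] soft_abs_sq[of t] by (simp add: soft_sgn_def field_simps power2_eq_square)
    then show ?thesis by (simp add: power3_eq_cube)
  qed
  ultimately show ?thesis by (simp add: soft_sgn_def[abs_def])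
qed

lemma soft_abs_continuous: "continuous_on UNIV (soft_abs d)"
  unfolding soft_abs_def by (intro continuous_intros)

lemma soft_sgn_C1: "C_k 1 (soft_sgn d)"
  using soft_abs_pos
  by (intro C_1_real[OF soft_sgn_derivative] continuous_intros soft_abs_continuous)
    (auto simp: less_imp_neq[symmetric])

lemma soft_clamp_derivative: "(soft_clamp d has_real_derivative soft_clamp' d t) (at t)"
proof -
  have "((\<lambda>t. soft_abs d (t - 1)) has_real_derivative soft_sgn d (t - 1) * 1) (at t)"
    by (rule DERIV_chain2[OF soft_abs_derivative]) (auto intro!: derivative_eq_intros)
  then show ?thesis
    unfolding soft_clamp_def[abs_def] soft_clamp'_def
    by (auto intro!: derivative_eq_intros soft_abs_derivative)
qed

lemma soft_clamp'_C1: "C_k 1 (soft_clamp' d)"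
proof -
  have "C_k 1 (\<lambda>t. (1 / 2) * (soft_sgn d t - soft_sgn d (t - 1)))"
    by (intro C_k_mult C_k_const C_k_diff soft_sgn_C1 C_k_compose[OF soft_sgn_C1]
        C_k_bounded_linear[OF bounded_linear_ident])
  then show ?thesis by (simp add: soft_clamp'_def[abs_def])
qed

lemma soft_clamp_C1: "C_k 1 (soft_clamp d)"
  by (rule C_1_real[OF soft_clamp_derivative C_k_0D[OF soft_clamp'_C1]])

lemma soft_clamp'_bounds: "0 \<le> soft_clamp' d t" "soft_clamp' d t \<le> 1"
proof -
  have "soft_sgn d (t - 1) \<le> soft_sgn d t"
  proof (rule DERIV_nonneg_imp_nondecreasing[of "t - 1" t "soft_sgn d"])
    show "\<exists>y. (soft_sgn d has_real_derivative y) (at x) \<and> 0 \<le> y" for x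
      using soft_sgn_derivative soft_abs_pos[of x] by (intro exI[of _ "d\<^sup>2 / soft_abs d x ^ 3"]) auto
  qed simp
  then show "0 \<le> soft_clamp' d t" by (simp add: soft_clamp'_def)
  have "\<bar>soft_sgn d s\<bar> \<le> 1" for s
    using soft_abs_bounds(1)[of s] soft_abs_pos[of s] by (simp add: soft_sgn_def)
  from abs_le_D1[OF this[of t]] abs_le_D2[OF this[of "t - 1"]] show "soft_clamp' d t \<le> 1"
    unfolding soft_clamp'_def by simp
qed

lemma soft_clamp_approx: "\<bar>max 0 (min 1 t) - soft_clamp d t\<bar> \<le> d"
proof -
  have "max 0 (min 1 t) = (1 + \<bar>t\<bar> - \<bar>t - 1\<bar>) / 2" by (auto simp: max_def min_def abs_if)
  then show ?thesis
    using soft_abs_bounds[of t] soft_abs_bounds[of "t - 1"] d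
    unfolding soft_clamp_def by (simp add: abs_if field_simps)
qed

end

lemma integral_lebesgue_continuous:
  fixes f :: "'a::euclidean_space \<Rightarrow> real"
  assumes "continuous_on UNIV f"
  shows "(\<integral>x. f x \<partial>lebesgue) = (\<integral>x. f x \<partial>lborel)"
  using borel_measurable_continuous_onI[OF assms] by (intro integral_completion) simp

text \<open>If the distributional gradient of \<open>f\<close> has mass at most \<open>M\<close>, then so has that of \<open>f\<close> truncated to
  \<open>[0, 1]\<close>. For a \<open>C\<^sup>1\<close> function \<open>g\<close> and a nondecreasing \<open>c\<close> with \<open>c' \<le> 1\<close> the flux of \<open>X\<close> against \<open>c \<circ> g\<close>
  is that of \<open>c'(g) X\<close> against \<open>g\<close>; mollification reduces the general case to this one, and moving the
  mollifier onto the field shows that fields with smooth components suffice.\<close>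

lemma truncation_flux:
  fixes f :: "real^'n \<Rightarrow> real"
  assumes f: "integrable lborel f" "vanishes_beyond R f"
    and U: "open U" and X: "X \<in> test_fields U" "\<And>x. norm (X x) \<le> 1"
    and M: "\<And>S. S \<in> test_fields U \<Longrightarrow> C_infinity S \<Longrightarrow> (\<And>x. norm (S x) \<le> 1) \<Longrightarrow>
      (\<integral>x. f x * divergence S x \<partial>lborel) \<le> M"
  shows "(\<integral>x. max 0 (min 1 (f x)) * divergence X x \<partial>lborel) \<le> M"
proof (rule field_le_epsilon)
  fix e :: real assume e: "e > 0"
  define K where "K = closure {x. X x \<noteq> 0}"
  have K: "compact K" "K \<subseteq> U" and X_C1: "C_k 1 X" using test_fieldsD[OF X(1)] by (simp_all add: K_def)
  have XK: "x \<in> K" if "X x \<noteq> 0" for x using that closure_subset[of "{x. X x \<noteq> 0}"] by (auto simp: K_def)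
  obtain R1 where R1: "vanishes_beyond R1 X"
    using compact_support_vanishes_beyond[OF K(1)[unfolded K_def]] by blast
  have divX: "continuous_on UNIV (divergence X)" by (rule continuous_divergence[OF X_C1])
  obtain B where B: "B \<ge> 0" "\<And>x. norm (divergence X x) \<le> B"
    using continuous_vanishing_bounded[OF divX vanishes_beyond_divergence[OF R1]] by blast
  define v where "v = measure lborel (cball (0::real^'n) R1)"
  have v: "v \<ge> 0" by (simp add: v_def)
  \<comment> \<open>One half of \<open>e\<close> is for smoothing the truncation, the other half for mollifying \<open>f\<close>.\<close>
  define d where "d = e / (2 * (B * v + 1))"
  define e1 where "e1 = e / (2 * (B + 1))"
  have Bv: "B * v + 1 > 0" using B(1) v by (simp add: add_nonneg_pos)
  have d: "d > 0" using e Bv by (simp add: d_def)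
  have e1: "e1 > 0" using e B(1) by (simp add: e1_def)
  have "2 * (B * v + 1) * d = e" using Bv by (simp add: d_def)
  then have d': "B * d * v \<le> e / 2" using d by (simp add: algebra_simps)
  have "2 * (B + 1) * e1 = e" using B(1) by (simp add: e1_def)
  then have e1': "B * e1 \<le> e / 2" using e1 by (simp add: algebra_simps)
  obtain \<delta> where \<delta>: "\<delta> > 0" "\<And>\<epsilon> \<rho>. \<epsilon> < \<delta> \<Longrightarrow> mollifier \<epsilon> \<rho> \<Longrightarrow> (\<integral>x. \<bar>conv \<rho> f x - f x\<bar> \<partial>lborel) \<le> e1"
    using mollification_L1[OF f e1] by blast
  obtain \<epsilon>0 where \<epsilon>0: "\<epsilon>0 > 0" "(\<Union>x\<in>K. cball x \<epsilon>0) \<subseteq> U"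
    by (rule compact_subset_open_imp_cball_epsilon_subset[OF K(1) U K(2)])
  define \<epsilon> where "\<epsilon> = min \<delta> \<epsilon>0 / 2"
  have \<epsilon>: "\<epsilon> > 0" "\<epsilon> < \<delta>" "\<epsilon> \<le> \<epsilon>0" using \<delta>(1) \<epsilon>0(1) by (auto simp: \<epsilon>_def)
  have "cball x \<epsilon> \<subseteq> cball x \<epsilon>0" for x :: "real^'n" using \<epsilon>(3) by (rule subset_cball)
  then have KU: "(\<Union>x\<in>K. cball x \<epsilon>) \<subseteq> U" using \<epsilon>0(2) by blast
  obtain \<rho> :: "real^'n \<Rightarrow> real" where \<rho>: "mollifier \<epsilon> \<rho>" using mollifier_exists[OF \<epsilon>(1)] by blast
  define g where "g = conv \<rho> f"
  have g_C: "C_k 1 g" unfolding g_def by (rule conv_C_k[OF f(1) mollifierD(1)[OF \<rho>] mollifierD(3)[OF \<rho>]])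
  have g_int: "integrable lborel g" unfolding g_def by (rule conv_integrable_and_bound(1)[OF f(1) \<rho>])
  define Y where "Y x = soft_clamp' d (g x) *\<^sub>R X x" for x
  have Y_C1: "C_k 1 Y" unfolding Y_def by (intro C_k_scaleR C_k_compose[OF soft_clamp'_C1[OF d] g_C] X_C1)
  have Y_R1: "vanishes_beyond R1 Y" using R1 by (simp add: Y_def vanishes_beyond_def)
  have Y_1: "norm (Y x) \<le> 1" for x
    using soft_clamp'_bounds[OF d, of "g x"] X(2)[of x] by (simp add: Y_def mult_le_one)
  have cg_C1: "C_k 1 (\<lambda>x. soft_clamp d (g x))" by (rule C_k_compose[OF soft_clamp_C1[OF d] g_C])
  have grad_cg: "grad (\<lambda>x. soft_clamp d (g x)) x \<bullet> X x = grad g x \<bullet> Y x" for x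
    unfolding grad_compose_real[OF soft_clamp_derivative[OF d] C_1_differentiable[OF g_C]] by (simp add: Y_def)
  have divY: "continuous_on UNIV (divergence Y)" by (rule continuous_divergence[OF Y_C1])
  have "(\<integral>x. soft_clamp d (g x) * divergence X x \<partial>lborel) = (\<integral>x. soft_clamp d (g x) * divergence X x \<partial>lebesgue)"
    by (intro integral_lebesgue_continuous[symmetric] continuous_intros C_k_0D[OF cg_C1] divX)
  also have "\<dots> = - (\<integral>x. grad g x \<bullet> Y x \<partial>lebesgue)"
    unfolding integration_by_parts[OF cg_C1 X_C1 R1] grad_cg ..
  also have "\<dots> = (\<integral>x. g x * divergence Y x \<partial>lebesgue)"
    unfolding integration_by_parts[OF g_C Y_C1 Y_R1] ..
  also have "\<dots> = (\<integral>x. g x * divergence Y x \<partial>lborel)"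
    by (intro integral_lebesgue_continuous continuous_intros C_k_0D[OF g_C] divY)
  also have "\<dots> = (\<integral>x. f x * conv \<rho> (divergence Y) x \<partial>lborel)"
    unfolding g_def
    by (rule conv_adjoint[OF f(1) integrable_lborel_continuous_vanishing[OF divY vanishes_beyond_divergence[OF Y_R1]] \<rho>])
  also have "\<dots> = (\<integral>x. f x * divergence (conv_field \<rho> Y) x \<partial>lborel)"
    unfolding divergence_conv_field[OF \<rho> Y_C1 Y_R1] ..
  also have "\<dots> \<le> M"
  proof (rule M)
    show "conv_field \<rho> Y \<in> test_fields U"
      by (rule conv_field_test_field[OF \<rho> Y_C1 K(1) _ KU]) (auto simp: Y_def intro: XK)
    show "C_infinity (conv_field \<rho> Y)" by (rule conv_field_smooth[OF \<rho> Y_C1 Y_R1])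
    show "norm (conv_field \<rho> Y x) \<le> 1" for x by (rule norm_conv_field_le[OF \<rho> Y_C1 Y_R1 Y_1])
  qed
  finally have 1: "(\<integral>x. soft_clamp d (g x) * divergence X x \<partial>lborel) \<le> M" .
  have int1: "integrable lborel (\<lambda>x. max 0 (min 1 (f x)) * divergence X x)"
  proof (rule integrable_mult_bounded_continuous[OF _ divX])
    show "integrable lborel (\<lambda>x. max 0 (min 1 (f x)))"
      using borel_measurable_integrable[OF f(1)]
      by (intro Bochner_Integration.integrable_bound[OF f(1)]) auto
    show "\<bar>divergence X x\<bar> \<le> B" for x using B(2)[of x] by simp
  qed
  have int2: "integrable lborel (\<lambda>x. soft_clamp d (g x) * divergence X x)"
    using vanishes_beyond_divergence[OF R1]
    by (intro integrable_lborel_continuous_vanishing[where R = R1] continuous_intros C_k_0D[OF cg_C1] divX)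
      (simp add: vanishes_beyond_def)
  have ind: "integrable lborel (\<lambda>x::real^'n. (B * d) * indicator (cball 0 R1) x)"
      by (rule integrable_lborel_cball_indicator)
  have "(\<integral>x. max 0 (min 1 (f x)) * divergence X x \<partial>lborel) - (\<integral>x. soft_clamp d (g x) * divergence X x \<partial>lborel)
    = (\<integral>x. max 0 (min 1 (f x)) * divergence X x - soft_clamp d (g x) * divergence X x \<partial>lborel)"
    using int1 int2 by simp
  also have "\<dots> \<le> (\<integral>x. B * \<bar>g x - f x\<bar> + (B * d) * indicator (cball 0 R1) x \<partial>lborel)"
  proof (rule integral_mono)
    show "integrable lborel (\<lambda>x. max 0 (min 1 (f x)) * divergence X x - soft_clamp d (g x) * divergence X x)"
      using int1 int2 by simp
    show "integrable lborel (\<lambda>x. B * \<bar>g x - f x\<bar> + (B * d) * indicator (cball 0 R1) x)"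
      using f(1) g_int ind by simp
    fix x
    show "max 0 (min 1 (f x)) * divergence X x - soft_clamp d (g x) * divergence X x
      \<le> B * \<bar>g x - f x\<bar> + (B * d) * indicator (cball 0 R1) x"
    proof (cases "norm x \<le> R1")
      case True
      have "\<bar>max 0 (min 1 (f x)) - max 0 (min 1 (g x))\<bar> \<le> \<bar>g x - f x\<bar>" by (auto simp: max_def min_def abs_if)
      moreover have "\<bar>a - c\<bar> \<le> s + d" if "\<bar>a - b\<bar> \<le> s" "\<bar>b - c\<bar> \<le> d" for a b c s :: real
        using that by linarith
      ultimately have "\<bar>max 0 (min 1 (f x)) - soft_clamp d (g x)\<bar> \<le> \<bar>g x - f x\<bar> + d"
        using soft_clamp_approx[OF d, of "g x"] by blast
      moreover have "\<bar>divergence X x\<bar> \<le> B" using B(2)[of x] by simp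
      ultimately have "\<bar>(max 0 (min 1 (f x)) - soft_clamp d (g x)) * divergence X x\<bar> \<le> (\<bar>g x - f x\<bar> + d) * B"
        unfolding abs_mult by (intro mult_mono) auto
      then show ?thesis using True by (simp add: algebra_simps)
    next
      case False
      then have "divergence X x = 0" using vanishes_beyond_divergence[OF R1] by (simp add: vanishes_beyond_def)
      then show ?thesis using B(1) d by (auto simp: indicator_def)
    qed
  qed
  also have "\<dots> = B * (\<integral>x. \<bar>g x - f x\<bar> \<partial>lborel) + B * d * v"
    using f(1) g_int ind by (simp add: v_def)
  also have "\<dots> \<le> B * e1 + e / 2"
    using \<delta>(2)[OF \<epsilon>(2) \<rho>] B(1) d' by (intro add_mono mult_left_mono) (auto simp: g_def)
  finally show "(\<integral>x. max 0 (min 1 (f x)) * divergence X x \<partial>lborel) \<le> M + e"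
    using 1 e1' by linarith
qed

text \<open>Mollifications of \<open>f\<close> vanish at points of \<open>V\<close> whose distance from the complement exceeds the radius
  of the mollifier, and they converge to \<open>f\<close> in \<open>L\<^sup>1\<close>.\<close>

lemma fundamental_lemma:
  fixes f :: "real^'n \<Rightarrow> real"
  assumes f: "integrable lborel f" and V: "open V" "bounded V"
    and zero: "\<And>\<rho>. C_infinity \<rho> \<Longrightarrow> compact (closure {x. \<rho> x \<noteq> 0}) \<Longrightarrow> closure {x. \<rho> x \<noteq> 0} \<subseteq> V \<Longrightarrow>
      (\<integral>x. f x * \<rho> x \<partial>lborel) = 0"
  shows "AE x in lborel. x \<in> V \<longrightarrow> f x = 0"
proof -
  define h where "h x = indicator V x * f x" for x
  have h: "integrable lborel h"
    unfolding h_def using integrable_mult_indicator[of V lborel f] V(1) f by simp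
  obtain R where "\<forall>x\<in>V. norm x \<le> R" using V(2) by (auto simp: bounded_iff)
  then have hR: "vanishes_beyond R h" by (force simp: vanishes_beyond_def h_def indicator_def)
  have V': "- V \<noteq> {}" using V(2) not_bounded_UNIV by (metis Compl_UNIV_eq double_compl)
  define D where "D n = {x. infdist x (- V) > 1 / real (Suc n)}" for n
  have "AE x in lborel. x \<in> D n \<longrightarrow> h x = 0" for n
  proof -
    have "open (D n)" unfolding D_def by (intro open_Collect_less continuous_intros)
    then have int: "integrable lborel (\<lambda>x. indicator (D n) x * \<bar>h x\<bar>)"
      using integrable_mult_indicator[of "D n" lborel "\<lambda>x. \<bar>h x\<bar>"] h by simp
    have "(\<integral>x. indicator (D n) x * \<bar>h x\<bar> \<partial>lborel) \<le> 0 + e" if e: "e > 0" for e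
    proof -
      obtain \<delta> where \<delta>: "\<delta> > 0" "\<And>\<epsilon> \<rho>. \<epsilon> < \<delta> \<Longrightarrow> mollifier \<epsilon> \<rho> \<Longrightarrow> (\<integral>x. \<bar>conv \<rho> h x - h x\<bar> \<partial>lborel) \<le> e"
        using mollification_L1[OF h hR e] by blast
      define \<epsilon> where "\<epsilon> = min \<delta> (1 / real (Suc n)) / 2"
      have \<epsilon>: "\<epsilon> > 0" "\<epsilon> < \<delta>" "\<epsilon> < 1 / real (Suc n)" using \<delta>(1) by (auto simp: \<epsilon>_def min_def field_simps)
      obtain \<rho> :: "real^'n \<Rightarrow> real" where \<rho>: "mollifier \<epsilon> \<rho>" using mollifier_exists[OF \<epsilon>(1)] by blast
      have conv0: "conv \<rho> h x = 0" if x: "x \<in> D n" for x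
      proof -
        have ball: "cball x \<epsilon> \<subseteq> V"
        proof
          fix y assume y: "y \<in> cball x \<epsilon>"
          show "y \<in> V"
          proof (rule ccontr)
            assume "y \<notin> V"
            then have "infdist x (- V) \<le> dist x y" by (intro infdist_le) simp
            then show False using x y \<epsilon>(3) by (simp add: D_def)
          qed
        qed
        have supp: "{y. \<rho> (x - y) \<noteq> 0} \<subseteq> cball x \<epsilon>"
        proof
          fix y assume "y \<in> {y. \<rho> (x - y) \<noteq> 0}"
          then have "\<not> norm (x - y) > \<epsilon>" using mollifierD(3)[OF \<rho>] by (auto simp: vanishes_beyond_def)
          then show "y \<in> cball x \<epsilon>" by (simp add: dist_norm)
        qed
        have "(\<integral>y. f y * \<rho> (x - y) \<partial>lborel) = 0"
        proof (rule zero)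
          show "C_infinity (\<lambda>y. \<rho> (x - y))"
            unfolding C_infinity_def
            by (intro allI C_k_compose[OF mollifierD(1)[OF \<rho>]] C_k_diff C_k_const C_k_bounded_linear[OF bounded_linear_ident])
          show "compact (closure {y. \<rho> (x - y) \<noteq> 0})"
            unfolding compact_closure by (rule bounded_subset[OF bounded_cball supp])
          show "closure {y. \<rho> (x - y) \<noteq> 0} \<subseteq> V"
            using closure_minimal[OF supp closed_cball] ball by blast
        qed
        moreover have "(\<lambda>y. h y * \<rho> (x - y)) = (\<lambda>y. f y * \<rho> (x - y))"
          using supp ball by (auto simp: h_def fun_eq_iff indicator_def)
        ultimately show ?thesis by (simp add: conv_def)
      qed
      have "(\<integral>x. indicator (D n) x * \<bar>h x\<bar> \<partial>lborel) \<le> (\<integral>x. \<bar>conv \<rho> h x - h x\<bar> \<partial>lborel)"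
      proof (rule integral_mono[OF int])
        show "integrable lborel (\<lambda>x. \<bar>conv \<rho> h x - h x\<bar>)"
          using conv_integrable_and_bound(1)[OF h \<rho>] h by simp
        show "indicator (D n) x * \<bar>h x\<bar> \<le> \<bar>conv \<rho> h x - h x\<bar>" for x
          using conv0[of x] by (cases "x \<in> D n") auto
      qed
      also have "\<dots> \<le> e" by (rule \<delta>(2)[OF \<epsilon>(2) \<rho>])
      finally show ?thesis by simp
    qed
    then have "(\<integral>x. indicator (D n) x * \<bar>h x\<bar> \<partial>lborel) \<le> 0" by (rule field_le_epsilon)
    moreover have "(\<integral>x. indicator (D n) x * \<bar>h x\<bar> \<partial>lborel) \<ge> 0" by (intro integral_nonneg_AE AE_I2) simp
    ultimately have "(\<integral>x. indicator (D n) x * \<bar>h x\<bar> \<partial>lborel) = 0" by linarith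
    then have "AE x in lborel. indicator (D n) x * \<bar>h x\<bar> = 0"
      using integral_nonneg_eq_0_iff_AE[OF int] by (auto intro: AE_I2)
    then show ?thesis by (auto elim!: eventually_mono simp: indicator_def split: if_splits)
  qed
  then have "AE x in lborel. \<forall>n. x \<in> D n \<longrightarrow> h x = 0" unfolding AE_all_countable by blast
  then show ?thesis
  proof eventually_elim
    case (elim x)
    show ?case
    proof
      assume x: "x \<in> V"
      have "infdist x (- V) \<noteq> 0"
        using in_closed_iff_infdist_zero[of "- V" x] V' V(1) x by auto
      then have "infdist x (- V) > 0" using infdist_nonneg[of x "- V"] by linarith
      then obtain n where "1 / real (Suc n) < infdist x (- V)" using nat_approx_posE by blast
      then have "x \<in> D n" by (simp add: D_def)
      then have "h x = 0" using elim by blast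
      then show "f x = 0" using x by (simp add: h_def)
    qed
  qed
qed


section \<open>Forms of degree \<open>N - 1\<close> and vector fields\<close>

lemma alternating_form_cong: "alternating_form k \<alpha> \<Longrightarrow> (\<And>i. i < k \<Longrightarrow> v i = w i) \<Longrightarrow> \<alpha> v = \<alpha> w"
  unfolding alternating_form_def by blast

lemma alternating_form_linear: "alternating_form k \<alpha> \<Longrightarrow> i < k \<Longrightarrow> linear (\<lambda>x. \<alpha> (v(i := x)))"
  unfolding alternating_form_def by blast

lemma alternating_form_repeat:
  "alternating_form k \<alpha> \<Longrightarrow> i < k \<Longrightarrow> j < k \<Longrightarrow> i \<noteq> j \<Longrightarrow> v i = v j \<Longrightarrow> \<alpha> v = 0"
  unfolding alternating_form_def by blast

lemma alternating_form_swap: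
  assumes \<alpha>: "alternating_form k \<alpha>" and ij: "i < k" "j < k" "i \<noteq> j"
  shows "\<alpha> (v(i := a, j := b)) = - \<alpha> (v(i := b, j := a))"
proof -
  have L: "\<alpha> (v(i := x + y, j := z)) = \<alpha> (v(i := x, j := z)) + \<alpha> (v(i := y, j := z))" for x y z
    using linear_add[OF alternating_form_linear[OF \<alpha> ij(1), of "v(j := z)"], of x y] ij(3)
    by (simp add: fun_upd_twist)
  have R: "\<alpha> (v(i := z, j := x + y)) = \<alpha> (v(i := z, j := x)) + \<alpha> (v(i := z, j := y))" for x y z
    using linear_add[OF alternating_form_linear[OF \<alpha> ij(2), of "v(i := z)"], of x y] by simp
  have Z: "\<alpha> (v(i := x, j := x)) = 0" for x
    by (rule alternating_form_repeat[OF \<alpha> ij]) (use ij(3) in simp)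
  have "\<alpha> (v(i := a + b, j := a + b)) = \<alpha> (v(i := a, j := b)) + \<alpha> (v(i := b, j := a))"
    unfolding L R using Z[of a] Z[of b] by simp
  then show ?thesis using Z[of "a + b"] by simp
qed

lemma alternating_form_transpose:
  assumes \<alpha>: "alternating_form k \<alpha>" and ij: "i < k" "j < k" "i \<noteq> j"
  shows "\<alpha> (v \<circ> Transposition.transpose i j) = - \<alpha> v"
proof -
  have "v \<circ> Transposition.transpose i j = v(i := v j, j := v i)"
    by (auto simp: fun_eq_iff Transposition.transpose_def)
  moreover have "v = v(i := v i, j := v j)" by simp
  ultimately show ?thesis using alternating_form_swap[OF \<alpha> ij, of v "v j" "v i"] by metis
qed

lemma alternating_form_permute_zero:
  assumes \<alpha>: "alternating_form k \<alpha>" and p: "p permutes {..<k}"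
  shows "\<alpha> v = 0 \<Longrightarrow> \<alpha> (v \<circ> p) = 0"
  using p finite_lessThan
proof (induction p arbitrary: v rule: permutes_induct)
  case id
  then show ?case by simp
next
  case (swap a b p)
  then have "\<alpha> (v \<circ> Transposition.transpose a b) = 0"
    using alternating_form_transpose[OF \<alpha>, of a b v] by simp
  from swap.IH[OF this] show ?case by (simp only: comp_assoc)
qed

text \<open>By multilinearity the arguments are replaced by basis vectors one after the other.\<close>

lemma alternating_form_zeroI:
  fixes \<alpha> :: "(nat \<Rightarrow> real^'n) \<Rightarrow> real"
  assumes \<alpha>: "alternating_form k \<alpha>" and basis: "\<And>\<kappa>. \<alpha> (\<lambda>j. axis (\<kappa> j :: 'n) 1) = 0"
  shows "\<alpha> v = 0"
proof -
  have "\<forall>v. (\<forall>j. m \<le> j \<and> j < k \<longrightarrow> (\<exists>b. v j = axis b 1)) \<longrightarrow> \<alpha> v = 0" for m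
  proof (induction m)
    case 0
    show ?case
    proof (intro allI impI)
      fix v :: "nat \<Rightarrow> real^'n" assume "\<forall>j. 0 \<le> j \<and> j < k \<longrightarrow> (\<exists>b. v j = axis b 1)"
      then obtain \<kappa> where \<kappa>: "\<And>j. j < k \<Longrightarrow> v j = axis (\<kappa> j) 1" by (metis zero_le)
      have "\<alpha> v = \<alpha> (\<lambda>j. axis (\<kappa> j) 1)" by (rule alternating_form_cong[OF \<alpha>]) (rule \<kappa>)
      then show "\<alpha> v = 0" using basis by simp
    qed
  next
    case (Suc m)
    show ?case
    proof (intro allI impI)
      fix v :: "nat \<Rightarrow> real^'n" assume v: "\<forall>j. Suc m \<le> j \<and> j < k \<longrightarrow> (\<exists>b. v j = axis b 1)"
      have IH: "\<alpha> (v(m := axis b 1)) = 0" for b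
        using v by (intro Suc.IH[rule_format]) (metis Suc_leI fun_upd_apply le_neq_implies_less)
      show "\<alpha> v = 0"
      proof (cases "m < k")
        case True
        note lin = alternating_form_linear[OF \<alpha> True, of v]
        have "v m = (\<Sum>b\<in>UNIV. (v m $ b) *\<^sub>R axis b 1)"
          by (auto simp: vec_eq_iff axis_def if_distrib cong: if_cong)
        then have "\<alpha> v = \<alpha> (v(m := (\<Sum>b\<in>UNIV. (v m $ b) *\<^sub>R axis b 1)))" by simp
        also have "\<dots> = (\<Sum>b\<in>UNIV. (v m $ b) * \<alpha> (v(m := axis b 1)))"
          using linear_sum[OF lin, of "\<lambda>b. (v m $ b) *\<^sub>R axis b 1" UNIV] linear_scale[OF lin] by simp
        finally show ?thesis by (simp add: IH)
      next
        case False
        then show ?thesis using Suc.IH by auto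
      qed
    qed
  qed
  moreover have "\<forall>j. k \<le> j \<and> j < k \<longrightarrow> (\<exists>b. v j = axis b 1)" by auto
  ultimately show ?thesis by blast
qed

lemma alternating_form_diff:
  assumes "alternating_form k \<alpha>" "alternating_form k \<beta>"
  shows "alternating_form k (\<lambda>v. \<alpha> v - \<beta> v)"
proof -
  have "linear (\<lambda>x. \<alpha> (v(i := x)) - \<beta> (v(i := x)))" if "i < k" for v i
    by (intro linear_compose_sub alternating_form_linear[OF assms(1) that] alternating_form_linear[OF assms(2) that])
  moreover have "\<alpha> v - \<beta> v = \<alpha> w - \<beta> w" if "\<forall>i<k. v i = w i" for v w
    using alternating_form_cong[OF assms(1), of v w] alternating_form_cong[OF assms(2), of v w] that by simp
  moreover have "\<alpha> v - \<beta> v = 0" if "i < k \<and> j < k \<and> i \<noteq> j \<and> v i = v j" for v i j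
    using alternating_form_repeat[OF assms(1), of i j v] alternating_form_repeat[OF assms(2), of i j v] that by simp
  ultimately show ?thesis unfolding alternating_form_def by blast
qed

lemma alternating_form_scale:
  assumes "alternating_form k \<alpha>"
  shows "alternating_form k (\<lambda>v. c * \<alpha> v)"
proof -
  have "linear (\<lambda>x. c * \<alpha> (v(i := x)))" if "i < k" for v i
    using linear_compose_scale_right[OF alternating_form_linear[OF assms that], of c] by simp
  moreover have "c * \<alpha> v = c * \<alpha> w" if "\<forall>i<k. v i = w i" for v w
    using alternating_form_cong[OF assms, of v w] that by simp
  moreover have "c * \<alpha> v = 0" if "i < k \<and> j < k \<and> i \<noteq> j \<and> v i = v j" for v i j
    using alternating_form_repeat[OF assms, of i j v] that by simp
  ultimately show ?thesis unfolding alternating_form_def by blast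
qed

abbreviation coord :: "nat \<Rightarrow> 'n::{finite,linorder}" where
  "coord i \<equiv> sorted_list_of_set UNIV ! i"

definition coord_index :: "'n::{finite,linorder} \<Rightarrow> nat" where
  "coord_index = inv_into {..<CARD('n)} coord"

lemma coord_bij: "bij_betw coord {..<CARD('n)} (UNIV :: 'n::{finite,linorder} set)"
  by (rule bij_betw_nth) auto

lemma coord_index: "coord_index (a :: 'n::{finite,linorder}) < CARD('n)" "coord (coord_index a) = a"
proof -
  have "a \<in> coord ` {..<CARD('n)}" using coord_bij[where 'n = 'n] by (simp add: bij_betw_def)
  then show "coord_index a < CARD('n)" "coord (coord_index a) = a"
    unfolding coord_index_def using inv_into_into[of a coord "{..<CARD('n)}"] f_inv_into_f[of a coord "{..<CARD('n)}"]
    by simp_all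
qed

lemma coord_index_coord: "i < CARD('n) \<Longrightarrow> coord_index (coord i :: 'n::{finite,linorder}) = i"
  unfolding coord_index_def using coord_bij[where 'n = 'n] by (intro inv_into_f_f) (auto simp: bij_betw_def)

lemma std_frame_coord: "std_frame i = axis (coord i) 1"
  by (simp add: std_frame_def)

definition frame_det :: "(nat \<Rightarrow> real^('n::{finite,linorder})) \<Rightarrow> real" where
  "frame_det v = det (\<chi> a. v (coord_index a))"

lemma frame_det_alternating:
  "alternating_form CARD('n) (frame_det :: (nat \<Rightarrow> real^('n::{finite,linorder})) \<Rightarrow> real)"
  unfolding alternating_form_def
proof (intro conjI allI impI)
  fix v w :: "nat \<Rightarrow> real^('n::{finite,linorder})" assume "\<forall>i<CARD('n). v i = w i"
  then have "v (coord_index a) = w (coord_index a)" for a :: 'n using coord_index(1) by blast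
  then show "frame_det v = frame_det w" by (simp add: frame_det_def)
next
  fix v :: "nat \<Rightarrow> real^('n::{finite,linorder})" and i assume i: "i < CARD('n)"
  have eq: "frame_det (v(i := x)) = det (\<chi> a. if a = coord i then x else v (coord_index a))" for x
  proof -
    have "(v(i := x)) (coord_index a) = (if a = coord i then x else v (coord_index a))" for a :: 'n
      using coord_index[of a] coord_index_coord[OF i] by auto
    then show ?thesis unfolding frame_det_def by simp
  qed
  show "linear (\<lambda>x. frame_det (v(i := x)))"
  proof (rule linearI)
    show "frame_det (v(i := x + y)) = frame_det (v(i := x)) + frame_det (v(i := y))" for x y
      unfolding eq using det_row_add[of "coord i" "\<lambda>_. x" "\<lambda>_. y" "\<lambda>a. v (coord_index a)"] by simp
    show "frame_det (v(i := c *\<^sub>R x)) = c *\<^sub>R frame_det (v(i := x))" for c x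
      unfolding eq using det_row_mul[of "coord i" c "\<lambda>_. x" "\<lambda>a. v (coord_index a)"]
      unfolding scalar_mult_eq_scaleR by simp
  qed
next
  fix v :: "nat \<Rightarrow> real^('n::{finite,linorder})" and i j assume ij: "i < CARD('n) \<and> j < CARD('n) \<and> i \<noteq> j \<and> v i = v j"
  then have ne: "coord i \<noteq> (coord j :: 'n)" using coord_index_coord[where 'n = 'n] by metis
  define M :: "real^('n::{finite,linorder})^('n::{finite,linorder})" where "M = (\<chi> a. v (coord_index a))"
  have "row (coord i) M = row (coord j) M"
    using ij by (simp add: M_def row_def coord_index_coord)
  then show "frame_det v = 0" unfolding frame_det_def M_def[symmetric] by (rule det_identical_rows[OF ne])
qed

lemma frame_det_std: "frame_det (std_frame :: nat \<Rightarrow> real^('n::{finite,linorder})) = 1"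
proof -
  have "(\<chi> a. std_frame (coord_index a)) = (mat 1 :: real^('n::{finite,linorder})^('n::{finite,linorder}))"
    by (auto simp: std_frame_coord coord_index(2) vec_eq_iff mat_def axis_def)
  then show ?thesis by (simp add: frame_det_def)
qed

lemma frame_det_orthonormal:
  fixes v :: "nat \<Rightarrow> real^('n::{finite,linorder})"
  assumes "\<And>i j. i < CARD('n) \<Longrightarrow> j < CARD('n) \<Longrightarrow> v i \<bullet> v j = (if i = j then 1 else 0)"
  shows "\<bar>frame_det v\<bar> = 1"
proof -
  define M :: "real^('n::{finite,linorder})^('n::{finite,linorder})" where "M = (\<chi> a. v (coord_index a))"
  have "(M ** Finite_Cartesian_Product.transpose M) $ a $ b = (if a = b then 1 else 0)" for a b
  proof -
    have "(M ** Finite_Cartesian_Product.transpose M) $ a $ b = v (coord_index a) \<bullet> v (coord_index b)"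
      by (simp add: matrix_matrix_mult_def Finite_Cartesian_Product.transpose_def M_def inner_vec_def)
    moreover have "coord_index a = coord_index b \<longleftrightarrow> a = b" using coord_index(2) by metis
    ultimately show ?thesis using assms[OF coord_index(1) coord_index(1), of a b] by simp
  qed
  then have "M ** Finite_Cartesian_Product.transpose M = mat 1" by (simp add: vec_eq_iff mat_def)
  then have "orthogonal_matrix (Finite_Cartesian_Product.transpose M)"
    by (simp add: orthogonal_matrix Finite_Cartesian_Product.transpose_transpose)
  then have "det M = 1 \<or> det M = -1" using det_orthogonal_matrix by fastforce
  then show ?thesis by (auto simp: frame_det_def M_def)
qed

definition omit :: "nat \<Rightarrow> (nat \<Rightarrow> 'a) \<Rightarrow> nat \<Rightarrow> 'a" where
  "omit i v = (\<lambda>j. if j < i then v j else v (Suc j))"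

text \<open>Under the pairing \<open>\<omega>(v) = det(X, v)\<close> the exterior derivative is the divergence and the comass
  is the length.\<close>

definition form_of_field :: "(real^('n::{finite,linorder}) \<Rightarrow> real^('n::{finite,linorder})) \<Rightarrow> (real^('n::{finite,linorder})) dform" where
  "form_of_field X x v = frame_det (case_nat (X x) v)"

definition field_of_form :: "(real^('n::{finite,linorder})) dform \<Rightarrow> real^('n::{finite,linorder}) \<Rightarrow> real^('n::{finite,linorder})" where
  "field_of_form \<omega> x = (\<chi> a. (-1) ^ coord_index a * \<omega> x (omit (coord_index a) std_frame))"

lemma case_nat_upd: "case_nat a (v(i := x)) = (case_nat a v)(Suc i := x)" "(case_nat a v)(0 := x) = case_nat x v"
  by (auto simp: fun_eq_iff split: nat.splits)

lemma form_of_field_alternating: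
  "alternating_form (CARD('n) - 1) (form_of_field X (x :: real^('n::{finite,linorder})))"
  unfolding alternating_form_def form_of_field_def
proof (intro conjI allI impI)
  note alt = frame_det_alternating[where 'n = 'n]
  fix v w :: "nat \<Rightarrow> real^('n::{finite,linorder})" assume "\<forall>i<CARD('n) - 1. v i = w i"
  then show "frame_det (case_nat (X x) v) = frame_det (case_nat (X x) w)"
    by (intro alternating_form_cong[OF alt]) (auto split: nat.splits)
next
  fix v :: "nat \<Rightarrow> real^('n::{finite,linorder})" and i assume "i < CARD('n) - 1"
  then show "linear (\<lambda>y. frame_det (case_nat (X x) (v(i := y))))"
    unfolding case_nat_upd by (intro alternating_form_linear[OF frame_det_alternating]) simp
next
  fix v :: "nat \<Rightarrow> real^('n::{finite,linorder})" and i j assume "i < CARD('n) - 1 \<and> j < CARD('n) - 1 \<and> i \<noteq> j \<and> v i = v j"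
  then show "frame_det (case_nat (X x) v) = 0"
    by (intro alternating_form_repeat[OF frame_det_alternating, of "Suc i" "Suc j"]) auto
qed

lemma frame_det_linear_first: "linear (\<lambda>y. frame_det (case_nat y (v :: nat \<Rightarrow> real^('n::{finite,linorder}))))"
  using alternating_form_linear[OF frame_det_alternating, of 0 "case_nat 0 v"] by (simp add: case_nat_upd)

lemma frame_det_cofactor:
  fixes v :: "nat \<Rightarrow> real^('n::{finite,linorder})"
  shows "frame_det (case_nat y v) = (\<Sum>a\<in>UNIV. y $ a * frame_det (case_nat (axis a 1) v))"
proof -
  note lin = frame_det_linear_first[of v]
  have "y = (\<Sum>a\<in>UNIV. (y $ a) *\<^sub>R axis a 1)"
    by (auto simp: vec_eq_iff axis_def if_distrib cong: if_cong)
  then have "frame_det (case_nat y v) = frame_det (case_nat (\<Sum>a\<in>UNIV. (y $ a) *\<^sub>R axis a 1) v)" by simp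
  also have "\<dots> = (\<Sum>a\<in>UNIV. y $ a * frame_det (case_nat (axis a 1) v))"
    using linear_sum[OF lin, of "\<lambda>a. (y $ a) *\<^sub>R axis a 1" UNIV] linear_scale[OF lin] by simp
  finally show ?thesis .
qed

text \<open>Moving \<open>e\<^sub>i\<close> from the front to its place takes \<open>i\<close> transpositions.\<close>

lemma frame_det_move:
  assumes i: "i < CARD('n)"
  shows "frame_det (case_nat (std_frame i) (omit i std_frame) :: nat \<Rightarrow> real^('n::{finite,linorder})) = (-1) ^ i"
proof -
  define F where "F j = (\<lambda>k. if k < j then std_frame k else if k = j then std_frame i
    else if k \<le> i then std_frame (k - 1) else std_frame k :: real^('n::{finite,linorder}))" for j
  have F0: "F 0 = case_nat (std_frame i) (omit i std_frame)"
    by (auto simp: F_def omit_def fun_eq_iff split: nat.splits)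
  have Fi: "F i = std_frame" by (auto simp: F_def fun_eq_iff)
  have step: "frame_det (F j) = - frame_det (F (Suc j))" if "j < i" for j
  proof -
    have "F (Suc j) = F j \<circ> Transposition.transpose j (Suc j)"
      using that by (auto simp: F_def fun_eq_iff Transposition.transpose_def)
    then show ?thesis
      using alternating_form_transpose[OF frame_det_alternating, of j "Suc j" "F j"] that i by simp
  qed
  have "j \<le> i \<Longrightarrow> frame_det (F 0) = (-1) ^ j * frame_det (F j)" for j
    by (induction j) (simp_all add: step)
  from this[of i] show ?thesis by (simp add: F0 Fi frame_det_std)
qed

lemma form_of_field_omit:
  fixes x :: "real^('n::{finite,linorder})"
  assumes i: "i < CARD('n)"
  shows "form_of_field X x (omit i std_frame) = (-1) ^ i * X x $ coord i"
proof -
  have zero: "frame_det (case_nat (axis a 1) (omit i std_frame)) = 0" if "a \<noteq> coord i" for a :: 'n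
  proof -
    define j where "j = coord_index a"
    have j: "j < CARD('n)" "a = coord j" "j \<noteq> i" using coord_index[of a] that by (auto simp: j_def)
    define k where "k = (if j < i then j else j - 1)"
    have "Suc k < CARD('n)" "case_nat (axis a 1) (omit i std_frame) (Suc k) = axis a 1"
      using j i by (auto simp: k_def omit_def std_frame_coord)
    then show ?thesis
      using i by (intro alternating_form_repeat[OF frame_det_alternating, of 0 "Suc k"]) auto
  qed
  have "form_of_field X x (omit i std_frame)
    = X x $ coord i * frame_det (case_nat (axis (coord i) 1 :: real^('n::{finite,linorder})) (omit i std_frame))"
    unfolding form_of_field_def frame_det_cofactor[of "X x"] by (subst sum.remove[of _ "coord i"]) (auto simp: zero)
  then show ?thesis using frame_det_move[OF i] by (simp add: std_frame_coord)
qed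

lemma field_of_form_of_field: "field_of_form (form_of_field X) = X"
  by (auto simp: fun_eq_iff vec_eq_iff field_of_form_def form_of_field_omit[OF coord_index(1)] coord_index(2)
      simp flip: power_add mult.assoc mult_2)

text \<open>An injective tuple of \<open>N - 1\<close> basis vectors misses exactly one of them, so it is a permutation of
  the standard frame without that vector.\<close>

lemma injective_basis_tuple_permuted_omit:
  fixes \<kappa> :: "nat \<Rightarrow> 'n::{finite,linorder}"
  assumes \<kappa>: "inj_on \<kappa> {..<CARD('n) - 1}"
  obtains i p where "i < CARD('n)" "p permutes {..<CARD('n) - 1}"
    "\<And>j. j < CARD('n) - 1 \<Longrightarrow> axis (\<kappa> j) 1 = (omit i std_frame \<circ> p) j"
proof -
  let ?k = "CARD('n) - 1"
  have "card (\<kappa> ` {..<?k}) = ?k" using card_image[OF \<kappa>] by simp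
  moreover have "?k < CARD('n)" by simp
  ultimately have "\<kappa> ` {..<?k} \<noteq> UNIV" by (metis less_irrefl)
  then obtain l where l: "l \<notin> \<kappa> ` {..<?k}" by blast
  define i where "i = coord_index l"
  have i: "i < CARD('n)" "coord i = l" using coord_index[of l] by (auto simp: i_def)
  \<comment> \<open>The inverse of the enumeration of the basis vectors other than \<open>e\<^sub>i\<close>.\<close>
  define \<sigma> where "\<sigma> j = (let m = coord_index (\<kappa> j) in if m < i then m else m - 1)" for j
  have m: "coord_index (\<kappa> j) \<noteq> i" "coord_index (\<kappa> j) < CARD('n)" if "j < ?k" for j
    using l that coord_index[of "\<kappa> j"] i by auto
  have \<sigma>: "omit i std_frame (\<sigma> j) = (axis (\<kappa> j) 1 :: real^('n::{finite,linorder}))" "\<sigma> j < ?k" if "j < ?k" for j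
  proof -
    show "omit i std_frame (\<sigma> j) = (axis (\<kappa> j) 1 :: real^('n::{finite,linorder}))"
      using m[OF that] coord_index(2)[of "\<kappa> j"] by (auto simp: \<sigma>_def omit_def std_frame_coord Let_def)
    show "\<sigma> j < ?k" using m[OF that] i(1) by (auto simp: \<sigma>_def Let_def)
  qed
  have "inj_on \<sigma> {..<?k}"
  proof (rule inj_onI)
    fix a b assume ab: "a \<in> {..<?k}" "b \<in> {..<?k}" "\<sigma> a = \<sigma> b"
    then have "(axis (\<kappa> a) 1 :: real^('n::{finite,linorder})) = axis (\<kappa> b) 1" using \<sigma>(1)[of a] \<sigma>(1)[of b] by simp
    then have "\<kappa> a = \<kappa> b" by (simp add: axis_eq_axis)
    then show "a = b" using \<kappa> ab by (auto dest: inj_onD)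
  qed
  moreover have "\<sigma> ` {..<?k} \<subseteq> {..<?k}" using \<sigma>(2) by auto
  ultimately have bij: "bij_betw \<sigma> {..<?k} {..<?k}"
    by (simp add: bij_betw_def endo_inj_surj)
  define p where "p j = (if j < ?k then \<sigma> j else j)" for j
  have "p permutes {..<?k}"
  proof (rule bij_imp_permutes)
    show "bij_betw p {..<?k} {..<?k}"
      using bij by (rule bij_betw_cong[THEN iffD1, rotated]) (simp add: p_def)
  qed (simp add: p_def)
  moreover have "axis (\<kappa> j) 1 = (omit i std_frame \<circ> p) j" if "j < ?k" for j
    using \<sigma>(1)[OF that] that by (simp add: p_def)
  ultimately show thesis using that i(1) by blast
qed

text \<open>Both forms agree on the standard frame without one of its vectors, hence on all tuples of basis
  vectors by the alternating property.\<close>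

lemma form_of_field_of_form:
  fixes \<omega> :: "(real^('n::{finite,linorder})) dform"
  assumes \<omega>: "alternating_form (CARD('n) - 1) (\<omega> x)"
  shows "\<omega> x v = form_of_field (field_of_form \<omega>) x v"
proof -
  define \<delta> where "\<delta> v = \<omega> x v - form_of_field (field_of_form \<omega>) x v" for v
  have \<delta>: "alternating_form (CARD('n) - 1) \<delta>"
    unfolding \<delta>_def by (rule alternating_form_diff[OF \<omega> form_of_field_alternating])
  have omit0: "\<delta> (omit i std_frame) = 0" if i: "i < CARD('n)" for i
    unfolding \<delta>_def form_of_field_omit[OF i]
    by (simp add: field_of_form_def coord_index_coord[OF i] flip: power_add mult.assoc mult_2)
  have "\<delta> (\<lambda>j. axis (\<kappa> j) 1) = 0" for \<kappa> :: "nat \<Rightarrow> 'n"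
  proof (cases "inj_on \<kappa> {..<CARD('n) - 1}")
    case True
    then obtain i p where ip: "i < CARD('n)" "p permutes {..<CARD('n) - 1}"
      "\<And>j. j < CARD('n) - 1 \<Longrightarrow> axis (\<kappa> j) 1 = ((omit i std_frame \<circ> p) j :: real^('n::{finite,linorder}))"
      by (rule injective_basis_tuple_permuted_omit) (rule that)
    have "\<delta> (\<lambda>j. axis (\<kappa> j) 1) = \<delta> (omit i std_frame \<circ> p)"
      by (rule alternating_form_cong[OF \<delta> ip(3)])
    also have "\<dots> = 0" by (rule alternating_form_permute_zero[OF \<delta> ip(2) omit0[OF ip(1)]])
    finally show ?thesis .
  next
    case False
    then obtain a b where "a < CARD('n) - 1" "b < CARD('n) - 1" "a \<noteq> b" "\<kappa> a = \<kappa> b"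
      by (auto simp: inj_on_def)
    then show ?thesis by (intro alternating_form_repeat[OF \<delta>, of a b]) auto
  qed
  then have "\<delta> v = 0" by (rule alternating_form_zeroI[OF \<delta>])
  then show ?thesis by (simp add: \<delta>_def)
qed

lemma comass_form_of_field:
  fixes x :: "real^('n::{finite,linorder})"
  assumes "norm (X x) \<le> 1"
  shows "comass (CARD('n) - 1) (form_of_field X x) \<le> 1"
  unfolding comass_def
proof (rule SUP_least)
  fix v :: "nat \<Rightarrow> real^('n::{finite,linorder})"
  assume "v \<in> {v. \<forall>i<CARD('n) - 1. \<forall>j<CARD('n) - 1. v i \<bullet> v j = (if i = j then 1 else 0)}"
  then have v: "v i \<bullet> v j = (if i = j then 1 else 0)" if "i < CARD('n) - 1" "j < CARD('n) - 1" for i j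
    using that by auto
  define c :: "real^('n::{finite,linorder})" where "c = (\<chi> a. frame_det (case_nat (axis a 1) v))"
  have c: "frame_det (case_nat y v) = y \<bullet> c" for y
    unfolding frame_det_cofactor[of y] by (simp add: c_def inner_vec_def)
  have orth: "v j \<bullet> c = 0" if "j < CARD('n) - 1" for j
    unfolding c[symmetric] using that
    by (intro alternating_form_repeat[OF frame_det_alternating, of 0 "Suc j"]) auto
  \<comment> \<open>The cofactor vector is normal to the frame, and completes it to an orthonormal basis once
    normalized, so it has length 1.\<close>
  have "norm c \<le> 1"
  proof (cases "c = 0")
    case False
    define t where "t = (1 / norm c) *\<^sub>R c"
    have t: "t \<bullet> t = 1" "t \<bullet> c = norm c"
      using False by (simp_all add: t_def power2_norm_eq_inner[symmetric] power2_eq_square)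
    have "\<bar>frame_det (case_nat t v)\<bar> = 1"
    proof (rule frame_det_orthonormal)
      fix i j assume "i < CARD('n)" "j < CARD('n)"
      then show "case_nat t v i \<bullet> case_nat t v j = (if i = j then 1 else 0)"
        using v orth t(1) by (auto simp: t_def inner_commute split: nat.splits)
    qed
    then show ?thesis unfolding c t(2) by simp
  qed simp
  then have "norm (X x) * norm c \<le> 1" using assms by (simp add: mult_le_one)
  then have "\<bar>form_of_field X x v\<bar> \<le> 1"
    unfolding form_of_field_def c using Cauchy_Schwarz_ineq2[of "X x" c] by linarith
  then show "ennreal \<bar>form_of_field X x v\<bar> \<le> 1" by (simp add: ennreal_le_1)
qed

text \<open>The length of the field at \<open>x\<close> is the value of the form on an orthonormal frame of its orthogonal
  complement.\<close>

lemma norm_field_of_form_le: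
  fixes \<omega> :: "(real^('n::{finite,linorder})) dform"
  assumes \<omega>: "alternating_form (CARD('n) - 1) (\<omega> x)" and comass: "comass (CARD('n) - 1) (\<omega> x) \<le> 1"
  shows "norm (field_of_form \<omega> x) \<le> 1"
proof (cases "field_of_form \<omega> x = 0")
  case False
  define T where "T = field_of_form \<omega> x"
  have T: "norm T > 0" using False by (simp add: T_def)
  define t where "t = (1 / norm T) *\<^sub>R T"
  have "norm t = 1" using T by (simp add: t_def)
  then obtain A :: "real^('n::{finite,linorder})^('n::{finite,linorder})" where A: "orthogonal_matrix A" "A *v (axis (coord 0) 1) = t"
    using orthogonal_matrix_exists_basis[of t "coord 0"] by blast
  define f where "f i = A *v (std_frame i)" for i
  have f0: "f 0 = t" by (simp add: f_def std_frame_coord A(2))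
  have orth: "f i \<bullet> f j = (if i = j then 1 else 0)" if "i < CARD('n)" "j < CARD('n)" for i j
  proof -
    have "orthogonal_transformation ((*v) A)" using A(1) by (simp add: orthogonal_transformation_matrix)
    then have "f i \<bullet> f j = std_frame i \<bullet> (std_frame j :: real^('n::{finite,linorder}))"
      by (simp add: f_def orthogonal_transformation_def)
    moreover have "coord i = (coord j :: 'n) \<longleftrightarrow> i = j"
      using coord_index_coord[OF that(1)] coord_index_coord[OF that(2)] by metis
    ultimately show ?thesis by (simp add: std_frame_coord inner_axis_axis)
  qed
  define v where "v i = f (Suc i)" for i
  have "case_nat t v = f" using f0 by (auto simp: v_def fun_eq_iff split: nat.splits)
  then have det: "\<bar>frame_det (case_nat t v)\<bar> = 1" using frame_det_orthonormal[OF orth] by simp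
  have "T = norm T *\<^sub>R t" using T by (simp add: t_def)
  then have "\<omega> x v = norm T * frame_det (case_nat t v)"
    using form_of_field_of_form[of \<omega> x v, OF \<omega>] linear_scale[OF frame_det_linear_first[of v], of "norm T" t]
    by (simp add: form_of_field_def T_def)
  then have "\<bar>\<omega> x v\<bar> = norm T" using det by (simp add: abs_mult)
  moreover have "ennreal \<bar>\<omega> x v\<bar> \<le> comass (CARD('n) - 1) (\<omega> x)"
    unfolding comass_def using orth by (intro SUP_upper) (auto simp: v_def)
  ultimately have "ennreal (norm T) \<le> 1" using comass by (metis order_trans)
  then show ?thesis by (simp add: T_def ennreal_le_1)
qed simp

lemma form_of_field_test_form:
  fixes X :: "real^('n::{finite,linorder}) \<Rightarrow> real^('n::{finite,linorder})"
  assumes X: "X \<in> test_fields U" "C_infinity X"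
  shows "form_of_field X \<in> test_forms (CARD('n) - 1) U"
proof -
  have smooth: "C_infinity (\<lambda>x. form_of_field X x v)" for v
    unfolding form_of_field_def frame_det_cofactor[of "X _"] C_infinity_def
  proof
    fix k
    have "C_k k (\<lambda>x. X x $ a)" for a using C_infinityD[OF X(2), of k] C_k_vec by blast
    then show "C_k k (\<lambda>x. \<Sum>a\<in>UNIV. X x $ a * frame_det (case_nat (axis a 1) v))"
      by (intro C_k_sum C_k_mult C_k_const)
  qed
  have "form_of_field X x = (\<lambda>_. 0)" if "X x = 0" for x
    using that linear_0[OF frame_det_linear_first[where 'n = 'n]] by (simp add: form_of_field_def fun_eq_iff)
  then have sub: "{x. form_of_field X x \<noteq> (\<lambda>_. 0)} \<subseteq> {x. X x \<noteq> 0}" by blast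
  note D = test_fieldsD[OF X(1)]
  have "compact (closure {x. form_of_field X x \<noteq> (\<lambda>_. 0)})"
    using D(2) bounded_subset[OF _ sub] by (simp add: compact_closure)
  then show ?thesis
    unfolding test_forms_def using form_of_field_alternating smooth closure_mono[OF sub] D(3) by blast
qed

lemma field_of_form_smooth:
  assumes "\<omega> \<in> test_forms k U"
  shows "C_infinity (field_of_form \<omega>)"
  unfolding C_infinity_def C_k_vec
proof (intro allI)
  fix k i
  have smooth: "C_infinity (\<lambda>x. \<omega> x v)" for v using assms by (simp add: test_forms_def)
  show "C_k k (\<lambda>x. field_of_form \<omega> x $ i)"
    unfolding field_of_form_def vec_lambda_beta by (intro C_k_mult C_k_const C_infinityD[OF smooth])
qed

lemma field_of_form_test_field:
  fixes \<omega> :: "(real^('n::{finite,linorder})) dform"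
  assumes \<omega>: "\<omega> \<in> test_forms k U"
  shows "field_of_form \<omega> \<in> test_fields U"
proof -
  have "field_of_form \<omega> x = 0" if "\<omega> x = (\<lambda>_. 0)" for x
    using that by (simp add: field_of_form_def vec_eq_iff)
  then have sub: "{x. field_of_form \<omega> x \<noteq> 0} \<subseteq> {x. \<omega> x \<noteq> (\<lambda>_. 0)}" by blast
  have D: "compact (closure {x. \<omega> x \<noteq> (\<lambda>_. 0)})" "closure {x. \<omega> x \<noteq> (\<lambda>_. 0)} \<subseteq> U"
    using \<omega> by (auto simp: test_forms_def)
  have "compact (closure {x. field_of_form \<omega> x \<noteq> 0})"
    using D(1) bounded_subset[OF _ sub] by (simp add: compact_closure)
  then show ?thesis
    unfolding test_fields_def using C_infinityD[OF field_of_form_smooth[OF \<omega>]] closure_mono[OF sub] D(2) by blast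
qed

text \<open>The signs in the exterior derivative are those in the definition of the field.\<close>

lemma ext_deriv_divergence:
  fixes \<omega> :: "(real^('n::{finite,linorder})) dform"
  assumes \<omega>: "\<And>v. C_infinity (\<lambda>x. \<omega> x v)" and "C_infinity (field_of_form \<omega>)"
  shows "ext_deriv (CARD('n) - 1) \<omega> x std_frame = divergence (field_of_form \<omega>) x"
proof -
  have comp: "grad (\<lambda>y. field_of_form \<omega> y $ a) x $ a
    = (-1) ^ coord_index a * frechet_derivative (\<lambda>y. \<omega> y (omit (coord_index a) std_frame)) (at x) (axis a 1)" for a
  proof -
    have "((\<lambda>y. \<omega> y (omit (coord_index a) std_frame)) has_derivative
        frechet_derivative (\<lambda>y. \<omega> y (omit (coord_index a) std_frame)) (at x)) (at x)"
      using C_1_differentiable[OF C_infinityD[OF \<omega>]] by (simp add: frechet_derivative_works)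
    from has_derivative_mult_right[OF this, of "(-1) ^ coord_index a"]
    show ?thesis by (simp add: field_of_form_def grad_nth frechet_derivative_at[symmetric])
  qed
  have "divergence (field_of_form \<omega>) x = (\<Sum>a\<in>UNIV. grad (\<lambda>y. field_of_form \<omega> y $ a) x $ a)"
    by (rule divergence_components[OF C_1_differentiable[OF C_infinityD[OF assms(2)]]])
  also have "\<dots> = (\<Sum>i<CARD('n). grad (\<lambda>y. field_of_form \<omega> y $ coord i) x $ coord i)"
    by (rule sum.reindex_bij_betw[OF coord_bij, symmetric])
  also have "\<dots> = (\<Sum>i<CARD('n). (-1) ^ i * frechet_derivative (\<lambda>y. \<omega> y (omit i std_frame)) (at x) (std_frame i))"
    by (rule sum.cong) (auto simp: comp coord_index_coord std_frame_coord)
  also have "{..<CARD('n)} = {..CARD('n) - 1}"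
    by (metis Suc_pred' lessThan_Suc_atMost zero_less_card_finite)
  finally show ?thesis by (simp add: ext_deriv_def omit_def)
qed


section \<open>Mass minimality\<close>

lemma integral_density:
  fixes \<theta> f g :: "real^'n \<Rightarrow> real"
  assumes \<theta>: "\<theta> \<in> borel_measurable lebesgue" and f: "f \<in> borel_measurable borel"
    and eq: "AE x in lborel. \<theta> x = f x" and g: "continuous_on UNIV g"
  shows "(\<integral>x. \<theta> x * g x \<partial>lebesgue) = (\<integral>x. f x * g x \<partial>lborel)"
proof -
  have gb: "g \<in> borel_measurable borel" by (rule borel_measurable_continuous_onI[OF g])
  have fg: "(\<lambda>x. f x * g x) \<in> borel_measurable lborel" using f gb by simp
  have "(\<integral>x. \<theta> x * g x \<partial>lebesgue) = (\<integral>x. f x * g x \<partial>lebesgue)"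
  proof (rule integral_cong_AE)
    show "(\<lambda>x. \<theta> x * g x) \<in> borel_measurable lebesgue"
      by (intro borel_measurable_times \<theta> continuous_borel_lebesgue g)
    show "(\<lambda>x. f x * g x) \<in> borel_measurable lebesgue" by (rule measurable_completion[OF fg])
    show "AE x in lebesgue. \<theta> x * g x = f x * g x"
      using AE_completion[OF eq] by eventually_elim simp
  qed
  then show ?thesis using integral_completion[OF fg] by simp
qed

text \<open>Top-dimensional test forms are the products of test functions with the determinant, so a
  density is zero almost everywhere outside the support of its current.\<close>

lemma density_zero_off_support:
  fixes f :: "real^('n::{finite,linorder}) \<Rightarrow> real"
  assumes f: "integrable lborel f"
    and W: "\<And>\<omega>. \<omega> \<in> test_forms CARD('n) UNIV \<Longrightarrow> W \<omega> = (\<integral>x. f x * \<omega> x std_frame \<partial>lborel)"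
  shows "AE x in lborel. x \<notin> current_support CARD('n) W \<longrightarrow> f x = 0"
proof -
  define \<F> where "\<F> = {V. open V \<and> bounded V \<and> (\<forall>\<omega>\<in>test_forms CARD('n) V. W \<omega> = 0)}"
  have ae: "AE x in lborel. x \<in> V \<longrightarrow> f x = 0" if V: "V \<in> \<F>" for V
  proof (rule fundamental_lemma[OF f])
    show "open V" "bounded V" using V by (auto simp: \<F>_def)
    fix \<rho> :: "real^('n::{finite,linorder}) \<Rightarrow> real"
    assume \<rho>: "C_infinity \<rho>" "compact (closure {x. \<rho> x \<noteq> 0})" "closure {x. \<rho> x \<noteq> 0} \<subseteq> V"
    define \<omega> :: "(real^('n::{finite,linorder})) dform" where "\<omega> x v = \<rho> x * frame_det v" for x v
    have "\<omega> x \<noteq> (\<lambda>_. 0) \<longleftrightarrow> \<rho> x \<noteq> 0" for x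
      using frame_det_std[where 'n = 'n] by (auto simp: \<omega>_def fun_eq_iff) (metis zero_neq_one)
    then have supp: "{x. \<omega> x \<noteq> (\<lambda>_. 0)} = {x. \<rho> x \<noteq> 0}" by blast
    have "alternating_form CARD('n) (\<omega> x)" for x
      unfolding \<omega>_def by (rule alternating_form_scale[OF frame_det_alternating])
    moreover have "C_infinity (\<lambda>x. \<omega> x v)" for v
      unfolding \<omega>_def C_infinity_def by (intro allI C_k_mult C_k_const C_infinityD[OF \<rho>(1)])
    ultimately have test: "\<omega> \<in> test_forms CARD('n) V" "\<omega> \<in> test_forms CARD('n) UNIV"
      unfolding test_forms_def mem_Collect_eq supp using \<rho>(2,3) by auto
    have "W \<omega> = 0" using V test(1) by (auto simp: \<F>_def)
    then show "(\<integral>x. f x * \<rho> x \<partial>lborel) = 0"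
      using W[OF test(2)] by (simp add: \<omega>_def frame_det_std)
  qed
  obtain \<F>' where \<F>': "\<F>' \<subseteq> \<F>" "countable \<F>'" "\<Union>\<F>' = \<Union>\<F>"
    using Lindelof[of \<F>] by (auto simp: \<F>_def)
  have "AE x in lborel. \<forall>V\<in>\<F>'. x \<in> V \<longrightarrow> f x = 0"
    using ae \<F>'(1) by (subst AE_ball_countable[OF \<F>'(2)]) blast
  then show ?thesis
  proof eventually_elim
    case (elim x)
    show ?case
    proof
      assume "x \<notin> current_support CARD('n) W"
      then obtain V where V: "open V" "\<And>\<omega>. \<omega> \<in> test_forms CARD('n) V \<Longrightarrow> W \<omega> = 0" "x \<in> V"
        by (auto simp: current_support_def)
      have "test_forms CARD('n) (V \<inter> ball 0 (norm x + 1)) \<subseteq> test_forms CARD('n) V"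
        by (auto simp: test_forms_def)
      then have "V \<inter> ball 0 (norm x + 1) \<in> \<F>"
        using V by (auto simp: \<F>_def)
      moreover have "x \<in> V \<inter> ball 0 (norm x + 1)" using V(3) by simp
      ultimately have "x \<in> \<Union>\<F>'" using \<F>'(3) by blast
      then show "f x = 0" using elim by blast
    qed
  qed
qed

lemma integral_indicator_borel:
  fixes g :: "real^'n \<Rightarrow> real"
  assumes "A \<in> sets borel" "continuous_on UNIV g"
  shows "(LINT x:A|lebesgue. g x) = (\<integral>x. indicator A x * g x \<partial>lborel)"
  unfolding set_lebesgue_integral_def
  using assms borel_measurable_continuous_onI[OF assms(2)] by (subst integral_completion) auto

text \<open>A competitor is the boundary of the current of an integer multiplicity function. Its truncation
  to \<open>[0, 1]\<close> is the indicator of a set that differs from \<open>{G < 0}\<close> only on the support of \<open>W\<close>,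
  and has no larger mass.\<close>

theorem mass_minimizing:
  fixes G :: "real^('n::{finite,linorder}) \<Rightarrow> real"
  assumes "subcalibrated G Z"
  shows "locally_mass_minimizing (current_boundary CARD('n) (set_current {x. G x < 0}))"
  unfolding locally_mass_minimizing_def
proof (intro allI impI)
  interpret subcalibrated G Z by fact
  fix U :: "(real^('n::{finite,linorder})) set" and W :: "(real^('n::{finite,linorder})) current"
  let ?S = "current_boundary CARD('n) (set_current E)"
  let ?m = "current_mass (CARD('n) - 1) (\<lambda>\<omega>. ?S \<omega> + current_boundary CARD('n) W \<omega>) U"
  assume "open U \<and> bounded U \<and> integral_top_current W \<and>
    compact (current_support CARD('n) W) \<and> current_support CARD('n) W \<subseteq> U"
  then have U: "open U" "bounded U" and W: "integral_top_current W"
    and supp: "compact (current_support CARD('n) W)" "current_support CARD('n) W \<subseteq> U" by auto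
  define C where "C = current_support CARD('n) W"
  have C: "compact C" "C \<subseteq> U" using supp by (simp_all add: C_def)
  obtain \<theta> :: "real^('n::{finite,linorder}) \<Rightarrow> int" where \<theta>: "integrable lebesgue (\<lambda>x. real_of_int (\<theta> x))"
    and W_eq: "\<And>\<omega>. W \<omega> = (\<integral>x. real_of_int (\<theta> x) * \<omega> x std_frame \<partial>lebesgue)"
    using W unfolding integral_top_current_def by auto
  note \<theta>m = borel_measurable_integrable[OF \<theta>]
  obtain f0 where f0m: "f0 \<in> borel_measurable lborel" and \<theta>f0: "AE x in lborel. real_of_int (\<theta> x) = f0 x"
    using completion_ex_borel_measurable_real[OF \<theta>m] by blast
  have [measurable]: "f0 \<in> borel_measurable borel" using f0m by simp
  have f0: "integrable lborel f0"
  proof -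
    have "integrable lebesgue f0"
      using \<theta> measurable_completion[OF f0m] AE_completion[OF \<theta>f0]
        integrable_cong_AE[OF \<theta>m measurable_completion[OF f0m]] by simp
    then show ?thesis using integrable_completion[OF f0m] by simp
  qed
  have W_f0: "(\<integral>x. real_of_int (\<theta> x) * g x \<partial>lebesgue) = (\<integral>x. f0 x * g x \<partial>lborel)"
    if "continuous_on UNIV g" for g
    by (rule integral_density[OF \<theta>m _ \<theta>f0 that]) simp
  have off_C: "AE x in lborel. x \<notin> C \<longrightarrow> f0 x = 0"
    unfolding C_def
  proof (rule density_zero_off_support[OF f0])
    fix \<omega> :: "(real^('n::{finite,linorder})) dform" assume "\<omega> \<in> test_forms CARD('n) UNIV"
    then have "continuous_on UNIV (\<lambda>x. \<omega> x std_frame)"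
      by (intro C_k_0D[of 0] C_infinityD) (auto simp: test_forms_def)
    then show "W \<omega> = (\<integral>x. f0 x * \<omega> x std_frame \<partial>lborel)" unfolding W_eq by (rule W_f0)
  qed
  have E: "E \<in> sets borel"
    by (intro borel_open open_Collect_less continuous_intros C_k_0D[OF G_smooth])
  have Cb: "C \<in> sets borel" using C(1) by (simp add: borel_compact)
  note [measurable] = E Cb
  \<comment> \<open>The competitor as a functional of the field instead of the form.\<close>
  have boundary: "?S \<omega> + current_boundary CARD('n) W \<omega> = (LINT x:E|lebesgue. divergence (field_of_form \<omega>) x)
      + (\<integral>x. f0 x * divergence (field_of_form \<omega>) x \<partial>lborel)"
      "?S \<omega> = (LINT x:E|lebesgue. divergence (field_of_form \<omega>) x)"
    if \<omega>: "\<omega> \<in> test_forms (CARD('n) - 1) U" for \<omega>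
  proof -
    have smooth: "C_infinity (field_of_form \<omega>)" by (rule field_of_form_smooth[OF \<omega>])
    have ed: "ext_deriv (CARD('n) - 1) \<omega> x std_frame = divergence (field_of_form \<omega>) x" for x
      by (rule ext_deriv_divergence[OF _ smooth]) (use \<omega> in \<open>simp add: test_forms_def\<close>)
    show "?S \<omega> = (LINT x:E|lebesgue. divergence (field_of_form \<omega>) x)"
      unfolding current_boundary_def set_current_def ed ..
    moreover have "current_boundary CARD('n) W \<omega> = (\<integral>x. f0 x * divergence (field_of_form \<omega>) x \<partial>lborel)"
      unfolding current_boundary_def W_eq ed
      by (rule W_f0[OF continuous_divergence[OF C_infinityD[OF smooth]]])
    ultimately show "?S \<omega> + current_boundary CARD('n) W \<omega> = (LINT x:E|lebesgue. divergence (field_of_form \<omega>) x)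
      + (\<integral>x. f0 x * divergence (field_of_form \<omega>) x \<partial>lborel)" by simp
  qed
  show "current_mass (CARD('n) - 1) ?S U \<le> ?m"
    unfolding current_mass_def[of _ ?S]
  proof (rule SUP_least)
    fix \<omega>0 assume "\<omega>0 \<in> {\<omega> \<in> test_forms (CARD('n) - 1) U. \<forall>x. comass (CARD('n) - 1) (\<omega> x) \<le> 1}"
    then have \<omega>0: "\<omega>0 \<in> test_forms (CARD('n) - 1) U" "\<And>x. comass (CARD('n) - 1) (\<omega>0 x) \<le> 1" by auto
    have upper: "ereal (?S \<omega> + current_boundary CARD('n) W \<omega>) \<le> ?m"
      if "\<omega> \<in> test_forms (CARD('n) - 1) U" "\<And>x. comass (CARD('n) - 1) (\<omega> x) \<le> 1" for \<omega>
      unfolding current_mass_def by (rule SUP_upper) (use that in auto)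
    show "ereal (?S \<omega>0) \<le> ?m"
    proof (cases ?m)
      case MInf
      then show ?thesis using upper[OF \<omega>0] by simp
    next
      case (real M)
      define T where "T = field_of_form \<omega>0"
      have T: "T \<in> test_fields U" unfolding T_def by (rule field_of_form_test_field[OF \<omega>0(1)])
      have T1: "norm (T x) \<le> 1" for x
        unfolding T_def using \<omega>0 by (intro norm_field_of_form_le) (auto simp: test_forms_def)
      define K where "K = (E - C) \<union> {x \<in> C. indicator E x + f0 x \<ge> 1}"
      have Kb: "K \<in> sets borel" unfolding K_def by measurable
      then have K: "K \<in> sets lebesgue" by auto
      have KC: "(K - E) \<union> (E - K) \<subseteq> C" by (auto simp: K_def)
      obtain R where R: "\<And>x. x \<in> U \<Longrightarrow> norm x \<le> R" using U(2) by (auto simp: bounded_iff)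
      have vanish: "vanishes_beyond R Y" if "Y \<in> test_fields U" for Y :: "real^('n::{finite,linorder}) \<Rightarrow> real^('n::{finite,linorder})"
        unfolding vanishes_beyond_def
      proof (intro allI impI, rule ccontr)
        fix x assume "norm x > R" "Y x \<noteq> 0"
        then have "x \<in> U" using test_fieldsD(3)[OF that] closure_subset[of "{x. Y x \<noteq> 0}"] by blast
        then show False using R \<open>norm x > R\<close> by force
      qed
      define f where "f x = indicator (E \<inter> cball 0 R) x + indicator C x * f0 x" for x
      have f: "integrable lborel f"
      proof -
        have "integrable lborel (\<lambda>x. indicator (E \<inter> cball 0 R) x :: real)"
          using integrable_mult_indicator[of E lborel "\<lambda>x. 1 * indicator (cball 0 R) x :: real"]
            integrable_lborel_cball_indicator[of 1 0 R] by (simp add: indicator_inter_arith)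
        moreover have "integrable lborel (\<lambda>x. indicator C x * f0 x)"
          using integrable_mult_indicator[of C lborel f0] f0 by simp
        ultimately show ?thesis unfolding f_def[abs_def] by simp
      qed
      have fR: "vanishes_beyond R f"
        unfolding vanishes_beyond_def f_def using R C(2) by (fastforce simp: indicator_def)
      have mass: "(\<integral>x. f x * divergence Y x \<partial>lborel) \<le> M"
        if Y: "Y \<in> test_fields U" "C_infinity Y" "\<And>x. norm (Y x) \<le> 1" for Y
      proof -
        have divY: "continuous_on UNIV (divergence Y)" by (rule continuous_divergence[OF test_fieldsD(1)[OF Y(1)]])
        have divR: "vanishes_beyond R (divergence Y)" by (rule vanishes_beyond_divergence[OF vanish[OF Y(1)]])
        obtain B where B: "\<And>x. norm (divergence Y x) \<le> B" using continuous_vanishing_bounded[OF divY divR] by blast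
        have int1: "integrable lborel (\<lambda>x. indicator E x * divergence Y x)"
          using integrable_mult_indicator[of E lborel "divergence Y"] integrable_lborel_continuous_vanishing[OF divY divR]
          by simp
        have int2: "integrable lborel (\<lambda>x. f0 x * divergence Y x)"
          by (rule integrable_mult_bounded_continuous[OF f0 divY, of B]) (use B in simp)
        have "(\<integral>x. f x * divergence Y x \<partial>lborel)
          = (\<integral>x. indicator E x * divergence Y x + f0 x * divergence Y x \<partial>lborel)"
        proof (rule integral_cong_AE)
          show "(\<lambda>x. f x * divergence Y x) \<in> borel_measurable lborel"
            using borel_measurable_integrable[OF f] borel_measurable_continuous_onI[OF divY] by simp
          show "(\<lambda>x. indicator E x * divergence Y x + f0 x * divergence Y x) \<in> borel_measurable lborel"
            using int1 int2 by (intro borel_measurable_integrable) simp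
          show "AE x in lborel. f x * divergence Y x = indicator E x * divergence Y x + f0 x * divergence Y x"
            using off_C
          proof eventually_elim
            case (elim x)
            show ?case
            proof (cases "norm x \<le> R")
              case True
              then show ?thesis using elim by (auto simp: f_def indicator_def algebra_simps)
            next
              case False
              then have "divergence Y x = 0" using divR by (simp add: vanishes_beyond_def)
              then show ?thesis by simp
            qed
          qed
        qed
        also have "\<dots> = (LINT x:E|lebesgue. divergence Y x) + (\<integral>x. f0 x * divergence Y x \<partial>lborel)"
          using int1 int2 by (simp add: integral_indicator_borel[OF E divY])
        also have "\<dots> = ?S (form_of_field Y) + current_boundary CARD('n) W (form_of_field Y)"
          using boundary(1)[OF form_of_field_test_form[OF Y(1,2)]] by (simp add: field_of_form_of_field)
        finally have "ereal (\<integral>x. f x * divergence Y x \<partial>lborel) \<le> ?m"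
          using upper[OF form_of_field_test_form[OF Y(1,2)] comass_form_of_field[of Y, OF Y(3)]] by simp
        then show ?thesis unfolding real by simp
      qed
      have "(LINT x:E|lebesgue. divergence T x) \<le> M"
      proof (rule field_le_epsilon)
        fix e :: real assume e: "e > 0"
        obtain X where X: "X \<in> test_fields U" "\<And>x. norm (X x) \<le> 1"
          and le: "(LINT x:E|lebesgue. divergence T x) \<le> (LINT x:K|lebesgue. divergence X x) + e"
          by (rule calibration[OF U(1) T T1 C K KC e]) (rule that)
        have divX: "continuous_on UNIV (divergence X)" by (rule continuous_divergence[OF test_fieldsD(1)[OF X(1)]])
        have divR: "vanishes_beyond R (divergence X)" by (rule vanishes_beyond_divergence[OF vanish[OF X(1)]])
        have "(LINT x:K|lebesgue. divergence X x) = (\<integral>x. indicator K x * divergence X x \<partial>lborel)"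
          by (rule integral_indicator_borel[OF Kb divX])
        also have "\<dots> = (\<integral>x. max 0 (min 1 (f x)) * divergence X x \<partial>lborel)"
        proof (rule integral_cong_AE)
          note [measurable] = borel_measurable_continuous_onI[OF divX] Kb
          show "(\<lambda>x. indicator K x * divergence X x) \<in> borel_measurable lborel" by measurable
          show "(\<lambda>x. max 0 (min 1 (f x)) * divergence X x) \<in> borel_measurable lborel"
            using borel_measurable_integrable[OF f] borel_measurable_continuous_onI[OF divX] by simp
          show "AE x in lborel. indicator K x * divergence X x = max 0 (min 1 (f x)) * divergence X x"
            using \<theta>f0
          proof eventually_elim
            case (elim x)
            show ?case
            proof (cases "norm x \<le> R")
              case True
              have "indicator K x = max 0 (min 1 (f x))"
              proof (cases "x \<in> C")
                case True
                define k where "k = \<theta> x + (if x \<in> E then 1 else 0)"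
                have fk: "f x = real_of_int k"
                  using True \<open>norm x \<le> R\<close> elim by (auto simp: f_def k_def indicator_def)
                have "x \<in> K \<longleftrightarrow> 1 \<le> real_of_int k"
                  using True elim by (auto simp: K_def k_def indicator_def)
                then show ?thesis unfolding fk by (cases "k \<ge> 1") (auto simp: indicator_def)
              next
                case False
                then show ?thesis using True by (auto simp: f_def K_def indicator_def)
              qed
              then show ?thesis by simp
            next
              case False
              then have "divergence X x = 0" using divR by (simp add: vanishes_beyond_def)
              then show ?thesis by simp
            qed
          qed
        qed
        also have "\<dots> \<le> M" by (rule truncation_flux[OF f fR U(1) X mass])
        finally show "(LINT x:E|lebesgue. divergence T x) \<le> M + e" using le by linarith
      qed
      then show ?thesis unfolding real boundary(2)[OF \<omega>0(1)] T_def by simp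
    qed simp
  qed
qed


section \<open>Minimality of the negativity set\<close>

theorem proposition9p1:
  fixes \<phi> :: "real^('n::{finite,linorder}) \<Rightarrow> real^'m"
    and lam \<eta> G :: "real^('n::{finite,linorder}) \<Rightarrow> real"
    and H W :: "real^'m \<Rightarrow> real"
    and d l :: nat
  assumes "d \<ge> 1"
    and "polynomial_harmonic_morphism d \<phi> lam"
    and "\<And>x. x \<in> regular_set \<phi> \<Longrightarrow>
           frechet_derivative \<phi> (at x) (grad (\<lambda>y. (lam y)\<^sup>2) x) = \<eta> x *\<^sub>R \<phi> x"
    and "l > 0"
    and "homogeneous_polynomial l H"
    and "\<exists>y. H y \<noteq> 0"
    and "G = H \<circ> \<phi>"
    and "W = (\<lambda>y. (norm (grad H y))\<^sup>2)"
  shows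
    "(\<forall>x\<in>regular_set \<phi>.
        (norm (grad G x))\<^sup>2 = (lam x)\<^sup>2 * W (\<phi> x) \<and>
        laplacian G x = (lam x)\<^sup>2 * laplacian H (\<phi> x) \<and>
        level_op G x = (lam x)^4 * level_op H (\<phi> x) - real l * \<eta> x / 2 * (H (\<phi> x) * W (\<phi> x)))
     \<and>
     (\<forall>\<kappa>::real.
        (\<forall>x\<in>regular_set \<phi>. \<phi> x \<noteq> 0 \<longrightarrow> (norm (\<phi> x))\<^sup>2 * \<eta> x / (2 * (lam x)^4) \<le> \<kappa>) \<and>
        (\<forall>y. y \<noteq> 0 \<longrightarrow> (norm y)\<^sup>2 * H y * level_op H y \<ge> \<kappa> * real l * (H y)\<^sup>2 * W y)
        \<longrightarrow>
        (\<forall>x\<in>regular_set \<phi>. \<phi> x \<noteq> 0 \<longrightarrow> G x * level_op G x \<ge> 0) \<and>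
        (\<forall>Z. (\<exists>x. G x \<noteq> 0) \<and>
             algebraic_set Z \<and> algebraic_dim Z \<le> ereal (real CARD('n) - 2) \<and>
             {x. grad G x = 0} \<union> {x. G x = 0 \<and> grad G x = 0} \<union> (- regular_set \<phi>) \<union> {x. \<phi> x = 0} \<subseteq> Z
             \<longrightarrow> locally_perimeter_minimizing {x. G x < 0} \<and>
                 locally_mass_minimizing
                   (current_boundary CARD('n) (set_current {x. G x < 0}))))"
proof -
  interpret harmonic_morphism d \<phi> lam by unfold_locales fact
  have G: "G = (\<lambda>y. H (\<phi> y))" using assms(7) by (simp add: o_def)
  have H_smooth: "C_k k H" for k
    by (rule C_k_real_polynomial[OF homogeneous_polynomial_real_polynomial[OF assms(5)]])
  have G_smooth: "C_infinity G"
    unfolding G C_infinity_def by (rule allI) (rule C_k_compose[OF H_smooth smooth])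
  have dH: "H differentiable (at y)" for y by (rule C_1_differentiable[OF H_smooth])
  have identities: "(norm (grad G x))\<^sup>2 = (lam x)\<^sup>2 * W (\<phi> x) \<and>
        laplacian G x = (lam x)\<^sup>2 * laplacian H (\<phi> x) \<and>
        level_op G x = (lam x)^4 * level_op H (\<phi> x) - real l * \<eta> x / 2 * (H (\<phi> x) * W (\<phi> x))"
    if x: "x \<in> regular_set \<phi>" for x
    unfolding G assms(8) power2_norm_eq_inner grad_inner_grad[OF dH dH] laplacian_compose[OF H_smooth]
      level_op_compose[OF assms(5) assms(3)[OF x]] by simp
  have sign: "G x * level_op G x \<ge> 0"
    if \<kappa>: "\<And>x. x \<in> regular_set \<phi> \<Longrightarrow> \<phi> x \<noteq> 0 \<Longrightarrow> (norm (\<phi> x))\<^sup>2 * \<eta> x / (2 * (lam x)^4) \<le> \<kappa>"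
      and ineq: "\<And>y. y \<noteq> 0 \<Longrightarrow> (norm y)\<^sup>2 * H y * level_op H y \<ge> \<kappa> * real l * (H y)\<^sup>2 * W y"
      and x: "x \<in> regular_set \<phi>" "\<phi> x \<noteq> 0" for \<kappa> x
    unfolding G
    by (rule level_op_sign[OF assms(5) assms(3)[OF x(1)] x \<kappa>[OF x]]) (use ineq[OF x(2)] in \<open>simp add: assms(8)\<close>)
  have \<phi>0: "\<phi> 0 = 0"
  proof -
    have "homogeneous_polynomial d (\<lambda>x. \<phi> x $ i)" for i
      using assms(2) by (simp add: polynomial_harmonic_morphism_def)
    from homogeneous_polynomial_scaleR[OF this, of 0] show ?thesis
      using assms(1) by (simp add: vec_eq_iff power_0_left)
  qed
  have minimizing: "locally_perimeter_minimizing {x. G x < 0} \<and>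
      locally_mass_minimizing (current_boundary CARD('n) (set_current {x. G x < 0}))"
    if pos: "\<And>x. x \<in> regular_set \<phi> \<Longrightarrow> \<phi> x \<noteq> 0 \<Longrightarrow> G x * level_op G x \<ge> 0"
      and Z: "algebraic_set Z" "algebraic_dim Z \<le> ereal (real CARD('n) - 2)"
        "{x. grad G x = 0} \<union> {x. G x = 0 \<and> grad G x = 0} \<union> (- regular_set \<phi>) \<union> {x. \<phi> x = 0} \<subseteq> Z" for Z
  proof -
    \<comment> \<open>The origin is an excluded point, so \<open>Z\<close> is nonempty and the ambient dimension is at least 2.\<close>
    have "Z \<noteq> {}" using Z(3) \<phi>0 by blast
    then have N: "CARD('n) \<ge> 2" using Z(2) by (rule algebraic_dim_imp_card)
    have sub: "subcalibrated G Z"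
    proof
      show "CARD('n) \<ge> 2" by (rule N)
      show "C_infinity G" by (rule G_smooth)
      show "closed Z" by (rule algebraic_set_closed[OF Z(1)])
      show "codim1_null Z" by (rule algebraic_codim_two_null[OF N Z(2)])
      show "grad G x \<noteq> 0" if "x \<notin> Z" for x using that Z(3) by blast
      show "G x * level_op G x \<ge> 0" if "x \<notin> Z" for x using that Z(3) by (intro pos) blast+
    qed
    show ?thesis
      using subcalibrated.perimeter_minimizing[OF sub] mass_minimizing[OF sub] by blast
  qed
  show ?thesis
  proof (intro conjI ballI allI impI)
    fix x assume "x \<in> regular_set \<phi>"
    then show "(norm (grad G x))\<^sup>2 = (lam x)\<^sup>2 * W (\<phi> x)" "laplacian G x = (lam x)\<^sup>2 * laplacian H (\<phi> x)"
      "level_op G x = (lam x)^4 * level_op H (\<phi> x) - real l * \<eta> x / 2 * (H (\<phi> x) * W (\<phi> x))"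
      using identities by blast+
  next
    fix \<kappa> :: real and x
    assume hyp: "(\<forall>x\<in>regular_set \<phi>. \<phi> x \<noteq> 0 \<longrightarrow> (norm (\<phi> x))\<^sup>2 * \<eta> x / (2 * (lam x)^4) \<le> \<kappa>) \<and>
        (\<forall>y. y \<noteq> 0 \<longrightarrow> (norm y)\<^sup>2 * H y * level_op H y \<ge> \<kappa> * real l * (H y)\<^sup>2 * W y)"
      and "x \<in> regular_set \<phi>" "\<phi> x \<noteq> 0"
    then show "G x * level_op G x \<ge> 0" using sign[of \<kappa> x] by blast
  next
    fix \<kappa> :: real and Z
    assume hyp: "(\<forall>x\<in>regular_set \<phi>. \<phi> x \<noteq> 0 \<longrightarrow> (norm (\<phi> x))\<^sup>2 * \<eta> x / (2 * (lam x)^4) \<le> \<kappa>) \<and>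
        (\<forall>y. y \<noteq> 0 \<longrightarrow> (norm y)\<^sup>2 * H y * level_op H y \<ge> \<kappa> * real l * (H y)\<^sup>2 * W y)"
      and Z: "(\<exists>x. G x \<noteq> 0) \<and> algebraic_set Z \<and> algebraic_dim Z \<le> ereal (real CARD('n) - 2) \<and>
        {x. grad G x = 0} \<union> {x. G x = 0 \<and> grad G x = 0} \<union> (- regular_set \<phi>) \<union> {x. \<phi> x = 0} \<subseteq> Z"
    have pos: "G x * level_op G x \<ge> 0" if "x \<in> regular_set \<phi>" "\<phi> x \<noteq> 0" for x
      using hyp that sign[of \<kappa> x] by blast
    note * = minimizing[OF pos, of Z]
    show "locally_perimeter_minimizing {x. G x < 0}" using * Z by blast
    show "locally_mass_minimizing (current_boundary CARD('n) (set_current {x. G x < 0}))" using * Z by blast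
  qed
qed

end
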